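(* Let $n\ge3$. If $\Omega\subset\mathbb{R}^n$ is a domain such that $\partial_*\Omega=\partial\Omega$, $\partial\Omega$ is $(n-1)$-Ahlfors regular, and $\nu_\Omega\in VMO_{\mathrm{loc}}(\mathcal{H}^{n-1}\llcorner\partial\Omega)$, then $\partial\Omega$ is a vanishing Reifenberg flat set.
   Context: A domain is an open connected set. $\partial_*\Omega$ is the measure-theoretic (essential) boundary and $\nu_\Omega$ the measure-theoretic outer unit normal, defined on the reduced boundary of the set of locally finite perimeter $\Omega$ (a domain with Ahlfors regular boundary has locally finite perimeter). A closed set $F\subset\mathbb{R}^n$ is $(n-1)$-Ahlfors regular if there is $C_A\ge1$ with $C_A^{-1}r^{n-1}\le\mathcal{H}^{n-1}(F\cap B(x,r))\le C_Ar^{n-1}$ for all $x\in F$, $0<r<\operatorname{diam}F$. For such $F$ and $f\in L^2_{\mathrm{loc}}(\mathcal{H}^{n-1}\llcorner F)$ put $$\|f\|_*(x,r)=\sup_{0<s<r}\Big(\frac{1}{\mathcal{H}^{n-1}(B(x,s)\cap F)}\int_{B(x,s)\cap F}|f-f_{x,s}|^2\,d\mathcal{H}^{n-1}\Big)^{1/2},$$ with $f_{x,s}$ the average of $f$ over $B(x,s)\cap F$; $f\in VMO_{\mathrm{loc}}(\mathcal{H}^{n-1}\llcorner F)$ if $\lim_{r\to0}\sup_{x\in F\cap K}\|f\|_*(x,r)=0$ for every compact $K\subset\mathbb{R}^n$. For a closed set $\Sigma$, $x\in\Sigma$, $r>0$: $\Theta(x,r)=\inf_L\frac1rD[\Sigma\cap\overline{B(x,r)},L\cap\overline{B(x,r)}]$,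 the infimum over all $(n-1)$-planes $L\ni x$, with $D[A,B]=\sup_{a\in A}d(a,B)+\sup_{b\in B}d(b,A)$. $\Sigma$ is a vanishing Reifenberg flat set if for every compact $K\subset\mathbb{R}^n$, $\lim_{r\to0}\sup_{x\in\Sigma\cap K}\Theta(x,r)=0$. *)

theory Defs
  imports "HOL-Analysis.Analysis"
begin

section \<open>Hausdorff measure\<close>

text \<open>The library's \<open>diameter\<close> is only meaningful for bounded sets; the extended version takes the
  value \<open>\<infinity>\<close> on unbounded ones.\<close>

definition ediam :: "'a::metric_space set \<Rightarrow> ennreal" where
  "ediam A = (SUP x\<in>A. SUP y\<in>A. ennreal (dist x y))"

text \<open>The term of an empty covering set is forced to be \<open>0\<close> because of \<open>0 ^ 0 = 1\<close>. The constant
  makes \<open>k\<close>-dimensional Hausdorff measure agree with Lebesgue measure for \<open>k = n\<close>.\<close>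

definition hausdorff_content :: "nat \<Rightarrow> real \<Rightarrow> 'a::metric_space set \<Rightarrow> ennreal" where
  "hausdorff_content k \<delta> A =
     (INF C \<in> {C :: nat \<Rightarrow> 'a set. A \<subseteq> (\<Union>i. C i) \<and> (\<forall>i. ediam (C i) \<le> ennreal \<delta>)}.
        \<Sum>i. if C i = {} then 0
             else ennreal (unit_ball_vol (real k) / 2 ^ k) * ediam (C i) ^ k)"

definition hausdorff_outer :: "nat \<Rightarrow> 'a::metric_space set \<Rightarrow> ennreal" where
  "hausdorff_outer k A = (SUP \<delta>\<in>{0<..}. hausdorff_content k \<delta> A)"

text \<open>The set function \<open>hausdorff_outer k\<close> is a metric outer measure, hence countably additive on
  the Borel sets by Caratheodory's criterion; so \<open>measure_of\<close> does not fall back to the zero measure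
  here.\<close>

definition hausdorff_measure :: "nat \<Rightarrow> 'a::metric_space measure" where
  "hausdorff_measure k = measure_of UNIV (sets borel) (hausdorff_outer k)"

abbreviation surface_measure :: "'a::euclidean_space measure" where
  "surface_measure \<equiv> hausdorff_measure (DIM('a) - 1)"


section \<open>Essential boundary\<close>

definition has_density_at :: "'a::euclidean_space set \<Rightarrow> 'a \<Rightarrow> real \<Rightarrow> bool" where
  "has_density_at E x t \<longleftrightarrow>
     ((\<lambda>r. measure lebesgue (E \<inter> ball x r) / measure lebesgue (ball x r)) \<longlongrightarrow> t) (at_right 0)"

definition essential_boundary :: "'a::euclidean_space set \<Rightarrow> 'a set" where
  "essential_boundary E = {x. \<not> has_density_at E x 0 \<and> \<not> has_density_at E x 1}"


section \<open>Sets of locally finite perimeter, reduced boundary, outer unit normal\<close>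

definition divergence :: "('a::euclidean_space \<Rightarrow> 'a) \<Rightarrow> 'a \<Rightarrow> real" where
  "divergence \<phi> x = (\<Sum>b\<in>Basis. frechet_derivative \<phi> (at x) b \<bullet> b)"

definition C1_compact_support :: "('a::euclidean_space \<Rightarrow> 'a) \<Rightarrow> bool" where
  "C1_compact_support \<phi> \<longleftrightarrow>
     (\<forall>x. \<phi> differentiable at x) \<and>
     (\<forall>b\<in>Basis. continuous_on UNIV (\<lambda>x. frechet_derivative \<phi> (at x) b)) \<and>
     compact (closure {x. \<phi> x \<noteq> 0})"

text \<open>The distributional gradient of \<open>indicator E\<close> is the vector-valued Radon measure
  \<open>- \<sigma> \<mu>\<close>, given in polar form: \<open>\<mu>\<close> is its total variation (the perimeter measure of \<open>E\<close>)
  and \<open>\<sigma>\<close> has unit length \<open>\<mu>\<close>-almost everywhere. The sign makes \<open>\<sigma>\<close> point out of \<open>E\<close>.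
  By the Riesz theorem \<open>\<mu>\<close> is determined by \<open>E\<close>, and \<open>\<sigma>\<close> is determined \<open>\<mu>\<close>-a.e.\<close>

definition gauss_green ::
  "'a::euclidean_space set \<Rightarrow> 'a measure \<Rightarrow> ('a \<Rightarrow> 'a) \<Rightarrow> bool" where
  "gauss_green E \<mu> \<sigma> \<longleftrightarrow>
     sets \<mu> = sets borel \<and>
     (\<forall>K. compact K \<longrightarrow> emeasure \<mu> K < \<infinity>) \<and>
     \<sigma> \<in> borel_measurable borel \<and>
     (AE x in \<mu>. norm (\<sigma> x) = 1) \<and>
     (\<forall>\<phi>. C1_compact_support \<phi> \<longrightarrow>
        (LINT x:E|lebesgue. divergence \<phi> x) = (LINT x|\<mu>. \<phi> x \<bullet> \<sigma> x))"

definition locally_finite_perimeter :: "'a::euclidean_space set \<Rightarrow> bool" where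
  "locally_finite_perimeter E \<longleftrightarrow> E \<in> sets lebesgue \<and> (\<exists>\<mu> \<sigma>. gauss_green E \<mu> \<sigma>)"

text \<open>De Giorgi's definition: \<open>x\<close> lies in the support of the perimeter measure and the averages of
  the measure-theoretic normal over small balls converge to a unit vector \<open>v\<close>.\<close>

definition has_outer_normal :: "'a::euclidean_space set \<Rightarrow> 'a \<Rightarrow> 'a \<Rightarrow> bool" where
  "has_outer_normal E x v \<longleftrightarrow>
     locally_finite_perimeter E \<and> norm v = 1 \<and>
     (\<exists>\<mu> \<sigma>. gauss_green E \<mu> \<sigma> \<and>
        (\<forall>r>0. measure \<mu> (ball x r) > 0) \<and>
        ((\<lambda>r. (LINT y:ball x r|\<mu>. \<sigma> y) /\<^sub>R measure \<mu> (ball x r)) \<longlongrightarrow> v) (at_right 0))"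

definition reduced_boundary :: "'a::euclidean_space set \<Rightarrow> 'a set" where
  "reduced_boundary E = {x. \<exists>v. has_outer_normal E x v}"

text \<open>The value \<open>0\<close> off the reduced boundary is a convention. By Federer's theorem the reduced
  boundary has full surface measure in the essential boundary of a set of locally finite
  perimeter, so the convention affects only a null set there.\<close>

definition outer_normal :: "'a::euclidean_space set \<Rightarrow> 'a \<Rightarrow> 'a" where
  "outer_normal E x = (if x \<in> reduced_boundary E then THE v. has_outer_normal E x v else 0)"


section \<open>Ahlfors regular sets\<close>

definition ahlfors_regular :: "'a::euclidean_space set \<Rightarrow> bool" where
  "ahlfors_regular F \<longleftrightarrow>
     closed F \<and>
     (\<exists>C\<ge>1. \<forall>x\<in>F. \<forall>r>0. ennreal r < ediam F \<longrightarrow>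
        ennreal (r ^ (DIM('a) - 1) / C) \<le> emeasure surface_measure (F \<inter> ball x r) \<and>
        emeasure surface_measure (F \<inter> ball x r) \<le> ennreal (C * r ^ (DIM('a) - 1)))"


section \<open>Vanishing mean oscillation\<close>

definition L2_loc :: "'a::euclidean_space set \<Rightarrow> ('a \<Rightarrow> 'b::euclidean_space) \<Rightarrow> bool" where
  "L2_loc F f \<longleftrightarrow>
     f \<in> borel_measurable (restrict_space surface_measure F) \<and>
     (\<forall>K. compact K \<longrightarrow> set_integrable surface_measure (K \<inter> F) (\<lambda>y. (norm (f y))\<^sup>2))"

definition ball_average ::
  "'a::euclidean_space set \<Rightarrow> ('a \<Rightarrow> 'b::euclidean_space) \<Rightarrow> 'a \<Rightarrow> real \<Rightarrow> 'b" where
  "ball_average F f x s =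
     (LINT y:ball x s \<inter> F|surface_measure. f y) /\<^sub>R measure surface_measure (ball x s \<inter> F)"

text \<open>Suprema are taken in \<open>ennreal\<close>, so that the supremum of an empty family is \<open>0\<close> and that of an
  unbounded family is \<open>\<infinity>\<close>.\<close>

definition osc_norm ::
  "'a::euclidean_space set \<Rightarrow> ('a \<Rightarrow> 'b::euclidean_space) \<Rightarrow> 'a \<Rightarrow> real \<Rightarrow> ennreal" where
  "osc_norm F f x r =
     (SUP s\<in>{0<..<r}. ennreal (sqrt
        (ball_average F (\<lambda>y. (norm (f y - ball_average F f x s))\<^sup>2) x s)))"

definition VMO_loc :: "'a::euclidean_space set \<Rightarrow> ('a \<Rightarrow> 'b::euclidean_space) \<Rightarrow> bool" where
  "VMO_loc F f \<longleftrightarrow>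
     L2_loc F f \<and>
     (\<forall>K. compact K \<longrightarrow> ((\<lambda>r. SUP x\<in>F \<inter> K. osc_norm F f x r) \<longlongrightarrow> 0) (at_right 0))"


section \<open>Vanishing Reifenberg flat sets\<close>

definition two_sided_dist :: "'a::metric_space set \<Rightarrow> 'a set \<Rightarrow> real" where
  "two_sided_dist A B = (SUP a\<in>A. infdist a B) + (SUP b\<in>B. infdist b A)"

definition flatness :: "'a::euclidean_space set \<Rightarrow> 'a \<Rightarrow> real \<Rightarrow> real" where
  "flatness S x r =
     (INF L\<in>{L. affine L \<and> aff_dim L = int (DIM('a)) - 1 \<and> x \<in> L}.
        two_sided_dist (S \<inter> cball x r) (L \<inter> cball x r) / r)"

text \<open>The flatness is nonnegative for \<open>x \<in> S\<close> and \<open>r > 0\<close>, so nothing is lost in passing to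
  \<open>ennreal\<close>, where the supremum over an empty set is \<open>0\<close>.\<close>

definition vanishing_reifenberg_flat :: "'a::euclidean_space set \<Rightarrow> bool" where
  "vanishing_reifenberg_flat S \<longleftrightarrow>
     closed S \<and>
     (\<forall>K. compact K \<longrightarrow> ((\<lambda>r. SUP x\<in>S \<inter> K. ennreal (flatness S x r)) \<longlongrightarrow> 0) (at_right 0))"

end

theory Submission
  imports Defs
begin

text \<open>Let \<open>M\<close> be surface measure on \<open>F = frontier \<Omega>\<close>; only its Ahlfors bounds are used, which
  spares Caratheodory's criterion. Writing the derivative of \<open>indicator \<Omega>\<close> as a limit of difference
  quotients, each of which lives in a small neighbourhood of \<open>F\<close>, yields a bounded \<open>g\<close> with
  \<open>\<integral>\<^sub>\<Omega> div \<phi> = \<integral> \<phi> \<bullet> g dM\<close>; the outer normal is \<open>sgn g\<close> at the Lebesgue points of \<open>g\<close> at which \<open>g\<close>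
  does not vanish.

  Smooth \<open>indicator \<Omega>\<close> at a scale \<open>s = \<eta> r\<close>. The result takes only the values \<open>0\<close> and \<open>1\<close> at distance \<open>s\<close>
  from \<open>F\<close>, and by the upper Ahlfors bound every ball of radius comparable to \<open>s\<close> contains such a point.
  If the normal is nearly a constant \<open>e\<close> on a ball of radius comparable to \<open>r\<close>, then the smoothed indicator
  is almost decreasing in direction \<open>e\<close>, almost constant in the directions orthogonal to \<open>e\<close>, and drops by a
  definite amount near each point of \<open>F\<close>. A function with values \<open>0\<close> and \<open>1\<close> can do so only once, hence
  \<open>F\<close> stays close to a hyperplane orthogonal to \<open>e\<close>. The same argument at a Lebesgue point bounds
  \<open>norm g\<close> from below where \<open>g \<noteq> 0\<close>; where \<open>g = 0\<close>, \<open>\<Omega>\<close> has density \<open>0\<close> or \<open>1\<close>, which the hypothesis on the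
  essential boundary excludes.\<close>

section \<open>Compactly supported test functions of class C1\<close>

text \<open>The hypothesis controls only the direction \<open>sgn g\<close> of the density, whereas
  the drop of the smoothed indicator near a point of \<open>F\<close> is an integral of
  \<open>norm g\<close>. This is why \<open>norm g\<close> needs a lower bound that does not vary
  with the point: the oscillation allowed in \<open>flatness_le\<close> is computed from it and has
  to serve a whole compact set at once. At a Lebesgue point the admissible radii do depend on the
  point and on \<open>g x\<close>, but the radius cancels from the conclusion and leaves
  \<open>perim_lower\<close>, made of \<open>A\<close> and the dimension alone. Parameters are fixed
  in the order flatness \<delta>, ratio of \<open>s\<close> to \<open>r\<close>, oscillation
  \<epsilon>, radius \<open>r\<close>. The error is integrated over a ball of radius comparable to
  \<open>r\<close>, the drop over one of radius comparable to \<open>s\<close>; so \<epsilon> must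
  be small against a power of \<open>s / r\<close>, and that ratio must be settled first.\<close>

definition C1 :: "('a::euclidean_space \<Rightarrow> real) \<Rightarrow> bool" where
  "C1 f \<longleftrightarrow> (\<exists>f'. (\<forall>x. (f has_derivative f' x) (at x)) \<and> (\<forall>v. continuous_on UNIV (\<lambda>x. f' x v)))"

definition C1c :: "('a::euclidean_space \<Rightarrow> real) \<Rightarrow> bool" where
  "C1c f \<longleftrightarrow> C1 f \<and> (\<exists>R. \<forall>x. R \<le> norm x \<longrightarrow> f x = 0)"

lemma C1I:
  assumes "\<And>x. (f has_derivative f' x) (at x)" "\<And>v. continuous_on UNIV (\<lambda>x. f' x v)"
  shows "C1 f"
  using assms unfolding C1_def by blast

text \<open>Uniqueness of derivatives identifies any witness of \<open>C1\<close> with the Frechet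
  derivative. Continuity is asked for one direction \<open>v\<close> at a time; in finite dimension
  this is continuity in operator norm, without the type of bounded linear maps.\<close>

lemma C1_frechet:
  assumes "C1 f"
  shows "(f has_derivative frechet_derivative f (at x)) (at x)"
    and "continuous_on UNIV (\<lambda>x. frechet_derivative f (at x) v)"
proof -
  obtain f' where f': "\<And>x. (f has_derivative f' x) (at x)" "\<And>v. continuous_on UNIV (\<lambda>x. f' x v)"
    using assms unfolding C1_def by blast
  have "frechet_derivative f (at x) = f' x" for x
    using frechet_derivative_at[OF f'(1)] by simp
  then show "(f has_derivative frechet_derivative f (at x)) (at x)"
    and "continuous_on UNIV (\<lambda>x. frechet_derivative f (at x) v)"
    using f' by simp_all
qed

lemma C1_continuous: "C1 f \<Longrightarrow> continuous_on A f"
  by (metis C1_frechet(1) has_derivative_continuous continuous_at_imp_continuous_on)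

lemma C1_const [simp]: "C1 (\<lambda>x. c)"
  by (rule C1I[where f'="\<lambda>x v. 0"]) (auto intro: derivative_eq_intros)

lemma C1_add:
  assumes "C1 f" "C1 g"
  shows "C1 (\<lambda>x. f x + g x)"
proof (rule C1I)
  fix x v
  show "((\<lambda>x. f x + g x) has_derivative
      (\<lambda>v. frechet_derivative f (at x) v + frechet_derivative g (at x) v)) (at x)"
    by (intro has_derivative_add C1_frechet assms)
  show "continuous_on UNIV (\<lambda>x. frechet_derivative f (at x) v + frechet_derivative g (at x) v)"
    by (intro continuous_on_add C1_frechet assms)
qed

lemma C1_mult:
  assumes "C1 f" "C1 g"
  shows "C1 (\<lambda>x. f x * g x)"
proof (rule C1I)
  fix x v
  show "((\<lambda>x. f x * g x) has_derivative
      (\<lambda>v. f x * frechet_derivative g (at x) v + frechet_derivative f (at x) v * g x)) (at x)"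
    by (intro has_derivative_mult C1_frechet assms)
  show "continuous_on UNIV
      (\<lambda>x. f x * frechet_derivative g (at x) v + frechet_derivative f (at x) v * g x)"
    by (intro continuous_intros C1_frechet C1_continuous assms)
qed

lemma C1_diff:
  assumes "C1 f" "C1 g"
  shows "C1 (\<lambda>x. f x - g x)"
  using C1_add[OF assms(1) C1_mult[OF C1_const[of "-1"] assms(2)]] by simp

lemma C1_prod: "(\<And>i. i \<in> I \<Longrightarrow> C1 (f i)) \<Longrightarrow> C1 (\<lambda>x. \<Prod>i\<in>I. f i x)"
  by (induction I rule: infinite_finite_induct) (auto intro: C1_mult)

lemma C1_power: "C1 f \<Longrightarrow> C1 (\<lambda>x. f x ^ k)"
  by (induction k) (auto intro: C1_mult)

lemma frechet_shift:
  assumes "C1 f"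
  shows "((\<lambda>x. f (x + a)) has_derivative frechet_derivative f (at (x + a))) (at x)"
proof -
  have "((\<lambda>x. x + a) has_derivative (\<lambda>v. v)) (at x)"
    by (auto intro!: derivative_eq_intros)
  from has_derivative_compose[OF this C1_frechet(1)[OF assms]] show ?thesis
    by (simp add: o_def)
qed

lemma C1_shift:
  assumes "C1 f"
  shows "C1 (\<lambda>x. f (x + a))"
proof (rule C1I)
  fix x v
  show "((\<lambda>x. f (x + a)) has_derivative frechet_derivative f (at (x + a))) (at x)"
    by (rule frechet_shift[OF assms])
  have "continuous_on UNIV ((\<lambda>x. frechet_derivative f (at x) v) \<circ> (\<lambda>x. x + a))"
    by (intro continuous_on_compose continuous_intros
        continuous_on_subset[OF C1_frechet(2)[OF assms]]) auto
  then show "continuous_on UNIV (\<lambda>x. frechet_derivative f (at (x + a)) v)"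
    by (simp add: o_def)
qed

lemma C1cD: "C1c f \<Longrightarrow> C1 f"
  by (simp add: C1c_def)

lemma C1c_shift:
  assumes "C1c f" shows "C1c (\<lambda>x. f (x + a))"
proof -
  obtain R where R: "\<And>x. R \<le> norm x \<Longrightarrow> f x = 0"
    using assms unfolding C1c_def by blast
  have "f (x + a) = 0" if "R + norm a \<le> norm x" for x
    using that norm_triangle_ineq2[of x "-a"] by (intro R) simp
  then show ?thesis
    using C1_shift[OF C1cD[OF assms]] unfolding C1c_def by blast
qed

lemma C1c_add:
  assumes "C1c f" "C1c g" shows "C1c (\<lambda>x. f x + g x)"
proof -
  obtain R S where "\<And>x. R \<le> norm x \<Longrightarrow> f x = 0" "\<And>x. S \<le> norm x \<Longrightarrow> g x = 0"
    using assms unfolding C1c_def by blast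
  then have "\<forall>x. max R S \<le> norm x \<longrightarrow> f x + g x = 0" by auto
  then show ?thesis
    using assms C1_add unfolding C1c_def by blast
qed

lemma C1c_mult:
  assumes "C1 f" "C1c g" shows "C1c (\<lambda>x. f x * g x)"
  using assms C1_mult unfolding C1c_def by (metis mult_zero_right)

lemma C1c_zero: "C1c (\<lambda>x. 0)"
  unfolding C1c_def by auto

lemma C1c_frechet_zero:
  assumes "C1c f"
  obtains R where "R > 0" "\<And>x. R \<le> norm x \<Longrightarrow> f x = 0"
    "\<And>x v. R \<le> norm x \<Longrightarrow> frechet_derivative f (at x) v = 0"
proof -
  obtain R where R: "\<And>x. R \<le> norm x \<Longrightarrow> f x = 0"
    using assms unfolding C1c_def by blast
  have "frechet_derivative f (at x) v = 0" if "norm x > R" for x v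
  proof -
    have "((\<lambda>x. 0) has_derivative (\<lambda>v. 0)) (at x)" by simp
    moreover have "open {x::'a. norm x > R}"
      by (intro open_Collect_less continuous_intros)
    ultimately have "(f has_derivative (\<lambda>v. 0)) (at x)"
      by (rule has_derivative_transform_within_open) (use that R in auto)
    then show ?thesis
      using frechet_derivative_at by metis
  qed
  \<comment> \<open>The derivative is known to vanish only on the open set
    \<open>norm x > R\<close>, hence \<open>R + 1\<close>; the maximum makes the radius
    positive.\<close>
  then show thesis
    using that[of "max 1 (R + 1)"] R by auto
qed

lemma C1c_lipschitz:
  fixes f :: "'a::euclidean_space \<Rightarrow> real"
  assumes "C1c f"
  obtains L where "L \<ge> 0" "\<And>x y. \<bar>f x - f y\<bar> \<le> L * norm (x - y)"
    "\<And>x v. \<bar>frechet_derivative f (at x) v\<bar> \<le> L * norm v"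
proof -
  obtain R where R: "R > 0" "\<And>x v. R \<le> norm x \<Longrightarrow> frechet_derivative f (at x) v = 0"
    using C1c_frechet_zero[OF assms] by metis
  have "\<exists>B. \<forall>x. \<bar>frechet_derivative f (at x) v\<bar> \<le> B" for v
  proof -
    have "compact ((\<lambda>x. frechet_derivative f (at x) v) ` cball 0 R)"
      by (intro compact_continuous_image continuous_on_subset[OF C1_frechet(2)] C1cD assms) auto
    from compact_imp_bounded[OF this]
    obtain B where "\<forall>y\<in>(\<lambda>x. frechet_derivative f (at x) v) ` cball 0 R. norm y \<le> B"
      unfolding bounded_iff by blast
    then have B: "\<bar>frechet_derivative f (at x) v\<bar> \<le> B" if "norm x \<le> R" for x
      using that by simp
    have "\<bar>frechet_derivative f (at x) v\<bar> \<le> max B 0" for x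
      using B[of x] R(2)[of x v] by (cases "norm x \<le> R") auto
    then show ?thesis by blast
  qed
  then obtain B where B: "\<And>x v. \<bar>frechet_derivative f (at x) v\<bar> \<le> B v"
    by metis
  \<comment> \<open>Compactness gives a bound \<open>B v\<close> for each direction separately;
    expanding \<open>v\<close> in the basis turns finitely many of them into one for all
    \<open>v\<close>.\<close>
  define L where "L = (\<Sum>b\<in>Basis. B b)"
  have B0: "B v \<ge> 0" for v using B[of undefined v] by simp
  have L: "\<bar>frechet_derivative f (at x) v\<bar> \<le> L * norm v" for x v
  proof -
    interpret linear "frechet_derivative f (at x)"
      using C1_frechet(1)[OF C1cD[OF assms]] has_derivative_linear by blast
    have "frechet_derivative f (at x) v
        = (\<Sum>b\<in>Basis. (v \<bullet> b) * frechet_derivative f (at x) b)"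
      using sum[of "\<lambda>b. (v \<bullet> b) *\<^sub>R b" Basis] by (simp add: euclidean_representation scale)
    also have "\<bar>\<dots>\<bar> \<le> (\<Sum>b\<in>Basis. norm v * B b)"
      by (intro sum_abs[THEN order_trans] sum_mono)
        (auto simp: abs_mult intro!: mult_mono B Basis_le_norm)
    finally show ?thesis
      by (simp add: L_def sum_distrib_left mult.commute)
  qed
  have "L \<ge> 0" using B0 by (simp add: L_def sum_nonneg)
  have "\<bar>f x - f y\<bar> \<le> L * norm (x - y)" for x y
  proof -
    have "norm (f x - f y) \<le> L * norm (x - y)"
      by (rule differentiable_bound[of UNIV f "\<lambda>x. frechet_derivative f (at x)"])
        (auto intro!: C1_frechet C1cD assms onorm_bound L \<open>L \<ge> 0\<close>)
    then show ?thesis by simp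
  qed
  with L \<open>L \<ge> 0\<close> that show thesis by blast
qed

lemma C1c_bounded:
  fixes f :: "'a::euclidean_space \<Rightarrow> real"
  assumes "C1c f"
  obtains B where "B \<ge> 0" "\<And>x. \<bar>f x\<bar> \<le> B"
proof -
  obtain R where R: "R > 0" "\<And>x. R \<le> norm x \<Longrightarrow> f x = 0"
    using C1c_frechet_zero[OF assms] by metis
  obtain L where L: "L \<ge> 0" "\<And>x y. \<bar>f x - f y\<bar> \<le> L * norm (x - y)"
    using C1c_lipschitz[OF assms] by metis
  have "\<bar>f x\<bar> \<le> \<bar>f 0\<bar> + L * R" for x
  proof (cases "R \<le> norm x")
    case False
    then have "L * norm x \<le> L * R" using L by (intro mult_left_mono) auto
    then show ?thesis using L(2)[of x 0] by simp
  qed (use R L in auto)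
  then show thesis using that[of "\<bar>f 0\<bar> + L * R"] L R by simp
qed

lemma C1c_measurable [measurable]: "C1c f \<Longrightarrow> f \<in> borel_measurable borel"
  by (intro borel_measurable_continuous_onI C1_continuous C1cD)

section \<open>Explicit bump functions and approximation of indicators of open sets\<close>

definition bump :: "real \<Rightarrow> 'a::euclidean_space \<Rightarrow> real" where
  "bump s y = (max 0 (1 - (y \<bullet> y) / s\<^sup>2))\<^sup>2"

lemma bump_nonneg [simp]: "0 \<le> bump s y"
  by (simp add: bump_def)

lemma bump_le_1 [simp]: "bump s y \<le> 1"
  unfolding bump_def by (rule power_le_one) auto

lemma bump_eq_0:
  assumes "s > 0" "s \<le> norm y" shows "bump s y = 0"
proof -
  have "s\<^sup>2 \<le> (norm y)\<^sup>2" using assms by (intro power_mono) auto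
  then have "1 \<le> (y \<bullet> y) / s\<^sup>2" using assms by (simp add: dot_square_norm)
  then show ?thesis by (simp add: bump_def)
qed

lemma bump_pos: "norm y < s \<Longrightarrow> 0 < bump s y"
proof -
  assume "norm y < s"
  moreover from this have "s > 0" using norm_ge_zero[of y] by linarith
  ultimately have "(norm y)\<^sup>2 < s\<^sup>2" by (intro power_strict_mono) auto
  then have "(y \<bullet> y) / s\<^sup>2 < 1" using \<open>s > 0\<close> by (simp add: dot_square_norm)
  then have "0 < max 0 (1 - (y \<bullet> y) / s\<^sup>2)" by linarith
  then show ?thesis unfolding bump_def by (rule zero_less_power)
qed

lemma bump_ge_half: "norm y \<le> s / 2 \<Longrightarrow> s > 0 \<Longrightarrow> 1 / 2 \<le> bump s y"
proof -
  assume "norm y \<le> s / 2" "s > 0"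
  then have "(norm y)\<^sup>2 \<le> (s/2)\<^sup>2" by (intro power_mono) auto
  with \<open>s > 0\<close> have "3/4 \<le> 1 - (y \<bullet> y) / s\<^sup>2"
    by (auto simp: dot_square_norm divide_simps power2_eq_square)
  then have "(3/4)\<^sup>2 \<le> bump s y" unfolding bump_def by (intro power_mono max.coboundedI2) auto
  then show ?thesis by (simp add: power2_eq_square)
qed

lemma max0_square_deriv: "((\<lambda>t::real. (max 0 t)\<^sup>2) has_real_derivative 2 * max 0 t) (at t)"
proof -
  consider "t < 0" | "t = 0" | "t > 0" by linarith
  then show ?thesis
  proof cases
    case 1
    have "((\<lambda>t::real. 0) has_real_derivative 2 * max 0 t) (at t)" using 1 by (simp add: max_def)
    then show ?thesis
      by (rule has_field_derivative_transform_within_open[where S="{..<0}"]) (use 1 in auto)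
  next
    case 3
    have "((\<lambda>t::real. t\<^sup>2) has_real_derivative 2 * max 0 t) (at t)"
      using 3 by (auto intro!: derivative_eq_intros simp: max_def)
    then show ?thesis
      by (rule has_field_derivative_transform_within_open[where S="{0<..}"]) (use 3 in auto)
  next
    case 2
    have "((\<lambda>h. ((max 0 (0 + h))\<^sup>2 - (max 0 0)\<^sup>2) / h) \<longlongrightarrow> (0::real)) (at 0)"
    proof (rule Lim_null_comparison[OF _ tendsto_rabs_zero[OF tendsto_ident_at]])
      show "\<forall>\<^sub>F h::real in at 0. norm (((max 0 (0 + h))\<^sup>2 - (max 0 0)\<^sup>2) / h) \<le> \<bar>h\<bar>"
        by (intro always_eventually allI) (auto simp: max_def power2_eq_square)
    qed
    then show ?thesis using 2 by (simp add: DERIV_def)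
  qed
qed

text \<open>The outer square in \<open>bump\<close> is what makes the positive part of a paraboloid
  continuously differentiable across the edge of its support.\<close>

lemma C1_bump: "C1 (bump s)"
proof (rule C1I)
  fix x v :: 'a
  have "((\<lambda>y::'a. 1 - (y \<bullet> y) / s\<^sup>2) has_derivative (\<lambda>v. - (2 * (x \<bullet> v)) / s\<^sup>2)) (at x)"
    by (auto intro!: derivative_eq_intros simp: inner_commute divide_inverse)
  from has_derivative_compose[OF this max0_square_deriv[unfolded has_field_derivative_def]]
  show "(bump s has_derivative
      (\<lambda>v. 2 * max 0 (1 - (x \<bullet> x) / s\<^sup>2) * (- (2 * (x \<bullet> v)) / s\<^sup>2))) (at x)"
    by (simp add: bump_def[abs_def])
  show "continuous_on UNIV (\<lambda>x. 2 * max 0 (1 - (x \<bullet> x) / s\<^sup>2) * (- (2 * (x \<bullet> v)) / s\<^sup>2))"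
    unfolding divide_inverse by (intro continuous_intros)
qed

lemma C1c_bump: "s > 0 \<Longrightarrow> C1c (bump s)"
  using C1_bump bump_eq_0 unfolding C1c_def by blast

lemma C1c_bump_shift: "s > 0 \<Longrightarrow> C1c (\<lambda>x. bump s (x - a))"
  using C1c_shift[OF C1c_bump, of s "-a"] by simp

text \<open>Cover \<open>U\<close> by countably many balls and put a bump on each. Using only the
  first \<open>m\<close> bumps keeps the support compact, and the exponent \<open>m\<close> drives
  the product of the factors \<open>1 - \<psi> i x\<close> to 0 wherever some bump is
  positive.\<close>

lemma open_indicator_approx:
  fixes U :: "'a::euclidean_space set"
  assumes "open U"
  obtains \<phi> :: "nat \<Rightarrow> 'a \<Rightarrow> real" where "\<And>k. C1c (\<phi> k)" "\<And>k x. 0 \<le> \<phi> k x" "\<And>k x. \<phi> k x \<le> 1"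
    "\<And>k x. x \<notin> U \<Longrightarrow> \<phi> k x = 0" "\<And>x. (\<lambda>k. \<phi> k x) \<longlonglongrightarrow> indicator U x"
proof -
  have "\<forall>x\<in>U. \<exists>r>0. ball x r \<subseteq> U" using assms open_contains_ball by blast
  then obtain r where r: "\<And>x. x \<in> U \<Longrightarrow> r x > 0" "\<And>x. x \<in> U \<Longrightarrow> ball x (r x) \<subseteq> U"
    by metis
  obtain \<B> where \<B>: "\<B> \<subseteq> (\<lambda>x. ball x (r x)) ` U" "countable \<B>" "\<Union>\<B> = \<Union>((\<lambda>x. ball x (r x)) ` U)"
    by (rule Lindelof[of "(\<lambda>x. ball x (r x)) ` U"]) auto
  obtain A where A: "A \<subseteq> U" "countable A" "\<B> = (\<lambda>x. ball x (r x)) ` A"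
    using \<B> by (metis (no_types, lifting) countable_subset_image)
  have "U = (\<Union>x\<in>U. ball x (r x))"
  proof
    show "U \<subseteq> (\<Union>x\<in>U. ball x (r x))" using r(1) centre_in_ball by blast
    show "(\<Union>x\<in>U. ball x (r x)) \<subseteq> U" using r(2) by blast
  qed
  then have U: "U = (\<Union>x\<in>A. ball x (r x))" using \<B>(3) A(3) by simp
  show thesis
  proof (cases "A = {}")
    case True
    then have "U = {}" using U by simp
    then show thesis by (intro that[of "\<lambda>k x. 0"]) (auto simp: C1c_zero)
  next
    case False
    define a where "a = from_nat_into A"
    have a: "range a = A" using A False by (simp add: a_def range_from_nat_into)
    have rpos: "r (a i) > 0" for i using a A r by (metis rangeI subsetD)
    define \<psi> where "\<psi> i x = bump (r (a i)) (x - a i)" for i x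
    define \<phi> where "\<phi> m x = 1 - (\<Prod>i<m. (1 - \<psi> i x) ^ m)" for m x
    have \<psi>01: "0 \<le> \<psi> i x" "\<psi> i x \<le> 1" for i x by (auto simp: \<psi>_def)
    have p01: "0 \<le> (\<Prod>i\<in>I. (1 - \<psi> i x) ^ m)" "(\<Prod>i\<in>I. (1 - \<psi> i x) ^ m) \<le> 1" for I m x
      by (auto intro!: prod_nonneg prod_le_1 power_le_one simp: \<psi>01)
    have C1\<psi>: "C1 (\<psi> i)" for i unfolding \<psi>_def using C1cD[OF C1c_bump_shift[OF rpos]] .
    have zero\<psi>: "\<psi> i x = 0" if "x \<notin> ball (a i) (r (a i))" for i x
      unfolding \<psi>_def using that rpos
      by (intro bump_eq_0) (auto simp: dist_norm norm_minus_commute not_less)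
    have c: "C1c (\<phi> m)" for m
    proof -
      have "C1 (\<phi> m)" unfolding \<phi>_def
        by (intro C1_diff C1_const C1_prod C1_power C1\<psi>)
      moreover have "bounded (\<Union>i\<in>{..<m}. ball (a i) (r (a i)))" by (intro bounded_UN) auto
      then obtain R where R: "\<And>x. x \<in> (\<Union>i\<in>{..<m}. ball (a i) (r (a i))) \<Longrightarrow> norm x \<le> R"
        unfolding bounded_iff by blast
      have "\<phi> m x = 0" if "R + 1 \<le> norm x" for x
      proof -
        have "\<psi> i x = 0" if "i < m" for i
          using R[of x] that \<open>R + 1 \<le> norm x\<close> by (intro zero\<psi>) force
        then show ?thesis by (simp add: \<phi>_def)
      qed
      ultimately show ?thesis unfolding C1c_def by blast
    qed
    have b: "0 \<le> \<phi> k x" "\<phi> k x \<le> 1" for k x using p01 by (auto simp: \<phi>_def)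
    have z: "\<phi> k x = 0" if "x \<notin> U" for k x
    proof -
      have "\<psi> i x = 0" for i using that a U by (intro zero\<psi>) auto
      then show ?thesis by (simp add: \<phi>_def)
    qed
    have l: "(\<lambda>k. \<phi> k x) \<longlonglongrightarrow> 1" if xU: "x \<in> U" for x
    proof -
      have "x \<in> (\<Union>x\<in>range a. ball x (r x))" using xU U a by simp
      then obtain j where j: "x \<in> ball (a j) (r (a j))" by blast
      then have pos: "\<psi> j x > 0" unfolding \<psi>_def
        by (intro bump_pos) (auto simp: dist_norm norm_minus_commute)
      have lim: "(\<lambda>m. (1 - \<psi> j x) ^ m) \<longlonglongrightarrow> 0"
        using pos \<psi>01[of j x] by (intro LIMSEQ_power_zero) auto
      have "(\<Prod>i<m. (1 - \<psi> i x) ^ m) \<le> (1 - \<psi> j x) ^ m" if "m > j" for m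
      proof -
        have "(\<Prod>i<m. (1 - \<psi> i x) ^ m) = (1 - \<psi> j x) ^ m * (\<Prod>i\<in>{..<m} - {j}. (1 - \<psi> i x) ^ m)"
          using that by (intro prod.remove) auto
        also have "\<dots> \<le> (1 - \<psi> j x) ^ m"
          using p01 \<psi>01 by (intro mult_left_le) auto
        finally show ?thesis .
      qed
      then have ev: "\<forall>\<^sub>F m in sequentially. (\<Prod>i<m. (1 - \<psi> i x) ^ m) \<le> (1 - \<psi> j x) ^ m"
        using eventually_gt_at_top[of j] by (rule eventually_mono[rotated])
      have "(\<lambda>m. \<Prod>i<m. (1 - \<psi> i x) ^ m) \<longlonglongrightarrow> 0"
        by (rule tendsto_sandwich[OF always_eventually ev tendsto_const lim]) (use p01 in blast)
      from tendsto_diff[OF tendsto_const[of 1] this] show ?thesis by (simp add: \<phi>_def)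
    qed
    have "(\<lambda>k. \<phi> k x) \<longlonglongrightarrow> indicator U x" for x
      using l[of x] z[of x] by (cases "x \<in> U") simp_all
    from that[OF c b z this] show thesis .
  qed
qed

section \<open>Locally finite Borel measures and weak limits of bounded densities\<close>

locale radon =
  fixes M :: "'a::euclidean_space measure"
  assumes sets_borel [measurable_cong, simp]: "sets M = sets borel"
    and finite_compact: "\<And>K. compact K \<Longrightarrow> emeasure M K < \<infinity>"
begin

lemma space_UNIV [simp]: "space M = UNIV"
  using sets_eq_imp_space_eq[OF sets_borel] by simp

lemma finite_bounded:
  assumes "bounded A" "A \<in> sets borel"
  shows "emeasure M A < \<infinity>"
proof -
  obtain R where "A \<subseteq> cball 0 R"
    using bounded_subset_ballD[OF assms(1)] ball_subset_cball by blast
  then have "emeasure M A \<le> emeasure M (cball 0 R)"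
    by (intro emeasure_mono) auto
  then show ?thesis
    using finite_compact[of "cball 0 R"] compact_cball le_less_trans by blast
qed

sublocale sigma_finite_measure M
proof
  have "countable (range (\<lambda>n. cball (0::'a) (real n)))" by auto
  moreover have "\<Union>(range (\<lambda>n. cball (0::'a) (real n))) = UNIV"
    using real_arch_simple by (auto simp: mem_cball_0)
  ultimately show "\<exists>A. countable A \<and> A \<subseteq> sets M \<and> \<Union> A = space M \<and> (\<forall>a\<in>A. emeasure M a \<noteq> \<infinity>)"
    using finite_compact[OF compact_cball]
    by (intro exI[of _ "range (\<lambda>n. cball 0 (real n))"]) (auto simp: less_top[symmetric])
qed

lemma integrable_bounded_support:
  fixes f :: "'a \<Rightarrow> 'b::{banach, second_countable_topology}"
  assumes f: "f \<in> borel_measurable borel" and B: "\<And>x. norm (f x) \<le> B"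
    and R: "\<And>x. R \<le> norm x \<Longrightarrow> f x = 0"
  shows "integrable M f"
proof -
  have "integrable M (\<lambda>x. indicator (cball 0 R) x *\<^sub>R B)"
    using finite_compact[OF compact_cball] by (intro integrable_scaleR_left integrable_real_indicator) auto
  then show ?thesis
  proof (rule Bochner_Integration.integrable_bound)
    show "f \<in> borel_measurable M" using f by simp
    have "norm (f x) \<le> norm (indicator (cball 0 R) x *\<^sub>R B)" for x
      using B[of x] R[of x] by (cases "norm x \<le> R") auto
    then show "AE x in M. norm (f x) \<le> norm (indicator (cball 0 R) x *\<^sub>R B)" by simp
  qed
qed

lemma C1c_integrable: "C1c f \<Longrightarrow> integrable M f"
proof -
  assume f: "C1c f"
  obtain B where "\<And>x. \<bar>f x\<bar> \<le> B" using C1c_bounded[OF f] by metis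
  moreover obtain R where "\<And>x. R \<le> norm x \<Longrightarrow> f x = 0" using C1c_frechet_zero[OF f] by metis
  ultimately show ?thesis by (intro integrable_bounded_support[of f B R] C1c_measurable f) auto
qed

text \<open>Regularity is applied to the finite measure \<open>N\<close>, the part of
  \<open>M\<close> in a ball containing \<open>A\<close>; intersecting the open set with that ball
  brings the estimate back to \<open>M\<close>.\<close>

lemma outer_regular_bounded:
  assumes "bounded A" and A [measurable]: "A \<in> sets borel" and "e > 0"
  obtains U where "open U" "bounded U" "A \<subseteq> U" "measure M (U - A) < e"
proof -
  obtain R where R: "A \<subseteq> ball 0 R" using assms(1) bounded_subset_ballD by blast
  define N where "N = density M (indicator (ball 0 R))"
  have sN [measurable_cong]: "sets N = sets borel" by (simp add: N_def)
  have eN: "emeasure N B = emeasure M (B \<inter> ball 0 R)" if "B \<in> sets borel" for B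
  proof -
    have [measurable]: "B \<in> sets M" using that by simp
    have "emeasure N B = (\<integral>\<^sup>+x. indicator (ball 0 R) x * indicator B x \<partial>M)"
      unfolding N_def by (intro emeasure_density borel_measurable_indicator) (use that in auto)
    also have "\<dots> = (\<integral>\<^sup>+x. indicator (B \<inter> ball 0 R) x \<partial>M)"
      by (intro nn_integral_cong) (auto simp: indicator_def)
    finally show ?thesis using that by simp
  qed
  have "emeasure N (space N) < \<infinity>"
    using eN[of UNIV] finite_bounded[of "ball 0 R"] by (simp add: N_def)
  then have "emeasure N A = (INF U\<in>{U. A \<subseteq> U \<and> open U}. emeasure N U)"
    by (intro outer_regular sN A) auto
  moreover have "emeasure N A < emeasure N A + ennreal e"
    using eN[OF A] finite_bounded[OF assms(1,2)] R \<open>e > 0\<close>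
    by (simp add: inf.absorb1 ennreal_add_left_cancel_less[of _ 0, simplified])
  ultimately obtain U where U: "A \<subseteq> U" "open U" "emeasure N U < emeasure N A + ennreal e"
    by (auto simp: INF_less_iff)
  define V where "V = U \<inter> ball 0 R"
  have V: "open V" "bounded V" "A \<subseteq> V"
    using U R by (auto simp: V_def intro: bounded_subset[OF bounded_ball])
  have [measurable]: "V \<in> sets borel" using V by simp
  have fin: "emeasure M V \<noteq> \<infinity>" "emeasure M A \<noteq> \<infinity>"
    using finite_bounded[OF V(2)] finite_bounded[OF assms(1)] by auto
  have "ennreal (measure M V) < ennreal (measure M A) + ennreal e"
    using U(3) eN[of U] eN[OF A] R U(2) fin
    by (simp add: V_def inf.absorb1 emeasure_eq_ennreal_measure)
  then have "measure M V < measure M A + e"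
    using \<open>e > 0\<close> by (simp add: ennreal_plus[symmetric] ennreal_less_iff del: ennreal_plus)
  moreover have "measure M (V - A) = measure M V - measure M A"
    using V(3) fin by (intro measure_Diff) auto
  ultimately show thesis using V that by auto
qed

lemma C1c_dense:
  assumes "integrable M f" "e > 0"
  shows "\<exists>\<phi>. C1c \<phi> \<and> (LINT x|M. \<bar>f x - \<phi> x\<bar>) < e"
  using assms
proof (induction f arbitrary: e rule: integrable_induct)
  case (base A c)
  have A[measurable, simp]: "A \<in> sets borel" using base(1) by simp
  \<comment> \<open>Three errors of size \<open>d\<close> will arise: cutting \<open>A\<close> down
    to a bounded set, enlarging that set to an open one, and approximating the open set. The summand
    1 covers \<open>c = 0\<close>.\<close>
  define d where "d = e / (3 * (\<bar>c\<bar> + 1))"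
  have "d > 0" using base by (simp add: d_def)
  \<comment> \<open>\<open>A\<close> has finite measure but may be unbounded, whereas
    \<open>outer_regular_bounded\<close> is about bounded sets.\<close>
  have "(\<lambda>n. measure M (A \<inter> ball 0 (real n))) \<longlonglongrightarrow> measure M (\<Union>n. A \<inter> ball 0 (real n))"
  proof (rule Lim_measure_incseq)
    show "range (\<lambda>n. A \<inter> ball 0 (real n)) \<subseteq> sets M" by (rule image_subsetI) measurable
    show "incseq (\<lambda>n. A \<inter> ball 0 (real n))" by (auto simp: incseq_def)
    have "emeasure M (\<Union>n. A \<inter> ball 0 (real n)) \<le> emeasure M A"
      by (intro emeasure_mono) (use base(1) in auto)
    then show "emeasure M (\<Union>n. A \<inter> ball 0 (real n)) \<noteq> \<infinity>" using base(2) by auto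
  qed
  moreover have "(\<Union>n. A \<inter> ball 0 (real n)) = A"
    using reals_Archimedean2 by auto
  ultimately have "\<forall>\<^sub>F n in sequentially. measure M A - d < measure M (A \<inter> ball 0 (real n))"
    using \<open>d > 0\<close> by (intro order_tendstoD(1)) auto
  then obtain n where n: "measure M A - d < measure M (A \<inter> ball 0 (real n))"
    using eventually_happens'[OF sequentially_bot] by blast
  define B where "B = A \<inter> ball 0 (real n)"
  have [measurable, simp]: "B \<in> sets borel" by (auto simp: B_def)
  have "bounded B" unfolding B_def by (intro bounded_Int) auto
  then obtain U where U: "open U" "bounded U" "B \<subseteq> U" "measure M (U - B) < d"
    using outer_regular_bounded \<open>d > 0\<close> \<open>B \<in> sets borel\<close> by metis
  have [measurable, simp]: "U \<in> sets borel" using U by simp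
  have finU: "emeasure M U < \<infinity>" using finite_bounded U by simp
  have finA: "emeasure M A < \<infinity>" by fact
  have finB: "emeasure M B < \<infinity>" using finite_bounded[OF \<open>bounded B\<close>] by simp
  have AB: "measure M (A - B) < d"
    using n finA finB \<open>A \<in> sets M\<close> \<open>B \<in> sets borel\<close> by (subst measure_Diff) (auto simp: B_def)
  obtain \<phi> :: "nat \<Rightarrow> 'a \<Rightarrow> real" where \<phi>: "\<And>k. C1c (\<phi> k)" "\<And>k x. 0 \<le> \<phi> k x" "\<And>k x. \<phi> k x \<le> 1"
    "\<And>k x. x \<notin> U \<Longrightarrow> \<phi> k x = 0" "\<And>x. (\<lambda>k. \<phi> k x) \<longlonglongrightarrow> indicator U x"
    using open_indicator_approx[OF U(1)] by metis
  have iU: "integrable M (indicat_real U)" using finU by (intro integrable_real_indicator) auto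
  have iA: "integrable M (indicat_real A)" using finA by (intro integrable_real_indicator) auto
  have "(\<lambda>k. LINT x|M. \<bar>indicator U x - \<phi> k x\<bar>) \<longlonglongrightarrow> (LINT x|M. 0)"
  proof (rule integral_dominated_convergence[where w="indicator U"])
    have "(\<lambda>k. \<bar>indicator U x - \<phi> k x\<bar>) \<longlonglongrightarrow> \<bar>indicator U x - indicator U x\<bar>" for x
      by (intro tendsto_intros \<phi>)
    then show "AE x in M. (\<lambda>k. \<bar>indicator U x - \<phi> k x\<bar>) \<longlonglongrightarrow> 0" by simp
    have "norm \<bar>indicator U x - \<phi> k x\<bar> \<le> indicator U x" for x k
      using \<phi>(2,3)[of k x] \<phi>(4)[of x k] by (cases "x \<in> U") (auto simp: abs_le_iff)
    then show "AE x in M. norm \<bar>indicator U x - \<phi> k x\<bar> \<le> indicator U x" for k by simp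
  qed (use iU C1c_measurable[OF \<phi>(1)] in simp_all)
  from order_tendstoD(2)[OF this, of d] \<open>d > 0\<close>
  have "\<forall>\<^sub>F k in sequentially. (LINT x|M. \<bar>indicator U x - \<phi> k x\<bar>) < d"
    by simp
  then obtain k where k: "(LINT x|M. \<bar>indicator U x - \<phi> k x\<bar>) < d"
    using eventually_happens'[OF sequentially_bot] by blast
  have iUB: "integrable M (indicat_real (U - B))" "integrable M (indicat_real (A - B))"
    using finU finA
    by (intro integrable_real_indicator; force intro: le_less_trans[OF emeasure_mono])+
  have i\<phi>: "integrable M (\<phi> k)" using C1c_integrable \<phi> by blast
  have "(LINT x|M. \<bar>indicator A x *\<^sub>R c - c * \<phi> k x\<bar>)
      \<le> (LINT x|M. \<bar>c\<bar> * (indicator (A - B) x + indicator (U - B) x + \<bar>indicator U x - \<phi> k x\<bar>))"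
  proof (rule integral_mono)
    show "integrable M (\<lambda>x. \<bar>indicator A x *\<^sub>R c - c * \<phi> k x\<bar>)"
      using iA i\<phi> by auto
    show "integrable M (\<lambda>x. \<bar>c\<bar> * (indicator (A - B) x + indicator (U - B) x + \<bar>indicator U x - \<phi> k x\<bar>))"
      using iUB iU i\<phi> by auto
    fix x
    have "\<bar>indicator A x *\<^sub>R c - c * \<phi> k x\<bar> = \<bar>c\<bar> * \<bar>indicator A x - \<phi> k x\<bar>"
      by (simp add: abs_mult[symmetric] algebra_simps)
    also have "\<bar>indicator A x - \<phi> k x\<bar>
        \<le> indicator (A - B) x + indicator (U - B) x + \<bar>indicator U x - \<phi> k x\<bar>"
      using U(3) unfolding B_def by (auto simp: indicator_def)
    finally show "\<bar>indicator A x *\<^sub>R c - c * \<phi> k x\<bar>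
        \<le> \<bar>c\<bar> * (indicator (A - B) x + indicator (U - B) x + \<bar>indicator U x - \<phi> k x\<bar>)"
      by (simp add: mult_left_mono)
  qed
  also have "\<dots> = \<bar>c\<bar> * (measure M (A - B) + measure M (U - B) + (LINT x|M. \<bar>indicator U x - \<phi> k x\<bar>))"
    using iUB iU i\<phi> by simp
  also have "\<dots> \<le> \<bar>c\<bar> * (3 * d)"
    using AB U(4) k by (intro mult_left_mono) auto
  also have "\<dots> < e"
    using base(3) by (simp add: d_def divide_simps) 
  finally show ?case
    using C1c_mult[OF C1_const \<phi>(1), of c k] by blast
next
  case (add f g)
  obtain \<phi> \<psi> where "C1c \<phi>" "(LINT x|M. \<bar>f x - \<phi> x\<bar>) < e / 2" "C1c \<psi>" "(LINT x|M. \<bar>g x - \<psi> x\<bar>) < e / 2"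
    using add.IH[of "e/2"] add.prems by auto
  note * = this
  have i: "integrable M \<phi>" "integrable M \<psi>" using * C1c_integrable by auto
  have "(LINT x|M. \<bar>(f x + g x) - (\<phi> x + \<psi> x)\<bar>) \<le> (LINT x|M. \<bar>f x - \<phi> x\<bar> + \<bar>g x - \<psi> x\<bar>)"
    using add.hyps i by (intro integral_mono) auto
  also have "\<dots> = (LINT x|M. \<bar>f x - \<phi> x\<bar>) + (LINT x|M. \<bar>g x - \<psi> x\<bar>)"
    using add.hyps i by (intro Bochner_Integration.integral_add) auto
  also have "\<dots> < e" using * by simp
  finally show ?case using C1c_add[OF *(1,3)] by blast
next
  case (lim f s)
  have "(\<lambda>i. LINT x|M. \<bar>f x - s i x\<bar>) \<longlonglongrightarrow> (LINT x|M. 0)"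
  proof (rule integral_dominated_convergence[where w="\<lambda>x. 3 * \<bar>f x\<bar>"])
    have "(\<lambda>i. \<bar>f x - s i x\<bar>) \<longlonglongrightarrow> \<bar>f x - f x\<bar>" for x
      by (intro tendsto_intros lim.hyps) simp
    then show "AE x in M. (\<lambda>i. \<bar>f x - s i x\<bar>) \<longlonglongrightarrow> 0" by simp
    have "norm \<bar>f x - s i x\<bar> \<le> 3 * \<bar>f x\<bar>" for x i
      using lim.hyps(3)[of x i] by auto
    then show "AE x in M. norm \<bar>f x - s i x\<bar> \<le> 3 * \<bar>f x\<bar>" for i by simp
  qed (use lim.hyps in auto)
  from order_tendstoD(2)[OF this, of "e/2"] lim.prems
  have "\<forall>\<^sub>F i in sequentially. (LINT x|M. \<bar>f x - s i x\<bar>) < e / 2" by simp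
  then obtain i where i: "(LINT x|M. \<bar>f x - s i x\<bar>) < e / 2"
    using eventually_happens'[OF sequentially_bot] by blast
  obtain \<phi> where \<phi>: "C1c \<phi>" "(LINT x|M. \<bar>s i x - \<phi> x\<bar>) < e / 2"
    using lim.IH[of "e/2" i] lim.prems by auto
  have i\<phi>: "integrable M \<phi>" using \<phi> C1c_integrable by auto
  have "(LINT x|M. \<bar>f x - \<phi> x\<bar>) \<le> (LINT x|M. \<bar>f x - s i x\<bar> + \<bar>s i x - \<phi> x\<bar>)"
    using lim.hyps i\<phi> by (intro integral_mono) auto
  also have "\<dots> = (LINT x|M. \<bar>f x - s i x\<bar>) + (LINT x|M. \<bar>s i x - \<phi> x\<bar>)"
    using lim.hyps i\<phi> by (intro Bochner_Integration.integral_add) auto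
  also have "\<dots> < e" using i \<phi> by simp
  finally show ?case using \<phi> by blast
qed

lemma integrable_mult_bounded:
  fixes f G :: "'a \<Rightarrow> real"
  assumes "integrable M f" "G \<in> borel_measurable borel" "\<And>x. \<bar>G x\<bar> \<le> C"
  shows "integrable M (\<lambda>x. f x * G x)"
    and "\<bar>LINT x|M. f x * G x\<bar> \<le> C * (LINT x|M. \<bar>f x\<bar>)"
proof -
  have b: "\<bar>f x * G x\<bar> \<le> C * \<bar>f x\<bar>" for x
    using mult_left_mono[OF assms(3)[of x], of "\<bar>f x\<bar>"] by (simp add: abs_mult mult.commute)
  have iC: "integrable M (\<lambda>x. C * \<bar>f x\<bar>)" using assms(1) by auto
  have "0 \<le> C" using assms(3)[of undefined] by linarith
  then have "AE x in M. norm (f x * G x) \<le> norm (C * \<bar>f x\<bar>)" using b by (simp add: abs_mult)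
  then show i: "integrable M (\<lambda>x. f x * G x)"
    by (rule Bochner_Integration.integrable_bound[OF iC, rotated]) (use assms in measurable)
  have "\<bar>LINT x|M. f x * G x\<bar> \<le> (LINT x|M. \<bar>f x * G x\<bar>)"
    using integral_norm_bound[of M "\<lambda>x. f x * G x"] by simp
  also have "\<dots> \<le> (LINT x|M. C * \<bar>f x\<bar>)"
    using i iC b by (intro integral_mono) auto
  finally show "\<bar>LINT x|M. f x * G x\<bar> \<le> C * (LINT x|M. \<bar>f x\<bar>)" by simp
qed

text \<open>The common bound on the \<open>G k\<close> makes the functionals equicontinuous in the
  norm of integrable functions, so the Cauchy property extends from the dense class of test
  functions to every integrable \<open>f\<close>.\<close>

lemma weak_star_convergent:
  fixes G :: "nat \<Rightarrow> 'a \<Rightarrow> real"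
  assumes G [measurable]: "\<And>k. G k \<in> borel_measurable borel" and GC: "\<And>k x. \<bar>G k x\<bar> \<le> C"
    and conv: "\<And>\<phi>. C1c \<phi> \<Longrightarrow> convergent (\<lambda>k. LINT x|M. \<phi> x * G k x)"
    and f: "integrable M f"
  shows "convergent (\<lambda>k. LINT x|M. f x * G k x)"
proof -
  have "0 \<le> C" using GC[of undefined undefined] by linarith
  have "Cauchy (\<lambda>k. LINT x|M. f x * G k x)"
  proof (rule metric_CauchyI)
    fix e :: real assume "e > 0"
    define d where "d = e / (3 * (C + 1))"
    have "d > 0" using \<open>e > 0\<close> \<open>0 \<le> C\<close> by (simp add: d_def)
    then obtain \<phi> where \<phi>: "C1c \<phi>" "(LINT x|M. \<bar>f x - \<phi> x\<bar>) < d" using C1c_dense[OF f] by blast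
    have "C * d \<le> (C + 1) * d" using \<open>d > 0\<close> by simp
    also have "\<dots> = e / 3" using \<open>0 \<le> C\<close> by (auto simp: d_def divide_simps)
    finally have Cd: "C * d \<le> e / 3" .
    have i\<phi>: "integrable M \<phi>" using \<phi> C1c_integrable by auto
    have close: "\<bar>(LINT x|M. f x * G k x) - (LINT x|M. \<phi> x * G k x)\<bar> \<le> e / 3" for k
    proof -
      have "(LINT x|M. f x * G k x) - (LINT x|M. \<phi> x * G k x) = (LINT x|M. (f x - \<phi> x) * G k x)"
        using integrable_mult_bounded(1)[OF f G GC] integrable_mult_bounded(1)[OF i\<phi> G GC]
        by (simp add: left_diff_distrib)
      also have "\<bar>\<dots>\<bar> \<le> C * (LINT x|M. \<bar>f x - \<phi> x\<bar>)"
        using f i\<phi> by (intro integrable_mult_bounded G GC) auto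
      also have "\<dots> \<le> C * d" using \<phi> \<open>0 \<le> C\<close> by (intro mult_left_mono) auto
      finally show ?thesis using Cd by linarith
    qed
    obtain N where N: "\<And>m n. m \<ge> N \<Longrightarrow> n \<ge> N \<Longrightarrow>
        dist (LINT x|M. \<phi> x * G m x) (LINT x|M. \<phi> x * G n x) < e / 3"
      using metric_CauchyD[OF convergent_Cauchy[OF conv[OF \<phi>(1)]], of "e/3"] \<open>e > 0\<close> by auto
    have "dist (LINT x|M. f x * G m x) (LINT x|M. f x * G n x) < e" if "m \<ge> N" "n \<ge> N" for m n
      using N[OF that] close[of m] close[of n] unfolding dist_real_def by linarith
    then show "\<exists>N. \<forall>m\<ge>N. \<forall>n\<ge>N. dist (LINT x|M. f x * G m x) (LINT x|M. f x * G n x) < e"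
      by blast
  qed
  then show ?thesis by (rule Cauchy_convergent)
qed

text \<open>For a positive integrable weight \<open>w\<close>, the limits of the numbers \<open>\<integral>\<^sub>A (G k + C) w dM\<close> form a finite
  measure dominated by \<open>2 C w M\<close>, so Radon-Nikodym applies and no compactness theorem is needed.\<close>

lemma weak_star_limit:
  fixes G :: "nat \<Rightarrow> 'a \<Rightarrow> real"
  assumes G [measurable]: "\<And>k. G k \<in> borel_measurable borel" and GC: "\<And>k x. \<bar>G k x\<bar> \<le> C"
    and conv: "\<And>\<phi>. C1c \<phi> \<Longrightarrow> convergent (\<lambda>k. LINT x|M. \<phi> x * G k x)"
  obtains g where "g \<in> borel_measurable borel" "\<And>x. \<bar>g x\<bar> \<le> C"
    "\<And>f. integrable M f \<Longrightarrow> (\<lambda>k. LINT x|M. f x * G k x) \<longlonglongrightarrow> (LINT x|M. f x * g x)"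
proof -
  have C0: "0 \<le> C" using GC[of undefined undefined] by linarith
  define L where "L f = lim (\<lambda>k. LINT x|M. f x * G k x)" for f
  have L: "(\<lambda>k. LINT x|M. f x * G k x) \<longlonglongrightarrow> L f" if "integrable M f" for f
    using weak_star_convergent[OF G GC conv that] unfolding L_def by (simp add: convergent_LIMSEQ_iff)
  have Lb: "\<bar>L f\<bar> \<le> C * (LINT x|M. \<bar>f x\<bar>)" if "integrable M f" for f
    using integrable_mult_bounded(2)[OF that G GC]
    by (intro tendsto_upperbound[OF tendsto_rabs[OF L[OF that]]]) auto
  have Ladd: "L (\<lambda>x. f x + g x) = L f + L g" if f: "integrable M f" and g: "integrable M g" for f g
  proof (rule LIMSEQ_unique)
    show "(\<lambda>k. LINT x|M. (f x + g x) * G k x) \<longlonglongrightarrow> L (\<lambda>x. f x + g x)"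
      by (intro L) (use f g in auto)
    have "(LINT x|M. (f x + g x) * G k x) = (LINT x|M. f x * G k x) + (LINT x|M. g x * G k x)" for k
      using integrable_mult_bounded(1)[OF f G GC] integrable_mult_bounded(1)[OF g G GC]
      by (simp add: distrib_right)
    then show "(\<lambda>k. LINT x|M. (f x + g x) * G k x) \<longlonglongrightarrow> L f + L g"
      using tendsto_add[OF L[OF f] L[OF g]] by simp
  qed
  have Lscale: "L (\<lambda>x. c * f x) = c * L f" if f: "integrable M f" for f c
  proof (rule LIMSEQ_unique)
    show "(\<lambda>k. LINT x|M. (c * f x) * G k x) \<longlonglongrightarrow> L (\<lambda>x. c * f x)"
      by (intro L) (use f in auto)
    show "(\<lambda>k. LINT x|M. (c * f x) * G k x) \<longlonglongrightarrow> c * L f"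
      using tendsto_mult[OF tendsto_const L[OF f], of c] by (simp add: mult.assoc)
  qed
  obtain h where h: "h \<in> borel_measurable M" "integral\<^sup>N M h \<noteq> \<infinity>" "\<And>x. 0 < h x \<and> h x < \<infinity>"
    using Ex_finite_integrable_function by auto
  define w where "w x = enn2real (h x)" for x
  have wpos: "w x > 0" for x using h(3)[of x] by (simp add: w_def enn2real_positive_iff)
  have hw: "h x = ennreal (w x)" for x using h(3)[of x] by (simp add: w_def less_top)
  have w[measurable]: "w \<in> borel_measurable borel" using h(1) unfolding w_def by measurable
  have "h = (\<lambda>x. ennreal (w x))" using hw by auto
  then have iw: "integrable M w"
    using h(2) wpos by (intro integrableI_nonneg) (auto simp: less_top[symmetric] less_imp_le)
  have iAw: "integrable M (\<lambda>x. indicator A x * w x)" if "A \<in> sets borel" for A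
    using integrable_mult_indicator[OF _ iw, of A] that by simp
  define M' where "M' = density M (\<lambda>x. ennreal (w x))"
  have sM' [measurable_cong, simp]: "sets M' = sets borel" by (simp add: M'_def)
  have spM' [simp]: "space M' = UNIV" by (simp add: M'_def)
  have eM': "emeasure M' A = ennreal (LINT x|M. indicator A x * w x)" if [measurable]: "A \<in> sets borel" for A
  proof -
    have "emeasure M' A = (\<integral>\<^sup>+x. ennreal (w x) * indicator A x \<partial>M)"
      unfolding M'_def by (intro emeasure_density) (use that in auto)
    also have "\<dots> = (\<integral>\<^sup>+x. ennreal (indicator A x * w x) \<partial>M)"
      by (intro nn_integral_cong) (auto simp: indicator_def)
    also have "\<dots> = ennreal (LINT x|M. indicator A x * w x)"
      using iAw[OF that] wpos by (intro nn_integral_eq_integral) (auto simp: less_imp_le)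
    finally show ?thesis .
  qed
  interpret M': finite_measure M'
    by (intro finite_measureI) (simp add: eM')
  define m where "m A = L (\<lambda>x. indicator A x * w x) + C * (LINT x|M. indicator A x * w x)" for A
  have wA0: "0 \<le> (LINT x|M. indicator A x * w x)" for A
    using wpos by (intro integral_nonneg_AE) (auto simp: less_imp_le)
  have LA: "\<bar>L (\<lambda>x. indicator A x * w x)\<bar> \<le> C * (LINT x|M. indicator A x * w x)" if "A \<in> sets borel" for A
    using Lb[OF iAw[OF that]] wpos by (simp add: abs_mult less_imp_le)
  have m0: "0 \<le> m A" and m2: "m A \<le> 2 * C * (LINT x|M. indicator A x * w x)" if "A \<in> sets borel" for A
    using LA[OF that] by (auto simp: m_def)
  have madd: "m (A \<union> B) = m A + m B" if "A \<in> sets borel" "B \<in> sets borel" "A \<inter> B = {}" for A B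
  proof -
    have "(\<lambda>x. indicator (A \<union> B) x * w x) = (\<lambda>x. indicator A x * w x + indicator B x * w x)"
      using that(3) by (auto simp: indicator_def fun_eq_iff)
    then show ?thesis
      using Ladd[OF iAw[OF that(1)] iAw[OF that(2)]] iAw that(1,2) by (simp add: m_def algebra_simps)
  qed
  define \<nu> where "\<nu> = measure_of UNIV (sets borel) (\<lambda>A. ennreal (m A))"
  have s\<nu>: "sets \<nu> = sets borel"
    using sets.sigma_sets_eq[of "borel :: 'a measure"] by (simp add: \<nu>_def sets_measure_of_conv)
  \<comment> \<open>Only finite additivity survives a pointwise limit by itself; domination by the
    finite measure \<open>M'\<close> supplies continuity at the empty set.\<close>
  have ca: "countably_additive (sets borel) (\<lambda>A. ennreal (m A))"
  proof (rule sets.empty_continuous_imp_countably_additive)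
    show "positive (sets borel) (\<lambda>A. ennreal (m A))"
      using m2[of "{}"] m0[of "{}"] by (simp add: positive_def)
    show "additive (sets borel) (\<lambda>A. ennreal (m A))"
      using madd m0 by (auto simp: additive_def ennreal_plus[symmetric] simp del: ennreal_plus)
    fix A :: "nat \<Rightarrow> 'a set" assume A: "range A \<subseteq> sets borel" "decseq A" "(\<Inter>i. A i) = {}"
    have "(\<lambda>i. measure M' (A i)) \<longlonglongrightarrow> measure M' (\<Inter>i. A i)"
      using A by (intro M'.finite_Lim_measure_decseq) auto
    then have lim: "(\<lambda>i. 2 * C * measure M' (A i)) \<longlonglongrightarrow> 0"
      using A(3) tendsto_mult[OF tendsto_const[of "2 * C"]] by fastforce
    have "measure M' B = (LINT x|M. indicator B x * w x)" if "B \<in> sets borel" for B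
      using eM'[OF that] wA0 by (simp add: measure_def)
    then have "(\<lambda>i. m (A i)) \<longlonglongrightarrow> 0"
      using m0 m2 A(1) by (intro tendsto_sandwich[OF _ _ tendsto_const lim] always_eventually) auto
    then show "(\<lambda>i. ennreal (m (A i))) \<longlonglongrightarrow> 0"
      using tendsto_ennrealI by fastforce
  qed auto
  have e\<nu>: "emeasure \<nu> A = ennreal (m A)" if "A \<in> sets borel" for A
    using ca that m2[of "{}"] m0[of "{}"] unfolding \<nu>_def
    by (intro emeasure_measure_of_sigma) (auto simp: positive_def sets.sigma_algebra_axioms[of borel, simplified])
  have "absolutely_continuous M' \<nu>"
    unfolding absolutely_continuous_def
  proof
    fix A assume "A \<in> null_sets M'"
    then have A: "A \<in> sets borel" "emeasure M' A = 0" by (auto simp: null_sets_def)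
    then have "(LINT x|M. indicator A x * w x) = 0" using eM'[OF A(1)] wA0[of A] by simp
    then have "m A = 0" using m0[OF A(1)] m2[OF A(1)] by simp
    then show "A \<in> null_sets \<nu>" using A e\<nu>[OF A(1)] s\<nu> by (auto simp: null_sets_def)
  qed
  then obtain f where f[measurable]: "f \<in> borel_measurable M'" and f\<nu>: "density M' f = \<nu>"
    using M'.Radon_Nikodym[of \<nu>] s\<nu> by auto
  have \<nu>f: "ennreal (m A) = (\<integral>\<^sup>+x. f x * indicator A x \<partial>M')" if "A \<in> sets borel" for A
    using that e\<nu>[OF that] unfolding f\<nu>[symmetric] by (subst (asm) emeasure_density) auto
  \<comment> \<open>On the set where \<open>f\<close> exceeds \<open>2 * C\<close>, the bound
    \<open>m2\<close> forces the integral of the excess to vanish.\<close>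
  have fle: "AE x in M'. f x \<le> ennreal (2 * C)"
  proof -
    define A where "A = {x. ennreal (2 * C) < f x}"
    have [measurable]: "A \<in> sets M'"
    proof -
      have "{x\<in>space M'. ennreal (2 * C) < f x} \<in> sets M'" by measurable
      then show ?thesis by (simp add: A_def)
    qed
    then have Ab: "A \<in> sets borel" by simp
    have "(\<integral>\<^sup>+x. f x * indicator A x \<partial>M') \<le> (\<integral>\<^sup>+x. ennreal (2 * C) * indicator A x \<partial>M')"
      using m2[OF Ab] C0 unfolding \<nu>f[OF Ab, symmetric]
      by (simp add: nn_integral_cmult Ab eM'[OF Ab] ennreal_mult[symmetric] wA0)
    then have "(\<integral>\<^sup>+x. f x * indicator A x \<partial>M') - (\<integral>\<^sup>+x. ennreal (2 * C) * indicator A x \<partial>M') = 0"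
      using \<nu>f[OF Ab, symmetric] by (simp add: diff_eq_0_iff_ennreal)
    moreover have "(\<integral>\<^sup>+x. f x * indicator A x - ennreal (2 * C) * indicator A x \<partial>M')
       = (\<integral>\<^sup>+x. f x * indicator A x \<partial>M') - (\<integral>\<^sup>+x. ennreal (2 * C) * indicator A x \<partial>M')"
    proof (rule nn_integral_diff)
      show "(\<integral>\<^sup>+x. ennreal (2 * C) * indicator A x \<partial>M') \<noteq> \<infinity>"
        by (simp add: nn_integral_cmult ennreal_mult_eq_top_iff Ab eM'[OF Ab])
      show "AE x in M'. ennreal (2 * C) * indicator A x \<le> f x * indicator A x"
        by (auto simp: A_def indicator_def less_imp_le)
    qed auto
    ultimately have "(\<integral>\<^sup>+x. f x * indicator A x - ennreal (2 * C) * indicator A x \<partial>M') = 0"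
      by simp
    then have "AE x in M'. f x * indicator A x - ennreal (2 * C) * indicator A x = 0"
      by (subst (asm) nn_integral_0_iff_AE) auto
    then show ?thesis
    proof eventually_elim
      case (elim x)
      show ?case
      proof (rule ccontr)
        assume "\<not> f x \<le> ennreal (2 * C)"
        then have "x \<in> A" by (simp add: A_def)
        then show False
          using elim \<open>\<not> f x \<le> ennreal (2 * C)\<close> by (simp add: diff_eq_0_iff_ennreal)
      qed
    qed
  qed
  \<comment> \<open>Subtracting \<open>C\<close> undoes the shift that made \<open>m\<close>
    nonnegative. The minimum turns the almost everywhere bound \<open>fle\<close> into one valid
    everywhere.\<close>
  define g where "g x = enn2real (min (f x) (ennreal (2 * C))) - C" for x
  have g[measurable]: "g \<in> borel_measurable borel"
    using f unfolding g_def by measurable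
  have min_top: "min (f x) (ennreal (2 * C)) < top" for x by (simp add: min_less_iff_disj)
  have gC: "\<bar>g x\<bar> \<le> C" for x
  proof -
    have "enn2real (min (f x) (ennreal (2 * C))) \<le> 2 * C"
      using C0 by (intro enn2real_leI) auto
    then show ?thesis using enn2real_nonneg[of "min (f x) (ennreal (2 * C))"]
      by (simp add: g_def abs_le_iff)
  qed
  have LAg: "L (\<lambda>x. indicator A x * w x) = (LINT x|M. indicator A x * w x * g x)" if A[measurable]: "A \<in> sets borel" for A
  proof -
    have nn: "0 \<le> indicator A x * w x * (g x + C)" for x
    proof -
      have "0 \<le> g x + C" using gC[of x] by linarith
      then show ?thesis using wpos[of x] by simp
    qed
    have "ennreal (m A) = (\<integral>\<^sup>+x. f x * indicator A x \<partial>M')" by (rule \<nu>f[OF that])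
    also have "\<dots> = (\<integral>\<^sup>+x. ennreal ((g x + C) * indicator A x) \<partial>M')"
      using fle by (intro nn_integral_cong_AE, eventually_elim)
        (auto simp: g_def indicator_def min_absorb1 dest: le_less_trans[OF _ ennreal_less_top])
    also have "\<dots> = (\<integral>\<^sup>+x. ennreal (w x) * ennreal ((g x + C) * indicator A x) \<partial>M)"
      unfolding M'_def by (intro nn_integral_density) auto
    also have "\<dots> = (\<integral>\<^sup>+x. ennreal (indicator A x * w x * (g x + C)) \<partial>M)"
      using wpos by (intro nn_integral_cong) (auto simp: indicator_def ennreal_mult'[symmetric] less_imp_le)
    also have "\<dots> = ennreal (LINT x|M. indicator A x * w x * (g x + C))"
    proof (rule nn_integral_eq_integral)
      have "\<bar>g x + C\<bar> \<le> 2 * C" for x using gC[of x] by linarith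
      then show "integrable M (\<lambda>x. indicator A x * w x * (g x + C))"
        by (intro integrable_mult_bounded iAw that) auto
      show "AE x in M. 0 \<le> indicator A x * w x * (g x + C)" using nn by simp
    qed
    finally have "m A = (LINT x|M. indicator A x * w x * (g x + C))"
      using m0[OF that] nn by (subst (asm) ennreal_inj) (auto intro!: integral_nonneg_AE)
    also have "\<dots> = (LINT x|M. indicator A x * w x * g x + C * (indicator A x * w x))"
      by (simp add: algebra_simps)
    also have "\<dots> = (LINT x|M. indicator A x * w x * g x) + C * (LINT x|M. indicator A x * w x)"
      using integrable_mult_bounded(1)[OF iAw[OF that] g gC] iAw[OF that]
      by (subst Bochner_Integration.integral_add) auto
    finally show ?thesis by (simp add: m_def)
  qed
  have iM': "integrable M' k \<longleftrightarrow> integrable M (\<lambda>x. k x * w x)" if "k \<in> borel_measurable borel" for k :: "'a \<Rightarrow> real"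
    unfolding M'_def using that wpos by (subst integrable_density) (auto simp: less_imp_le mult.commute)
  have iM'D: "integrable M (\<lambda>x. k x * w x)" if "integrable M' k" for k
    using iM'[of k] that borel_measurable_integrable[OF that] by simp
  \<comment> \<open>The identity on indicators extends to all \<open>M'\<close>-integrable
    \<open>k\<close>. Since \<open>w\<close> has no zeros, every \<open>M\<close>-integrable
    function is of the form \<open>k x * w x\<close>.\<close>
  have main: "L (\<lambda>x. k x * w x) = (LINT x|M. k x * w x * g x)" if "integrable M' k" for k
    using that
  proof (induction k rule: integrable_induct)
    case (base A c)
    then have A: "A \<in> sets borel" by simp
    have "L (\<lambda>x. indicator A x *\<^sub>R c * w x) = L (\<lambda>x. c * (indicator A x * w x))"
      by (simp add: algebra_simps)
    also have "\<dots> = c * L (\<lambda>x. indicator A x * w x)" by (rule Lscale[OF iAw[OF A]])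
    also have "\<dots> = c * (LINT x|M. indicator A x * w x * g x)" by (simp add: LAg[OF A])
    also have "\<dots> = (LINT x|M. c * (indicator A x * w x * g x))" by simp
    finally show ?case by (simp add: algebra_simps)
  next
    case (add f1 f2)
    have i: "integrable M (\<lambda>x. f1 x * w x)" "integrable M (\<lambda>x. f2 x * w x)"
      using iM'D[OF add.hyps(1)] iM'D[OF add.hyps(2)] by simp_all
    have "L (\<lambda>x. (f1 x + f2 x) * w x) = L (\<lambda>x. f1 x * w x) + L (\<lambda>x. f2 x * w x)"
      using Ladd[OF i] by (simp add: distrib_right)
    also have "\<dots> = (LINT x|M. f1 x * w x * g x + f2 x * w x * g x)"
      using add.IH integrable_mult_bounded(1)[OF i(1) g gC] integrable_mult_bounded(1)[OF i(2) g gC] by simp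
    finally show ?case by (simp add: distrib_right)
  next
    case (lim k s)
    have ik: "integrable M (\<lambda>x. k x * w x)" and isi: "integrable M (\<lambda>x. s i x * w x)" for i
      using iM'D[OF lim.hyps(4)] iM'D[OF lim.hyps(1)] by simp_all
    have c: "(\<lambda>i. LINT x|M. \<bar>s i x * w x - k x * w x\<bar>) \<longlonglongrightarrow> (LINT x|M. 0)"
    proof (rule integral_dominated_convergence[where w="\<lambda>x. 3 * \<bar>k x * w x\<bar>"])
      have "(\<lambda>i. \<bar>s i x * w x - k x * w x\<bar>) \<longlonglongrightarrow> \<bar>k x * w x - k x * w x\<bar>" for x
        by (intro tendsto_intros lim.hyps) simp
      then show "AE x in M. (\<lambda>i. \<bar>s i x * w x - k x * w x\<bar>) \<longlonglongrightarrow> 0" by simp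
      have "norm \<bar>s i x * w x - k x * w x\<bar> \<le> 3 * \<bar>k x * w x\<bar>" for x i
      proof -
        have "\<bar>s i x - k x\<bar> \<le> 3 * \<bar>k x\<bar>" using lim.hyps(3)[of x i] by auto
        from mult_right_mono[OF this less_imp_le[OF wpos[of x]]] show ?thesis
          using wpos[of x] by (simp add: abs_mult flip: left_diff_distrib)
      qed
      then show "AE x in M. norm \<bar>s i x * w x - k x * w x\<bar> \<le> 3 * \<bar>k x * w x\<bar>" for i by simp
    qed (use ik isi in auto)
    show ?case
    proof (rule LIMSEQ_unique)
      have Ls: "L (\<lambda>x. s i x * w x) = (LINT x|M. s i x * w x * g x)" for i by (rule lim.IH)
      have b1: "\<bar>(LINT x|M. s i x * w x * g x) - (LINT x|M. k x * w x * g x)\<bar>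
          \<le> C * (LINT x|M. \<bar>s i x * w x - k x * w x\<bar>)" for i
      proof -
        have "(LINT x|M. s i x * w x * g x) - (LINT x|M. k x * w x * g x)
            = (LINT x|M. (s i x * w x - k x * w x) * g x)"
          using integrable_mult_bounded(1)[OF isi g gC] integrable_mult_bounded(1)[OF ik g gC]
          by (simp add: left_diff_distrib)
        also have "\<bar>\<dots>\<bar> \<le> C * (LINT x|M. \<bar>s i x * w x - k x * w x\<bar>)"
          using ik isi by (intro integrable_mult_bounded g gC) auto
        finally show ?thesis .
      qed
      have b2: "\<bar>L (\<lambda>x. s i x * w x) - L (\<lambda>x. k x * w x)\<bar>
          \<le> C * (LINT x|M. \<bar>s i x * w x - k x * w x\<bar>)" for i
      proof -
        have "L (\<lambda>x. s i x * w x) = L (\<lambda>x. k x * w x + (s i x * w x - k x * w x))" by simp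
        also have "\<dots> = L (\<lambda>x. k x * w x) + L (\<lambda>x. s i x * w x - k x * w x)"
          using ik isi by (intro Ladd) auto
        finally show ?thesis using Lb[of "\<lambda>x. s i x * w x - k x * w x"] ik isi by simp
      qed
      have z: "(\<lambda>i. C * (LINT x|M. \<bar>s i x * w x - k x * w x\<bar>)) \<longlonglongrightarrow> 0"
        using tendsto_mult[OF tendsto_const c, of C] by simp
      show "(\<lambda>i. L (\<lambda>x. s i x * w x)) \<longlonglongrightarrow> L (\<lambda>x. k x * w x)"
        using b2 by (intro LIM_zero_cancel[OF Lim_null_comparison[OF _ z]] always_eventually) simp
      show "(\<lambda>i. L (\<lambda>x. s i x * w x)) \<longlonglongrightarrow> (LINT x|M. k x * w x * g x)"
        unfolding Ls using b1 by (intro LIM_zero_cancel[OF Lim_null_comparison[OF _ z]] always_eventually) simp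
    qed
  qed
  have "(\<lambda>k. LINT x|M. f x * G k x) \<longlonglongrightarrow> (LINT x|M. f x * g x)" if f: "integrable M f" for f
  proof -
    have [measurable]: "f \<in> borel_measurable borel" using f by (auto dest: borel_measurable_integrable)
    have w0: "w x \<noteq> 0" for x using wpos[of x] by simp
    then have eq: "f x / w x * w x = f x" for x by simp
    have "integrable M' (\<lambda>x. f x / w x)" using f by (subst iM') (auto simp: w0)
    from main[OF this] have "L f = (LINT x|M. f x * g x)" by (simp add: w0)
    then show ?thesis using L[OF f] by simp
  qed
  then show thesis using that g gC by blast
qed

end

section \<open>Ahlfors regular measures\<close>

text \<open>Countable subadditivity for index sets that come without an enumeration, such as the
  family of balls selected by Vitali's lemma.\<close>

lemma emeasure_UN_le_count_space:
  assumes "countable I" and X [measurable]: "\<And>i. i \<in> I \<Longrightarrow> X i \<in> sets M"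
  shows "emeasure M (\<Union>i\<in>I. X i) \<le> (\<integral>\<^sup>+i. emeasure M (X i) \<partial>count_space I)"
proof -
  have [measurable]: "(\<Union>i\<in>I. X i) \<in> sets M" using assms by auto
  have "emeasure M (\<Union>i\<in>I. X i) = (\<integral>\<^sup>+x. indicator (\<Union>i\<in>I. X i) x \<partial>M)" by simp
  also have "\<dots> \<le> (\<integral>\<^sup>+x. \<integral>\<^sup>+i. indicator (X i) x \<partial>count_space I \<partial>M)"
  proof (rule nn_integral_mono)
    fix x
    show "indicator (\<Union>i\<in>I. X i) x \<le> (\<integral>\<^sup>+i. indicator (X i) x \<partial>count_space I)"
    proof (cases "x \<in> (\<Union>i\<in>I. X i)")
      case True
      then obtain i where "i \<in> I" "x \<in> X i" by blast
      then show ?thesis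
        using True nn_integral_ge_point[OF \<open>i \<in> I\<close>, of "\<lambda>i. indicator (X i) x"] by simp
    qed simp
  qed
  also have "\<dots> = (\<integral>\<^sup>+i. \<integral>\<^sup>+x. indicator (X i) x \<partial>M \<partial>count_space I)"
    by (rule nn_integral_count_space_nn_integral) (use assms in auto)
  also have "\<dots> = (\<integral>\<^sup>+i. emeasure M (X i) \<partial>count_space I)"
    by (intro nn_integral_cong) (auto simp: X)
  finally show ?thesis .
qed

context radon begin

text \<open>Serves for exceptional sets whose own measurability is unknown: the intersection of
  measurable supersets of measure at most \<open>1 / Suc k\<close> is a null set containing
  them.\<close>

lemma null_set_approx:
  assumes "\<And>e. e > 0 \<Longrightarrow> \<exists>V\<in>sets borel. B \<subseteq> V \<and> emeasure M V \<le> ennreal e"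
  shows "\<exists>N\<in>null_sets M. B \<subseteq> N"
proof -
  have "\<exists>V. \<forall>k. V k \<in> sets borel \<and> B \<subseteq> V k \<and> emeasure M (V k) \<le> ennreal (1 / Suc k)"
    using assms by (intro choice) (metis divide_pos_pos of_nat_0_less_iff zero_less_Suc zero_less_one)
  then obtain V where V: "\<And>k. V k \<in> sets borel" "\<And>k. B \<subseteq> V k" 
    "\<And>k. emeasure M (V k) \<le> ennreal (1 / Suc k)" by auto
  define N where "N = (\<Inter>k. V k)"
  have N: "N \<in> sets borel" using V(1) by (auto simp: N_def)
  have "emeasure M N \<le> ennreal (1 / Suc k)" for k
    using V by (intro order_trans[OF emeasure_mono V(3)]) (auto simp: N_def)
  moreover have "(\<lambda>k. ennreal (1 / Suc k)) \<longlonglongrightarrow> ennreal 0"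
    using LIMSEQ_inverse_real_of_nat by (intro tendsto_ennrealI) (simp add: inverse_eq_divide)
  ultimately have "emeasure M N \<le> ennreal 0"
    by (intro LIMSEQ_le_const) auto
  then have "N \<in> null_sets M" using N by (auto simp: null_sets_def)
  moreover have "B \<subseteq> N" using V(2) by (auto simp: N_def)
  ultimately show ?thesis by blast
qed

lemma measure_mono_bounded:
  assumes "A \<subseteq> B" "bounded B" "A \<in> sets borel" "B \<in> sets borel"
  shows "measure M A \<le> measure M B"
  using assms finite_bounded[of B] by (intro measure_mono_fmeasurable) (auto simp: fmeasurable_def)

lemma emeasure_bounded:
  assumes "bounded A" "A \<in> sets borel"
  shows "emeasure M A = ennreal (measure M A)"
  using finite_bounded[OF assms] by (intro emeasure_eq_ennreal_measure) auto

lemma set_integrable_bounded: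
  fixes f :: "'a \<Rightarrow> 'b::{banach, second_countable_topology}"
  assumes f: "f \<in> borel_measurable borel" and B: "\<And>x. norm (f x) \<le> B"
    and D: "bounded D" "D \<in> sets borel"
  shows "set_integrable M D f"
proof -
  obtain R where R: "D \<subseteq> ball 0 R" using bounded_subset_ballD[OF D(1)] by blast
  have "0 \<le> B" using order_trans[OF norm_ge_zero B] .
  show ?thesis unfolding set_integrable_def
  proof (rule integrable_bounded_support[of _ B R])
    show "(\<lambda>x. indicat_real D x *\<^sub>R f x) \<in> borel_measurable borel"
      using f D by measurable
    show "norm (indicat_real D x *\<^sub>R f x) \<le> B" for x
      using B[of x] \<open>0 \<le> B\<close> by (auto simp: indicator_def)
    show "indicat_real D x *\<^sub>R f x = 0" if "R \<le> norm x" for x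
      using R that by (auto simp: indicator_def)
  qed
qed

end

text \<open>Because of \<open>concentrated\<close>, balls can be measured without intersecting them
  with \<open>F\<close>. \<open>R0\<close> stands in for the diameter: later it is the distance of
  two points of \<open>F\<close>, below which both bounds hold.\<close>

locale ahlfors = radon M for M :: "'a::euclidean_space measure" +
  fixes F :: "'a set" and A R0 :: real
  assumes closed_F: "closed F" and R0: "R0 > 0" and A: "A \<ge> 1"
    and concentrated: "emeasure M (- F) = 0"
    and lower: "\<And>x r. x \<in> F \<Longrightarrow> 0 < r \<Longrightarrow> r < R0 \<Longrightarrow> r ^ (DIM('a) - 1) \<le> A * measure M (ball x r)"
    and upper: "\<And>x r. x \<in> F \<Longrightarrow> 0 < r \<Longrightarrow> r < R0 \<Longrightarrow> measure M (ball x r) \<le> A * r ^ (DIM('a) - 1)"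
begin

lemma ball_pos: "x \<in> F \<Longrightarrow> 0 < r \<Longrightarrow> r < R0 \<Longrightarrow> 0 < measure M (ball x r)"
proof -
  assume *: "x \<in> F" "0 < r" "r < R0"
  then have "0 < A * measure M (ball x r)" using lower[OF *] by (metis less_le_trans zero_less_power)
  then show ?thesis using A by (simp add: zero_less_mult_iff)
qed

lemma AE_F: "AE x in M. x \<in> F"
  using concentrated closed_F by (intro AE_I[of _ _ "- F"]) auto

section \<open>Density points and Lebesgue points by Vitali's covering lemma\<close>

lemma doubling:
  assumes "x \<in> F" "0 < r" "5 * r < R0"
  shows "measure M (ball x (5 * r)) \<le> A\<^sup>2 * 5 ^ (DIM('a) - 1) * measure M (ball x r)"
proof -
  have "measure M (ball x (5 * r)) \<le> A * (5 * r) ^ (DIM('a) - 1)"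
    using assms by (intro upper) auto
  also have "\<dots> = A * 5 ^ (DIM('a) - 1) * r ^ (DIM('a) - 1)" by (simp add: power_mult_distrib)
  also have "\<dots> \<le> A * 5 ^ (DIM('a) - 1) * (A * measure M (ball x r))"
    using assms A R0 by (intro mult_left_mono lower) auto
  finally show ?thesis by (simp add: power2_eq_square algebra_simps)
qed

text \<open>Around a bad point there are arbitrarily small bad balls, so they can be taken inside an
  open set \<open>U\<close> that exceeds \<open>E'\<close> by little. For disjoint bad balls the
  parts outside \<open>E\<close> have total measure at most that of \<open>U - E'\<close>; doubling
  transfers this to the fivefold balls, which cover all bad points.\<close>

lemma density_points_aux:
  assumes E [measurable]: "E \<in> sets borel" and "t > 0" and m: "m > 0"
  shows "\<exists>N\<in>null_sets M. {x \<in> E \<inter> F \<inter> ball 0 m. \<forall>\<delta>>0. \<exists>r. 0 < r \<and> r < \<delta> \<and>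
    t * measure M (ball x r) < measure M (ball x r - E)} \<subseteq> N" (is "\<exists>N\<in>_. ?B \<subseteq> N")
proof (rule null_set_approx)
  fix e :: real assume "e > 0"
  define K where "K = A\<^sup>2 * 5 ^ (DIM('a) - 1)"
  have K: "K > 0" using A by (simp add: K_def)
  define E' where "E' = E \<inter> ball 0 m"
  have E' [measurable]: "E' \<in> sets borel" by (simp add: E'_def)
  have "bounded E'" by (auto simp: E'_def)
  \<comment> \<open>The excess gets multiplied by \<open>K / t\<close> below: \<open>K\<close> is
    the doubling constant and \<open>1 / t\<close> comes from the badness of the balls.\<close>
  then obtain U where U: "open U" "bounded U" "E' \<subseteq> U" "measure M (U - E') < e * t / K"
    using outer_regular_bounded[of E' "e * t / K"] E' \<open>e > 0\<close> \<open>t > 0\<close> K by auto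
  define I where "I = {(x, r). x \<in> ?B \<and> 0 < r \<and> r < R0 / 5 \<and> ball x r \<subseteq> U \<inter> ball 0 m \<and>
     t * measure M (ball x r) < measure M (ball x r - E)}"
  have cover: "?B \<subseteq> (\<Union>i\<in>I. ball (fst i) (snd i))"
  proof
    fix x assume x: "x \<in> ?B"
    then have "x \<in> U \<inter> ball 0 m" using U(3) by (auto simp: E'_def)
    moreover have "open (U \<inter> ball 0 m)" using U by auto
    ultimately obtain \<delta> where \<delta>: "\<delta> > 0" "ball x \<delta> \<subseteq> U \<inter> ball 0 m"
      using open_contains_ball by blast
    obtain r where r: "0 < r" "r < min \<delta> (R0 / 5)" "t * measure M (ball x r) < measure M (ball x r - E)"
      using x \<delta>(1) R0 by (auto dest!: spec[of _ "min \<delta> (R0 / 5)"])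
    have "ball x r \<subseteq> ball x \<delta>" using r by auto
    then have "(x, r) \<in> I" using x r \<delta> by (auto simp: I_def)
    then show "x \<in> (\<Union>i\<in>I. ball (fst i) (snd i))" using r(1) by (intro UN_I[of "(x, r)"]) auto
  qed
  have rI: "0 < snd i \<and> snd i \<le> R0 / 5" if "i \<in> I" for i
    using that by (auto simp: I_def)
  obtain C where C: "countable C" "C \<subseteq> I"
    "pairwise (\<lambda>i j. disjnt (ball (fst i) (snd i)) (ball (fst j) (snd j))) C"
    "?B \<subseteq> (\<Union>i\<in>C. ball (fst i) (5 * snd i))"
    by (rule Vitali_covering_lemma_balls[OF cover rI])
  define V where "V = (\<Union>i\<in>C. ball (fst i) (5 * snd i))"
  have V: "V \<in> sets borel" unfolding V_def by (intro borel_open) auto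
  have "emeasure M V \<le> (\<integral>\<^sup>+i. emeasure M (ball (fst i) (5 * snd i)) \<partial>count_space C)"
    unfolding V_def by (intro emeasure_UN_le_count_space C) auto
  also have "\<dots> \<le> (\<integral>\<^sup>+i. ennreal (K / t) * emeasure M (ball (fst i) (snd i) - E) \<partial>count_space C)"
  proof (rule nn_integral_mono)
    fix i assume "i \<in> space (count_space C)"
    then have "i \<in> I" using C by auto
    then have i: "fst i \<in> F" "0 < snd i" "5 * snd i < R0"
      "t * measure M (ball (fst i) (snd i)) < measure M (ball (fst i) (snd i) - E)"
      by (auto simp: I_def)
    have "measure M (ball (fst i) (5 * snd i)) \<le> K * measure M (ball (fst i) (snd i))"
      using doubling[OF i(1-3)] by (simp add: K_def)
    also have "\<dots> \<le> K * (measure M (ball (fst i) (snd i) - E) / t)"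
      using i(4) \<open>t > 0\<close> K by (intro mult_left_mono) (auto simp: field_simps)
    finally have "ennreal (measure M (ball (fst i) (5 * snd i)))
      \<le> ennreal (K / t * measure M (ball (fst i) (snd i) - E))" by (intro ennreal_leI) simp
    then show "emeasure M (ball (fst i) (5 * snd i))
      \<le> ennreal (K / t) * emeasure M (ball (fst i) (snd i) - E)"
      using K \<open>t > 0\<close> by (simp add: emeasure_bounded bounded_diff flip: ennreal_mult')
  qed
  also have "\<dots> = ennreal (K / t) * (\<integral>\<^sup>+i. emeasure M (ball (fst i) (snd i) - E) \<partial>count_space C)"
    by (rule nn_integral_cmult) simp
  also have "(\<integral>\<^sup>+i. emeasure M (ball (fst i) (snd i) - E) \<partial>count_space C)
      = emeasure M (\<Union>i\<in>C. ball (fst i) (snd i) - E)"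
  proof (intro emeasure_UN_countable[symmetric])
    show "disjoint_family_on (\<lambda>i. ball (fst i) (snd i) - E) C"
      using C(3) unfolding disjoint_family_on_def pairwise_def disjnt_def by blast
  qed (use C(1) in auto)
  also have "\<dots> \<le> emeasure M (U - E')"
  proof (rule emeasure_mono)
    have "ball (fst i) (snd i) \<subseteq> U" if "i \<in> C" for i
    proof -
      have "i \<in> I" using C(2) that by blast
      then show ?thesis by (cases i) (auto simp: I_def)
    qed
    then show "(\<Union>i\<in>C. ball (fst i) (snd i) - E) \<subseteq> U - E'" by (auto simp: E'_def)
  qed (use U(1) in auto)
  also have "\<dots> = ennreal (measure M (U - E'))"
    using U by (intro emeasure_bounded) (auto intro: bounded_diff)
  also have "ennreal (K / t) * \<dots> \<le> ennreal (K / t) * ennreal (e * t / K)"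
    using U(4) by (intro mult_left_mono ennreal_leI) auto
  also have "\<dots> = ennreal e"
    using K \<open>t > 0\<close> \<open>e > 0\<close> by (simp add: ennreal_mult[symmetric])
  finally have "emeasure M V \<le> ennreal e" by (simp add: mult_left_mono)
  then show "\<exists>V\<in>sets borel. ?B \<subseteq> V \<and> emeasure M V \<le> ennreal e"
    using V C(4) by (auto simp: V_def)
qed

lemma density_points:
  assumes E [measurable]: "E \<in> sets borel"
  shows "AE x in M. x \<in> E \<longrightarrow> (\<forall>\<epsilon>>0. \<exists>\<delta>>0. \<forall>r. 0 < r \<and> r < \<delta> \<longrightarrow>
    measure M (ball x r - E) \<le> \<epsilon> * measure M (ball x r))"
proof -
  define B where "B t m = {x \<in> E \<inter> F \<inter> ball 0 m. \<forall>\<delta>>0. \<exists>r. 0 < r \<and> r < \<delta> \<and>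
    t * measure M (ball x r) < measure M (ball x r - E)}" for t m :: real
  have "AE x in M. x \<notin> B (1 / Suc k) (Suc m)" for k m :: nat
  proof -
    obtain N where "N \<in> null_sets M" "B (1 / Suc k) (Suc m) \<subseteq> N"
      using density_points_aux[OF E, of "1 / Suc k" "Suc m"] by (auto simp: B_def)
    then show ?thesis by (intro AE_I'[of N]) auto
  qed
  then have "AE x in M. \<forall>k m. x \<notin> B (1 / Suc k) (Suc m)"
    by (simp add: AE_all_countable)
  with AE_F show ?thesis
  proof eventually_elim
    case (elim x)
    show ?case
    proof (intro impI allI)
      fix \<epsilon> :: real assume "x \<in> E" "\<epsilon> > 0"
      obtain k where k: "1 / Suc k < \<epsilon>" using \<open>\<epsilon> > 0\<close> nat_approx_posE by metis
      obtain m :: nat where "norm x < m" using reals_Archimedean2 by blast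
      then have "x \<in> ball 0 (Suc m)" by simp
      with elim \<open>x \<in> E\<close> have "\<not> (\<forall>\<delta>>0. \<exists>r. 0 < r \<and> r < \<delta> \<and>
        1 / Suc k * measure M (ball x r) < measure M (ball x r - E))"
        unfolding B_def by blast
      then obtain \<delta> where \<delta>: "\<delta> > 0" "\<And>r. 0 < r \<Longrightarrow> r < \<delta> \<Longrightarrow>
         measure M (ball x r - E) \<le> 1 / Suc k * measure M (ball x r)"
        by (meson not_less)
      have "1 / Suc k * measure M (ball x r) \<le> \<epsilon> * measure M (ball x r)" for r
        using k by (intro mult_right_mono) auto
      with \<delta> show "\<exists>\<delta>>0. \<forall>r. 0 < r \<and> r < \<delta> \<longrightarrow>
          measure M (ball x r - E) \<le> \<epsilon> * measure M (ball x r)"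
        by (meson order_trans)
    qed
  qed
qed

definition lebesgue_point :: "('a \<Rightarrow> 'a) \<Rightarrow> 'a \<Rightarrow> bool" where
  "lebesgue_point g x \<longleftrightarrow> (\<forall>\<epsilon>>0. \<exists>\<delta>>0. \<forall>r. 0 < r \<and> r < \<delta> \<longrightarrow>
     (LINT y:ball x r|M. norm (g y - g x)) \<le> \<epsilon> * measure M (ball x r))"

text \<open>Apply \<open>density_points\<close> to the preimages of small balls about a countable
  dense set of values. Near almost every \<open>x\<close>, \<open>g\<close> then stays close to
  \<open>g x\<close> except on a small fraction of the ball, where the bound \<open>C\<close>
  controls the contribution.\<close>

lemma AE_lebesgue_point:
  assumes g [measurable]: "g \<in> borel_measurable borel" and C: "\<And>x. norm (g x) \<le> C"
  shows "AE x in M. lebesgue_point g x"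
proof -
  have "0 \<le> C" using order_trans[OF norm_ge_zero C] .
  obtain D :: "'a set" where D: "countable D" "\<And>X. open X \<Longrightarrow> X \<noteq> {} \<Longrightarrow> \<exists>d\<in>D. d \<in> X"
    using countable_dense_setE by blast
  define E where "E q k = g -` ball q (1 / Suc k)" for q and k :: nat
  have E [measurable]: "E q k \<in> sets borel" for q k
    unfolding E_def using measurable_sets_borel[OF g, of "ball q (1 / Suc k)"] by simp
  have "AE x in M. \<forall>q\<in>D. \<forall>k. x \<in> E q k \<longrightarrow> (\<forall>\<epsilon>>0. \<exists>\<delta>>0. \<forall>r. 0 < r \<and> r < \<delta> \<longrightarrow>
    measure M (ball x r - E q k) \<le> \<epsilon> * measure M (ball x r))"
    using density_points[OF E] by (simp add: AE_ball_countable[OF D(1)] AE_all_countable)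
  then show ?thesis
  proof eventually_elim
    case (elim x)
    show ?case unfolding lebesgue_point_def
    proof (intro allI impI)
      fix \<epsilon> :: real assume "\<epsilon> > 0"
      then obtain k where k: "1 / Suc k < \<epsilon> / 4" using nat_approx_posE[of "\<epsilon> / 4"] by auto
      obtain q where q: "q \<in> D" "q \<in> ball (g x) (1 / Suc k)" using D(2)[of "ball (g x) (1 / Suc k)"] by auto
      then have xE: "x \<in> E q k" by (auto simp: E_def dist_commute)
      define \<eta> where "\<eta> = \<epsilon> / (4 * (C + 1))"
      have "\<eta> > 0" using \<open>\<epsilon> > 0\<close> \<open>0 \<le> C\<close> by (simp add: \<eta>_def)
      have "\<exists>\<delta>>0. \<forall>r. 0 < r \<and> r < \<delta> \<longrightarrow> measure M (ball x r - E q k) \<le> \<eta> * measure M (ball x r)"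
        using elim[rule_format, OF q(1) xE \<open>\<eta> > 0\<close>] .
      then obtain \<delta> where \<delta>: "\<delta> > 0" "\<And>r. 0 < r \<Longrightarrow> r < \<delta> \<Longrightarrow>
        measure M (ball x r - E q k) \<le> \<eta> * measure M (ball x r)"
        by auto
      have "(LINT y:ball x r|M. norm (g y - g x)) \<le> \<epsilon> * measure M (ball x r)" if r: "0 < r" "r < \<delta>" for r
      proof -
        have n: "norm (g y - g x) \<le> 2 * C" for y
          using norm_triangle_ineq4[of "g y" "g x"] C[of y] C[of x] by linarith
        have i1: "set_integrable M (ball x r) (\<lambda>y. norm (g y - g x))"
          using n by (intro set_integrable_bounded[of _ "2 * C"]) auto
        have i2: "integrable M (\<lambda>y. \<epsilon> / 2 * indicator (ball x r) y + 2 * C * indicator (ball x r - E q k) y)"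
          using finite_bounded[of "ball x r"] finite_bounded[of "ball x r - E q k"]
          by (intro Bochner_Integration.integrable_add integrable_mult_right integrable_real_indicator)
            (simp_all add: bounded_diff)
        have "(LINT y:ball x r|M. norm (g y - g x))
          \<le> (LINT y|M. \<epsilon> / 2 * indicator (ball x r) y + 2 * C * indicator (ball x r - E q k) y)"
          unfolding set_lebesgue_integral_def
        proof (rule integral_mono)
          show "integrable M (\<lambda>y. indicat_real (ball x r) y *\<^sub>R norm (g y - g x))"
            using i1 unfolding set_integrable_def .
          fix y
          have "norm (g y - g x) \<le> \<epsilon> / 2" if "y \<in> E q k"
          proof -
            have "dist q (g y) < 1 / Suc k" "dist q (g x) < 1 / Suc k"
              using that xE by (auto simp: E_def)
            then have "dist (g y) (g x) < \<epsilon> / 2" using k dist_triangle3[of "g y" "g x" q] by linarith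
            then show ?thesis by (simp add: dist_norm)
          qed
          then show "indicat_real (ball x r) y *\<^sub>R norm (g y - g x)
             \<le> \<epsilon> / 2 * indicator (ball x r) y + 2 * C * indicator (ball x r - E q k) y"
            using n[of y] \<open>\<epsilon> > 0\<close> by (auto simp: indicator_def)
        qed (rule i2)
        also have "\<dots> = \<epsilon> / 2 * measure M (ball x r) + 2 * C * measure M (ball x r - E q k)"
          using finite_bounded[of "ball x r"] finite_bounded[of "ball x r - E q k"]
          by (subst Bochner_Integration.integral_add)
            (simp_all add: integrable_real_indicator bounded_diff)
        also have "\<dots> \<le> \<epsilon> / 2 * measure M (ball x r) + 2 * C * (\<eta> * measure M (ball x r))"
          using \<delta>(2)[OF r] \<open>0 \<le> C\<close> by (intro add_left_mono mult_left_mono) auto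
        also have "2 * C * \<eta> \<le> \<epsilon> / 2"
          using \<open>0 \<le> C\<close> \<open>\<epsilon> > 0\<close> by (simp add: \<eta>_def divide_simps)
        then have "\<epsilon> / 2 * measure M (ball x r) + 2 * C * (\<eta> * measure M (ball x r)) \<le> \<epsilon> * measure M (ball x r)"
          using mult_right_mono[of "2 * C * \<eta>" "\<epsilon> / 2" "measure M (ball x r)"] by (simp add: algebra_simps)
        finally show ?thesis .
      qed
      with \<delta>(1) show "\<exists>\<delta>>0. \<forall>r. 0 < r \<and> r < \<delta> \<longrightarrow>
        (LINT y:ball x r|M. norm (g y - g x)) \<le> \<epsilon> * measure M (ball x r)" by blast
    qed
  qed
qed

section \<open>Volume of the neighbourhoods of \<open>F\<close>\<close>

definition nbhd :: "real \<Rightarrow> 'a set" where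
  "nbhd s = {z. \<exists>y\<in>F. dist z y < s}"

lemma open_nbhd: "open (nbhd s)"
proof -
  have "nbhd s = (\<Union>y\<in>F. ball y s)" by (auto simp: nbhd_def dist_commute)
  then show ?thesis by auto
qed

lemma nbhd_measurable [measurable]: "nbhd s \<in> sets borel"
  using open_nbhd by simp

lemma nbhd_lower:
  assumes "z \<in> nbhd s" "0 < s" "s < R0"
  shows "s ^ (DIM('a) - 1) \<le> A * measure M (ball z (2 * s))"
proof -
  obtain y where y: "y \<in> F" "dist z y < s" using assms by (auto simp: nbhd_def)
  have "s ^ (DIM('a) - 1) \<le> A * measure M (ball y s)" using y assms by (intro lower) auto
  also have "\<dots> \<le> A * measure M (ball z (2 * s))"
  proof -
    have "ball y s \<subseteq> ball z (2 * s)"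
    proof
      fix w assume "w \<in> ball y s"
      then show "w \<in> ball z (2 * s)" using y(2) dist_triangle[of z w y] by simp
    qed
    then show ?thesis using A by (intro mult_left_mono measure_mono_bounded) auto
  qed
  finally show ?thesis .
qed

text \<open>A ball with arbitrary centre either misses \<open>F\<close> and is null, or lies in a
  ball of twice the radius centred on \<open>F\<close>.\<close>

lemma upper_general:
  assumes "0 < r" "2 * r < R0"
  shows "measure M (ball x r) \<le> A * (2 * r) ^ (DIM('a) - 1)"
proof (cases "ball x r \<inter> F = {}")
  case True
  then have "measure M (ball x r) \<le> measure M (- F)"
    using concentrated closed_F by (intro measure_mono_fmeasurable) (auto simp: fmeasurable_def)
  then have "measure M (ball x r) \<le> 0" using concentrated by (simp add: measure_def)
  then show ?thesis using A assms by (meson order_trans mult_nonneg_nonneg zero_le_power less_imp_le zero_less_one less_le_trans mult_pos_pos zero_less_numeral)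
next
  case False
  then obtain y where y: "y \<in> F" "dist x y < r" by auto
  have "ball x r \<subseteq> ball y (2 * r)"
  proof
    fix w assume "w \<in> ball x r"
    then show "w \<in> ball y (2 * r)" using y(2) dist_triangle[of y w x] by (simp add: dist_commute)
  qed
  then have "measure M (ball x r) \<le> measure M (ball y (2 * r))" by (intro measure_mono_bounded) auto
  also have "\<dots> \<le> A * (2 * r) ^ (DIM('a) - 1)" using assms y by (intro upper) auto
  finally show ?thesis .
qed

text \<open>Every \<open>z\<close> in \<open>nbhd s\<close> sees mass at least
  \<open>s ^ (n - 1) / A\<close> in \<open>ball z (2 * s)\<close>, where \<open>n = DIM('a)\<close>.
  Integrate this over \<open>z\<close> and exchange the integrals: a fixed \<open>y\<close> is
  counted only for \<open>z\<close> in \<open>ball y (2 * s)\<close>, which explains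
  \<open>2 ^ n\<close>, and only if it lies in \<open>ball x (3 * r)\<close>, whose mass
  \<open>upper_general\<close> bounds with the factor \<open>6 ^ (n - 1)\<close>.\<close>

lemma nbhd_volume:
  assumes "0 < s" "s \<le> r" "6 * r < R0"
  shows "measure lborel (nbhd s \<inter> ball x r)
    \<le> A\<^sup>2 * measure lborel (ball (0::'a) 1) * 2 ^ DIM('a) * 6 ^ (DIM('a) - 1) * s * r ^ (DIM('a) - 1)"
proof -
  define d where "d = DIM('a) - 1"
  have d: "DIM('a) = Suc d" using DIM_positive[where 'a='a] by (simp add: d_def)
  define V where "V = measure lborel (ball (0::'a) 1)"
  define W where "W = nbhd s \<inter> ball x r"
  have W [measurable]: "W \<in> sets borel" by (simp add: W_def)
  have finW: "emeasure lborel W = ennreal (measure lborel W)"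
  proof -
    have "emeasure lborel W \<le> emeasure lborel (ball x r)" by (intro emeasure_mono) (auto simp: W_def)
    then have "emeasure lborel W < \<infinity>" using emeasure_bounded_finite[of "ball x r"] by auto
    then show ?thesis by (intro emeasure_eq_ennreal_measure) auto
  qed
  interpret lb: sigma_finite_measure "lborel :: 'a measure" by (rule sigma_finite_lborel)
  interpret p: pair_sigma_finite "lborel :: 'a measure" M ..
  have "ennreal (s ^ d / A) * emeasure lborel W = (\<integral>\<^sup>+z. ennreal (s ^ d / A) * indicator W z \<partial>lborel)"
    by (simp add: nn_integral_cmult_indicator)
  also have "\<dots> \<le> (\<integral>\<^sup>+z. \<integral>\<^sup>+y. indicator (ball x r) z * indicator (ball z (2 * s)) y \<partial>M \<partial>lborel)"
  proof (rule nn_integral_mono)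
    fix z
    show "ennreal (s ^ d / A) * indicator W z \<le> (\<integral>\<^sup>+y. indicator (ball x r) z * indicator (ball z (2 * s)) y \<partial>M)"
    proof (cases "z \<in> W")
      case True
      then have "s ^ d \<le> A * measure M (ball z (2 * s))"
        unfolding d_def using assms by (intro nbhd_lower) (auto simp: W_def)
      then have "ennreal (s ^ d / A) \<le> ennreal (measure M (ball z (2 * s)))"
        using A by (intro ennreal_leI) (simp add: field_simps)
      then show ?thesis using True
        by (simp add: W_def nn_integral_cmult emeasure_bounded)
    qed simp
  qed
  also have "\<dots> = (\<integral>\<^sup>+y. \<integral>\<^sup>+z. indicator (ball x r) z * indicator (ball z (2 * s)) y \<partial>lborel \<partial>M)"
  proof (rule p.Fubini'[symmetric])
    define Z where "Z = {p. dist x (fst p) < r \<and> dist (fst p) (snd p) < 2 * s}"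
    have "open Z" unfolding Z_def by (intro open_Collect_conj open_Collect_less continuous_intros)
    then have "Z \<in> sets (lborel \<Otimes>\<^sub>M M)"
      unfolding sets_pair_measure_cong[OF sets_lborel sets_borel] borel_prod by (rule borel_open)
    have "(\<lambda>(z, y). indicator (ball x r) z * indicator (ball z (2 * s)) y :: ennreal) = indicator Z"
      by (auto simp: indicator_def fun_eq_iff Z_def)
    also have "\<dots> \<in> borel_measurable (lborel \<Otimes>\<^sub>M M)" by (rule borel_measurable_indicator) fact
    finally show "(\<lambda>(z, y). indicator (ball x r) z * indicator (ball z (2 * s)) y :: ennreal)
      \<in> borel_measurable (lborel \<Otimes>\<^sub>M M)" .
  qed
  also have "\<dots> \<le> (\<integral>\<^sup>+y. ennreal (V * (2 * s) ^ DIM('a)) * indicator (ball x (3 * r)) y \<partial>M)"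
  proof (rule nn_integral_mono)
    fix y
    show "(\<integral>\<^sup>+z. indicator (ball x r) z * indicator (ball z (2 * s)) y \<partial>lborel)
        \<le> ennreal (V * (2 * s) ^ DIM('a)) * indicator (ball x (3 * r)) y"
    proof (cases "y \<in> ball x (3 * r)")
      case True
      have "(\<integral>\<^sup>+z. indicator (ball x r) z * indicator (ball z (2 * s)) y \<partial>lborel)
        \<le> (\<integral>\<^sup>+z. indicator (ball y (2 * s)) z \<partial>lborel)"
        by (intro nn_integral_mono) (auto simp: indicator_def dist_commute)
      also have "\<dots> = emeasure lborel (ball y (2 * s))" by simp
      also have "\<dots> = ennreal (V * (2 * s) ^ DIM('a))"
        using assms content_ball_conv_unit_ball[of "2 * s" y] emeasure_bounded_finite[of "ball y (2 * s)"]
        by (subst emeasure_eq_ennreal_measure) (auto simp: V_def mult.commute)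
      finally show ?thesis using True by simp
    next
      case False
      have "indicator (ball x r) z * indicator (ball z (2 * s)) y = (0::ennreal)" for z
        using False assms dist_triangle[of x y z] by (auto simp: indicator_def)
      then have "(\<integral>\<^sup>+z. indicator (ball x r) z * indicator (ball z (2 * s)) y \<partial>lborel) = (\<integral>\<^sup>+z. 0 \<partial>(lborel::'a measure))"
        by (intro nn_integral_cong)
      then show ?thesis by simp
    qed
  qed
  also have "\<dots> = ennreal (V * (2 * s) ^ DIM('a)) * emeasure M (ball x (3 * r))"
    by (simp add: nn_integral_cmult_indicator)
  also have "emeasure M (ball x (3 * r)) = ennreal (measure M (ball x (3 * r)))"
    by (simp add: emeasure_bounded)
  also have "\<dots> \<le> ennreal (A * (6 * r) ^ d)"
    using upper_general[of "3 * r" x] assms by (intro ennreal_leI) (simp add: d_def)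
  finally have "ennreal (s ^ d / A) * ennreal (measure lborel W)
    \<le> ennreal (V * (2 * s) ^ DIM('a)) * ennreal (A * (6 * r) ^ d)"
    unfolding finW by (simp add: mult_left_mono)
  then have "ennreal (s ^ d / A * measure lborel W) \<le> ennreal (V * (2 * s) ^ DIM('a) * (A * (6 * r) ^ d))"
    using assms A ennreal_mult'[of "s ^ d / A" "measure lborel W"]
      ennreal_mult'[of "V * (2 * s) ^ DIM('a)" "A * (6 * r) ^ d"] by (simp add: V_def)
  then have "s ^ d / A * measure lborel W \<le> V * (2 * s) ^ DIM('a) * (A * (6 * r) ^ d)"
    using assms A by (subst (asm) ennreal_le_iff) (auto simp: V_def)
  also have "\<dots> = s ^ d / A * (A\<^sup>2 * V * 2 ^ DIM('a) * 6 ^ d * s * r ^ d)"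
    using A by (simp add: d power_mult_distrib power2_eq_square)
  finally show ?thesis
    using assms A unfolding W_def V_def d_def[symmetric]
    by (subst (asm) mult_le_cancel_left_pos) auto
qed

end

section \<open>The distributional gradient as a density\<close>

locale ahlfors_domain = ahlfors M F A R0
  for M :: "'a::euclidean_space measure" and F and A R0 :: real +
  fixes \<Omega> :: "'a set"
  assumes open_\<Omega>: "open \<Omega>" and F_eq: "F = frontier \<Omega>"
begin

sublocale lb: radon "lborel :: 'a measure"
  by standard (auto intro: emeasure_bounded_finite compact_imp_bounded simp del: infinity_ennreal_def)

lemma \<Omega>_measurable [measurable]: "\<Omega> \<in> sets borel"
  using open_\<Omega> by simp

text \<open>Minus the distributional derivative of \<open>indicator \<Omega>\<close> in direction
  \<open>v\<close>; on a smooth domain it is the boundary integral of \<open>\<phi>\<close> times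
  the \<open>v\<close>-component of the outer normal.\<close>

definition flux :: "('a \<Rightarrow> real) \<Rightarrow> 'a \<Rightarrow> real" where
  "flux \<phi> v = (LINT x|lborel. indicator \<Omega> x * frechet_derivative \<phi> (at x) v)"

lemma \<Omega>_integrable:
  assumes "C1c \<phi>"
  shows "integrable lborel (\<lambda>x. indicator \<Omega> x * \<phi> x)"
  using integrable_mult_indicator[OF _ lb.C1c_integrable[OF assms], of \<Omega>] by simp

lemma flux_integrable:
  assumes "C1c \<phi>"
  shows "integrable lborel (\<lambda>x. indicator \<Omega> x * frechet_derivative \<phi> (at x) v)"
proof -
  obtain R where R: "\<And>x v. R \<le> norm x \<Longrightarrow> frechet_derivative \<phi> (at x) v = 0"
    using C1c_frechet_zero[OF assms] by metis
  obtain L where L: "\<And>x v. \<bar>frechet_derivative \<phi> (at x) v\<bar> \<le> L * norm v"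
    using C1c_lipschitz[OF assms] by metis
  have "integrable lborel (\<lambda>x. frechet_derivative \<phi> (at x) v)"
    using L R by (intro lb.integrable_bounded_support[of _ "L * norm v" R]
        borel_measurable_continuous_onI C1_frechet(2) C1cD assms) auto
  from integrable_mult_indicator[OF _ this, of \<Omega>] show ?thesis by simp
qed

lemma flux_linear:
  assumes "C1c \<phi>"
  shows "flux \<phi> v = (\<Sum>b\<in>Basis. (v \<bullet> b) * flux \<phi> b)"
proof -
  have "frechet_derivative \<phi> (at x) v = (\<Sum>b\<in>Basis. (v \<bullet> b) * frechet_derivative \<phi> (at x) b)" for x
  proof -
    interpret linear "frechet_derivative \<phi> (at x)"
      using C1_frechet(1)[OF C1cD[OF assms]] has_derivative_linear by blast
    show ?thesis
      using sum[of "\<lambda>b. (v \<bullet> b) *\<^sub>R b" Basis] by (simp add: euclidean_representation scale)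
  qed
  then have "flux \<phi> v = (LINT x|lborel. (\<Sum>b\<in>Basis. (v \<bullet> b) * (indicator \<Omega> x * frechet_derivative \<phi> (at x) b)))"
    unfolding flux_def by (simp add: sum_distrib_left mult.left_commute)
  also have "\<dots> = (\<Sum>b\<in>Basis. (v \<bullet> b) * flux \<phi> b)"
    unfolding flux_def using flux_integrable[OF assms]
    by (subst Bochner_Integration.integral_sum) auto
  finally show ?thesis .
qed

text \<open>Dominated convergence along an arbitrary null sequence. The sequence is bounded, which
  puts all difference quotients into one ball, and the Lipschitz constant of \<open>\<phi>\<close>
  supplies the majorant there.\<close>

lemma DERIV_flux:
  assumes \<phi>: "C1c \<phi>"
  shows "((\<lambda>t. LINT x|lborel. indicator \<Omega> x * \<phi> (x + t *\<^sub>R v)) has_real_derivative flux \<phi> v) (at 0)"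
  unfolding DERIV_def tendsto_at_iff_sequentially
proof (intro allI impI)
  fix X :: "nat \<Rightarrow> real" assume X: "\<forall>i. X i \<in> UNIV - {0}" "X \<longlonglongrightarrow> 0"
  obtain B where B: "\<And>i. norm (X i) \<le> B" using Bseq_eq_bounded X(2) 
    by (metis BseqE convergentI convergent_imp_Bseq)
  have B0: "0 \<le> B" using order_trans[OF norm_ge_zero B] .
  obtain R where R: "R > 0" "\<And>x. R \<le> norm x \<Longrightarrow> \<phi> x = 0"
    using C1c_frechet_zero[OF \<phi>] by metis
  obtain L where L: "L \<ge> 0" "\<And>x y. \<bar>\<phi> x - \<phi> y\<bar> \<le> L * norm (x - y)"
    using C1c_lipschitz[OF \<phi>] by metis
  define q where "q i x = indicator \<Omega> x * ((\<phi> (x + X i *\<^sub>R v) - \<phi> x) / X i)" for i x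
  define W where "W = (\<lambda>x::'a. indicator (cball 0 (R + B * norm v)) x * (L * norm v))"
  note C1c_measurable[OF \<phi>, measurable]
  have lim: "(\<lambda>i. integral\<^sup>L lborel (q i)) \<longlonglongrightarrow> flux \<phi> v"
    unfolding flux_def
  proof (rule integral_dominated_convergence[where w=W])
    show "q i \<in> borel_measurable lborel" for i unfolding q_def by measurable
    have "integrable lborel (indicat_real (cball (0::'a) (R + B * norm v)))"
      using lb.finite_compact[OF compact_cball] by (intro integrable_real_indicator) auto
    then show "integrable lborel W" unfolding W_def by (rule integrable_mult_left)
    show "AE x in lborel. (\<lambda>i. q i x) \<longlonglongrightarrow> indicator \<Omega> x * frechet_derivative \<phi> (at x) v"
    proof (intro AE_I2)
      fix x
      have "((\<lambda>t. x + t *\<^sub>R v) has_derivative (\<lambda>t. t *\<^sub>R v)) (at 0)"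
        by (auto intro!: derivative_eq_intros)
      moreover have "(\<phi> has_derivative frechet_derivative \<phi> (at x)) (at (x + 0 *\<^sub>R v))"
        using C1_frechet(1)[OF C1cD[OF \<phi>]] by simp
      ultimately have "((\<lambda>t. \<phi> (x + t *\<^sub>R v)) has_derivative (\<lambda>t. frechet_derivative \<phi> (at x) (t *\<^sub>R v))) (at 0)"
        by (rule has_derivative_compose)
      moreover have "frechet_derivative \<phi> (at x) (t *\<^sub>R v) = frechet_derivative \<phi> (at x) v * t" for t
        using linear_scale[OF has_derivative_linear[OF C1_frechet(1)[OF C1cD[OF \<phi>]]]] by simp
      ultimately have "((\<lambda>t. \<phi> (x + t *\<^sub>R v)) has_real_derivative frechet_derivative \<phi> (at x) v) (at 0)"
        by (simp add: has_field_derivative_def)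
      then have "(\<lambda>i. (\<phi> (x + X i *\<^sub>R v) - \<phi> x) / X i) \<longlonglongrightarrow> frechet_derivative \<phi> (at x) v"
        unfolding DERIV_def tendsto_at_iff_sequentially using X by (auto simp: o_def)
      then show "(\<lambda>i. q i x) \<longlonglongrightarrow> indicator \<Omega> x * frechet_derivative \<phi> (at x) v"
        unfolding q_def by (intro tendsto_intros)
    qed
    show "AE x in lborel. norm (q i x) \<le> W x" for i
    proof (intro AE_I2)
      fix x
      have Xi: "X i \<noteq> 0" using X(1) by simp
      show "norm (q i x) \<le> W x"
      proof (cases "norm x \<le> R + B * norm v")
        case True
        have "\<bar>(\<phi> (x + X i *\<^sub>R v) - \<phi> x) / X i\<bar> \<le> L * norm v"
          using L(2)[of "x + X i *\<^sub>R v" x] Xi by (simp add: field_simps)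
        then show ?thesis using True by (simp add: W_def q_def indicator_def L)
      next
        case False
        have "norm (X i *\<^sub>R v) \<le> B * norm v" using B[of i] by (simp add: mult_right_mono)
        then have "R \<le> norm (x + X i *\<^sub>R v)"
          using False norm_triangle_ineq2[of x "- (X i *\<^sub>R v)"] by simp
        moreover have "R \<le> norm x" using False B0 mult_nonneg_nonneg[OF B0 norm_ge_zero[of v]] by linarith
        ultimately have "q i x = 0" using R by (simp add: q_def)
        then show ?thesis by (simp add: W_def L)
      qed
    qed
  qed (use borel_measurable_integrable[OF flux_integrable[OF \<phi>]] in simp)
  have "integral\<^sup>L lborel (q i) = ((LINT x|lborel. indicator \<Omega> x * \<phi> (x + (0 + X i) *\<^sub>R v))
       - (LINT x|lborel. indicator \<Omega> x * \<phi> (x + 0 *\<^sub>R v))) / X i" for i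
  proof -
    have "integral\<^sup>L lborel (q i) = (LINT x|lborel. (indicator \<Omega> x * \<phi> (x + X i *\<^sub>R v) - indicator \<Omega> x * \<phi> x) / X i)"
      unfolding q_def by (intro Bochner_Integration.integral_cong) (auto simp: algebra_simps diff_divide_distrib)
    then show ?thesis
      using \<Omega>_integrable[OF C1c_shift[OF \<phi>]] \<Omega>_integrable[OF \<phi>] by simp
  qed
  with lim show "((\<lambda>h. ((LINT x|lborel. indicator \<Omega> x * \<phi> (x + (0 + h) *\<^sub>R v))
       - (LINT x|lborel. indicator \<Omega> x * \<phi> (x + 0 *\<^sub>R v))) / h) \<circ> X) \<longlonglongrightarrow> flux \<phi> v"
    by (simp add: o_def)
qed

section \<open>Difference quotients of the indicator, represented by a bounded kernel\<close>

lemma integral_shift: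
  fixes f :: "'a \<Rightarrow> real"
  assumes "f \<in> borel_measurable borel"
  shows "(LINT x|lborel. f (x + c)) = (LINT x|lborel. f x)"
proof -
  have "(LINT x|lborel. f x) = (LINT x|distr lborel borel ((+) c). f x)"
    by (simp add: lborel_distr_plus)
  also have "\<dots> = (LINT x|lborel. f (c + x))"
    using assms by (intro integral_distr) auto
  finally show ?thesis by (simp add: add.commute)
qed

text \<open>The adjoint difference quotient: translation invariance moves the shift from the test
  function to the indicator, whence the opposite sign.\<close>

definition dquot :: "'a \<Rightarrow> real \<Rightarrow> 'a \<Rightarrow> real" where
  "dquot v t x = (indicator \<Omega> (x - t *\<^sub>R v) - indicator \<Omega> x) / t"

lemma dquot_measurable [measurable]: "dquot v t \<in> borel_measurable borel"
proof -
  have "(\<lambda>x. indicat_real \<Omega> (x - t *\<^sub>R v)) \<in> borel_measurable borel" by measurable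
  then show ?thesis unfolding dquot_def by measurable
qed

lemma dquot_integral:
  assumes \<phi>: "C1c \<phi>" and t: "t \<noteq> 0"
  shows "((LINT x|lborel. indicator \<Omega> x * \<phi> (x + t *\<^sub>R v)) - (LINT x|lborel. indicator \<Omega> x * \<phi> x)) / t
    = (LINT x|lborel. \<phi> x * dquot v t x)"
proof -
  note C1c_measurable[OF \<phi>, measurable]
  have eq: "(LINT x|lborel. indicator \<Omega> x * \<phi> (x + t *\<^sub>R v)) = (LINT x|lborel. indicator \<Omega> (x - t *\<^sub>R v) * \<phi> x)"
    using integral_shift[of "\<lambda>x. indicator \<Omega> (x - t *\<^sub>R v) * \<phi> x" "t *\<^sub>R v"] by simp
  have i: "integrable lborel (\<lambda>x. indicator \<Omega> (x - t *\<^sub>R v) * \<phi> x)"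
    using lb.integrable_mult_bounded(1)[OF lb.C1c_integrable[OF \<phi>], of "\<lambda>x. indicator \<Omega> (x - t *\<^sub>R v)" 1]
    by (simp add: mult.commute indicator_def[of \<Omega>, abs_def] del: of_bool_eq)
  have "(LINT x|lborel. \<phi> x * dquot v t x)
     = (LINT x|lborel. (indicator \<Omega> (x - t *\<^sub>R v) * \<phi> x - indicator \<Omega> x * \<phi> x) / t)"
    unfolding dquot_def by (intro Bochner_Integration.integral_cong) (auto simp: algebra_simps diff_divide_distrib)
  then show ?thesis unfolding eq using i \<Omega>_integrable[OF \<phi>] by simp
qed

text \<open>The segment from \<open>x - t *\<^sub>R v\<close> to \<open>x\<close> leads from
  \<Omega> to its complement or back, so it meets \<open>F\<close> within distance \<open>t\<close>;
  the factor 2 absorbs the strict inequality in \<open>nbhd\<close>.\<close>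

lemma dquot_nbhd:
  assumes "norm v = 1" "t > 0" "dquot v t x \<noteq> 0"
  shows "x \<in> nbhd (2 * t)"
proof -
  let ?S = "closed_segment (x - t *\<^sub>R v) x"
  have "x - t *\<^sub>R v \<in> \<Omega> \<longleftrightarrow> x \<notin> \<Omega>"
    using assms(3) by (auto simp: dquot_def indicator_def split: if_splits)
  then have "?S \<inter> \<Omega> \<noteq> {}" "?S - \<Omega> \<noteq> {}"
    using ends_in_segment[of "x - t *\<^sub>R v" x] by blast+
  then obtain y where y: "y \<in> ?S" "y \<in> F"
    using connected_Int_frontier[OF connected_segment(1)] F_eq by blast
  have "dist x y \<le> dist (x - t *\<^sub>R v) x"
    using segment_bound1[OF y(1)] segment_bound(2)[OF y(1)] by (simp add: dist_norm norm_minus_commute)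
  also have "\<dots> = t" using assms by (simp add: dist_norm)
  finally show ?thesis using y(2) assms(2) unfolding nbhd_def by force
qed

lemma measure_ball_measurable [measurable]: "(\<lambda>x. measure M (ball x r)) \<in> borel_measurable borel"
proof -
  define Z where "Z = {p::'a\<times>'a. dist (fst p) (snd p) < r}"
  have "open Z" unfolding Z_def by (intro open_Collect_less continuous_intros)
  then have "Z \<in> sets (borel \<Otimes>\<^sub>M M)"
    unfolding sets_pair_measure_cong[OF refl sets_borel] borel_prod by (rule borel_open)
  then have "(\<lambda>x. emeasure M (Pair x -` Z)) \<in> borel_measurable borel"
    by (rule measurable_emeasure_Pair)
  moreover have "Pair x -` Z = ball x r" for x by (auto simp: Z_def)
  ultimately show ?thesis unfolding measure_def by simp
qed

text \<open>Integrating \<open>diff_kernel v t x\<close> in its last argument with respect to \<open>M\<close> returns \<open>dquot v t x\<close>; by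
  Fubini the difference quotient thus acts on test functions, up to their oscillation at scale \<open>4 t\<close>,
  like the bounded function \<open>kernel_weight\<close> times \<open>M\<close>.\<close>

definition diff_kernel :: "'a \<Rightarrow> real \<Rightarrow> 'a \<Rightarrow> 'a \<Rightarrow> real" where
  "diff_kernel v t x y = dquot v t x * indicator (ball x (4 * t)) y / measure M (ball x (4 * t))"

text \<open>The difference quotient is at most \<open>1 / t\<close>, the ball of radius
  \<open>4 * t\<close> has mass at least \<open>(2 * t) ^ (n - 1) / A\<close>, and \<open>x\<close>
  ranges over a ball of radius \<open>4 * t\<close>; here \<open>n = DIM('a)\<close>. All powers of
  \<open>t\<close> cancel, so the bound is uniform in \<open>t\<close>.\<close>

definition kernel_bound :: real where
  "kernel_bound = A * measure lborel (ball (0::'a) 1) * 2 ^ (DIM('a) - 1) * 4"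

lemma kernel_bound_nonneg: "0 \<le> kernel_bound"
  using A by (simp add: kernel_bound_def)

lemma diff_kernel_measurable: "(\<lambda>(x, y). diff_kernel v t x y) \<in> borel_measurable (lborel \<Otimes>\<^sub>M M)"
proof -
  define Z where "Z = {p::'a\<times>'a. dist (fst p) (snd p) < 4 * t}"
  have "open Z" unfolding Z_def by (intro open_Collect_less continuous_intros)
  then have [measurable]: "Z \<in> sets (lborel \<Otimes>\<^sub>M M)"
    unfolding sets_pair_measure_cong[OF sets_lborel sets_borel] borel_prod by (rule borel_open)
  have "(\<lambda>(x, y). diff_kernel v t x y)
    = (\<lambda>p. dquot v t (fst p) * indicator Z p / measure M (ball (fst p) (4 * t)))"
    by (auto simp: diff_kernel_def Z_def indicator_def fun_eq_iff)
  also have "\<dots> \<in> borel_measurable (lborel \<Otimes>\<^sub>M M)" by measurable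
  finally show ?thesis .
qed

lemma diff_kernel_bound:
  assumes "norm v = 1" "t > 0" "4 * t < R0"
  shows "\<bar>diff_kernel v t x y\<bar> \<le> A / (t * (2 * t) ^ (DIM('a) - 1)) * indicator (ball y (4 * t)) x"
proof (cases "dquot v t x = 0 \<or> y \<notin> ball x (4 * t)")
  case True
  then show ?thesis using assms A by (auto simp: diff_kernel_def)
next
  case False
  then have "x \<in> nbhd (2 * t)" using dquot_nbhd assms by blast
  then have "(2 * t) ^ (DIM('a) - 1) \<le> A * measure M (ball x (4 * t))"
    using nbhd_lower[of x "2 * t"] assms by simp
  moreover have p: "0 < (2 * t) ^ (DIM('a) - 1)" using assms by simp
  ultimately have le: "(2 * t) ^ (DIM('a) - 1) \<le> A * measure M (ball x (4 * t))"
    and "0 < A * measure M (ball x (4 * t))" by linarith+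
  then have m0: "0 < measure M (ball x (4 * t))" using A by (simp add: zero_less_mult_iff)
  then have m: "0 < measure M (ball x (4 * t))"
    "1 / measure M (ball x (4 * t)) \<le> A / (2 * t) ^ (DIM('a) - 1)"
    using le p by (simp_all add: divide_simps mult.commute)
  have "\<bar>dquot v t x\<bar> \<le> 1 / t" using assms by (auto simp: dquot_def indicator_def)
  then have "\<bar>dquot v t x\<bar> * (1 / measure M (ball x (4 * t))) \<le> 1 / t * (A / (2 * t) ^ (DIM('a) - 1))"
    using m assms by (intro mult_mono) auto
  then show ?thesis using False m(1)
    by (simp add: diff_kernel_def abs_mult dist_commute)
qed

lemma lborel_ball: "0 \<le> r \<Longrightarrow> measure lborel (ball (y::'a) r) = r ^ DIM('a) * measure lborel (ball (0::'a) 1)"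
  using content_ball_conv_unit_ball[of r y] by simp

lemma diff_kernel_integrable:
  assumes "norm v = 1" "t > 0" "4 * t < R0"
  shows "integrable lborel (\<lambda>x. diff_kernel v t x y)"
    and "(LINT x|lborel. \<bar>diff_kernel v t x y\<bar>) \<le> kernel_bound"
proof -
  let ?c = "A / (t * (2 * t) ^ (DIM('a) - 1))"
  have [measurable]: "(\<lambda>x. diff_kernel v t x y) \<in> borel_measurable lborel"
    using measurable_compose[OF measurable_Pair2'[of y M] diff_kernel_measurable[of v t]] by simp
  have i: "integrable lborel (\<lambda>x. ?c * indicator (ball y (4 * t)) x)"
    using emeasure_bounded_finite[of "ball y (4 * t)"] by (intro integrable_mult_right integrable_real_indicator) auto
  show int: "integrable lborel (\<lambda>x. diff_kernel v t x y)"
    using i by (rule Bochner_Integration.integrable_bound)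
      (use diff_kernel_bound[OF assms] A assms in \<open>auto simp: abs_mult\<close>)
  have "(LINT x|lborel. \<bar>diff_kernel v t x y\<bar>) \<le> (LINT x|lborel. ?c * indicator (ball y (4 * t)) x)"
    using int i diff_kernel_bound[OF assms] by (intro integral_mono) auto
  also have "\<dots> = ?c * ((4 * t) ^ DIM('a) * measure lborel (ball (0::'a) 1))"
    using assms lborel_ball[of "4 * t" y] by simp
  also have "\<dots> = kernel_bound"
  proof -
    obtain d where d: "DIM('a) = Suc d" using DIM_positive[where 'a='a] gr0_implies_Suc by blast
    have "(4 * t) ^ DIM('a) = t * (2 * t) ^ d * (2 ^ d * 4)"
      using power_mult_distrib[of 2 "2 * t" d] by (simp add: d mult.commute)
    moreover have "t * (2 * t) ^ d \<noteq> 0" using assms by simp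
    ultimately show ?thesis by (simp add: kernel_bound_def d)
  qed
  finally show "(LINT x|lborel. \<bar>diff_kernel v t x y\<bar>) \<le> kernel_bound" .
qed

definition kernel_weight :: "'a \<Rightarrow> real \<Rightarrow> 'a \<Rightarrow> real" where
  "kernel_weight v t y = (LINT x|lborel. diff_kernel v t x y)"

lemma kernel_weight_measurable: "kernel_weight v t \<in> borel_measurable borel"
proof -
  have "(\<lambda>(y, x). diff_kernel v t x y) \<in> borel_measurable (M \<Otimes>\<^sub>M lborel)"
    using measurable_compose[OF measurable_pair_swap' diff_kernel_measurable[of v t]]
    by (simp add: split_beta')
  from lborel.borel_measurable_lebesgue_integral[OF this] show ?thesis
    by (simp add: kernel_weight_def[abs_def])
qed

lemma kernel_weight_bound:
  assumes "norm v = 1" "t > 0" "4 * t < R0"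
  shows "\<bar>kernel_weight v t y\<bar> \<le> kernel_bound"
  using order_trans[OF integral_norm_bound[of lborel "\<lambda>x. diff_kernel v t x y"], of kernel_bound]
    diff_kernel_integrable(2)[OF assms, of y] by (simp add: kernel_weight_def)

text \<open>After exchanging the integrals the only error is \<open>\<phi> x - \<phi> y\<close>
  where the kernel lives, that is for \<open>x\<close> and \<open>y\<close> at distance below
  \<open>4 * t\<close>; this gives the factor \<open>4 * t * L\<close>.\<close>

lemma kernel_weight_approx:
  assumes v: "norm v = 1" and t: "t > 0" "4 * t < R0" and \<phi>: "C1c \<phi>"
    and L: "L \<ge> 0" "\<And>x y. \<bar>\<phi> x - \<phi> y\<bar> \<le> L * norm (x - y)"
    and R: "\<And>x. R \<le> norm x \<Longrightarrow> \<phi> x = 0"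
  shows "\<bar>(LINT x|lborel. \<phi> x * dquot v t x) - (LINT y|M. \<phi> y * kernel_weight v t y)\<bar>
     \<le> 4 * t * L * kernel_bound * measure M (ball 0 (R + 4 * t))"
proof -
  note C1c_measurable[OF \<phi>, measurable]
  note kb = diff_kernel_bound[OF v t] and ki = diff_kernel_integrable[OF v t]
  interpret p: pair_sigma_finite "lborel :: 'a measure" M ..
  define c where "c = A / (t * (2 * t) ^ (DIM('a) - 1))"
  have c_nonneg: "0 \<le> c" using t A by (simp add: c_def)
  obtain B where B: "B \<ge> 0" "\<And>x. \<bar>\<phi> x\<bar> \<le> B" using C1c_bounded[OF \<phi>] by metis
  have zero: "\<phi> x * diff_kernel v t x y = 0" if "x \<notin> ball 0 R \<or> y \<notin> ball 0 (R + 4 * t)" for x y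
  proof (cases "norm x < R")
    case True
    then have "R + 4 * t \<le> norm y" using that by auto
    then have "y \<notin> ball x (4 * t)" using True norm_triangle_ineq2[of y x] by (auto simp: dist_norm norm_minus_commute)
    then show ?thesis by (simp add: diff_kernel_def)
  qed (use R in auto)
  have i: "integrable (lborel \<Otimes>\<^sub>M M) (\<lambda>(x, y). \<phi> x * diff_kernel v t x y)"
  proof (rule Bochner_Integration.integrable_bound)
    have "emeasure (lborel \<Otimes>\<^sub>M M) (ball (0::'a) R \<times> ball 0 (R + 4 * t))
      = emeasure lborel (ball (0::'a) R) * emeasure M (ball 0 (R + 4 * t))"
      by (intro sigma_finite_measure.emeasure_pair_measure_Times sigma_finite_measure_axioms) auto
    also have "\<dots> < \<infinity>"
      using emeasure_bounded_finite[of "ball (0::'a) R"] finite_bounded[of "ball 0 (R + 4 * t)"]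
      by (auto simp: ennreal_mult_less_top)
    finally show "integrable (lborel \<Otimes>\<^sub>M M) (\<lambda>z. B * c * indicator (ball (0::'a) R \<times> ball 0 (R + 4 * t)) z)"
      by (intro integrable_mult_right integrable_real_indicator) auto
    show "(\<lambda>(x, y). \<phi> x * diff_kernel v t x y) \<in> borel_measurable (lborel \<Otimes>\<^sub>M M)"
    proof -
      have "(\<lambda>p. \<phi> (fst p) * (\<lambda>(x, y). diff_kernel v t x y) p) \<in> borel_measurable (lborel \<Otimes>\<^sub>M M)"
        by (intro borel_measurable_times diff_kernel_measurable) measurable
      then show ?thesis by (simp add: split_beta')
    qed
    have "\<bar>\<phi> x * diff_kernel v t x y\<bar> \<le> B * c * indicator (ball (0::'a) R \<times> ball 0 (R + 4 * t)) (x, y)" for x y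
    proof (cases "x \<notin> ball 0 R \<or> y \<notin> ball 0 (R + 4 * t)")
      case True
      then show ?thesis using zero[OF True] B(1) c_nonneg by auto
    next
      case False
      have "\<bar>diff_kernel v t x y\<bar> \<le> c"
        using kb[of x y] c_nonneg unfolding c_def[symmetric] by (cases "x \<in> ball y (4 * t)") simp_all
      then have "\<bar>\<phi> x\<bar> * \<bar>diff_kernel v t x y\<bar> \<le> B * c" using B by (intro mult_mono) auto
      then show ?thesis using False by (simp add: abs_mult)
    qed
    then show "AE z in lborel \<Otimes>\<^sub>M M. norm (case z of (x, y) \<Rightarrow> \<phi> x * diff_kernel v t x y)
       \<le> norm (B * c * indicator (ball (0::'a) R \<times> ball 0 (R + 4 * t)) z)"
      using B(1) c_nonneg by (intro AE_I2) (auto simp: abs_mult)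
  qed
  \<comment> \<open>Where \<open>dquot\<close> does not vanish, \<open>x\<close> is close to
    \<open>F\<close> and its ball has positive mass, so the normalisation in
    \<open>diff_kernel\<close> is not a division by 0.\<close>
  have "(LINT x|lborel. \<phi> x * dquot v t x) = (LINT x|lborel. LINT y|M. \<phi> x * diff_kernel v t x y)"
  proof (rule Bochner_Integration.integral_cong[OF refl])
    fix x
    show "\<phi> x * dquot v t x = (LINT y|M. \<phi> x * diff_kernel v t x y)"
    proof (cases "dquot v t x = 0")
      case True
      then show ?thesis by (simp add: diff_kernel_def)
    next
      case False
      then have "x \<in> nbhd (2 * t)" using dquot_nbhd v t by blast
      then have "(2 * t) ^ (DIM('a) - 1) \<le> A * measure M (ball x (4 * t))"
        using nbhd_lower[of x "2 * t"] t by simp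
      moreover have "0 < (2 * t) ^ (DIM('a) - 1)" using t by simp
      ultimately have "measure M (ball x (4 * t)) \<noteq> 0" by auto
      then show ?thesis by (simp add: diff_kernel_def)
    qed
  qed
  also have "\<dots> = (LINT y|M. LINT x|lborel. \<phi> x * diff_kernel v t x y)"
    using p.Fubini_integral[OF i] by simp
  finally have eq: "(LINT x|lborel. \<phi> x * dquot v t x) = (LINT y|M. LINT x|lborel. \<phi> x * diff_kernel v t x y)" .
  have iy: "integrable M (\<lambda>y. LINT x|lborel. \<phi> x * diff_kernel v t x y)"
    using p.integrable_snd[OF i] .
  have iw: "integrable M (\<lambda>y. \<phi> y * kernel_weight v t y)"
    by (intro integrable_mult_bounded[OF C1c_integrable[OF \<phi>] kernel_weight_measurable kernel_weight_bound[OF v t]])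
  have "(LINT x|lborel. \<phi> x * dquot v t x) - (LINT y|M. \<phi> y * kernel_weight v t y)
     = (LINT y|M. (LINT x|lborel. \<phi> x * diff_kernel v t x y) - \<phi> y * kernel_weight v t y)"
    unfolding eq using iy iw by simp
  also have "\<bar>\<dots>\<bar> \<le> (LINT y|M. \<bar>(LINT x|lborel. \<phi> x * diff_kernel v t x y) - \<phi> y * kernel_weight v t y\<bar>)"
    using integral_norm_bound[of M "\<lambda>y. (LINT x|lborel. \<phi> x * diff_kernel v t x y) - \<phi> y * kernel_weight v t y"] by simp
  also have "\<dots> \<le> (LINT y|M. 4 * t * L * kernel_bound * indicator (ball 0 (R + 4 * t)) y)"
  proof (rule integral_mono)
    show "integrable M (\<lambda>y. \<bar>(LINT x|lborel. \<phi> x * diff_kernel v t x y) - \<phi> y * kernel_weight v t y\<bar>)"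
      using iy iw by auto
    show "integrable M (\<lambda>y. 4 * t * L * kernel_bound * indicator (ball 0 (R + 4 * t)) y)"
      using finite_bounded[of "ball 0 (R + 4 * t)"] by (intro integrable_mult_right integrable_real_indicator) auto
    fix y
    show "\<bar>(LINT x|lborel. \<phi> x * diff_kernel v t x y) - \<phi> y * kernel_weight v t y\<bar>
        \<le> 4 * t * L * kernel_bound * indicator (ball 0 (R + 4 * t)) y"
    proof (cases "y \<in> ball 0 (R + 4 * t)")
      case True
      have i1: "integrable lborel (\<lambda>x. \<phi> x * diff_kernel v t x y)"
        using lb.integrable_mult_bounded(1)[OF ki(1)[of y], of \<phi> B] B by (simp add: mult.commute)
      have "(LINT x|lborel. \<phi> x * diff_kernel v t x y) - \<phi> y * kernel_weight v t y
        = (LINT x|lborel. (\<phi> x - \<phi> y) * diff_kernel v t x y)"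
        unfolding kernel_weight_def using i1 ki(1)[of y] by (simp add: left_diff_distrib)
      also have "\<bar>\<dots>\<bar> \<le> (LINT x|lborel. \<bar>(\<phi> x - \<phi> y) * diff_kernel v t x y\<bar>)"
        using integral_norm_bound[of lborel "\<lambda>x. (\<phi> x - \<phi> y) * diff_kernel v t x y"] by simp
      also have "\<dots> \<le> (LINT x|lborel. 4 * t * L * \<bar>diff_kernel v t x y\<bar>)"
      proof (rule integral_mono)
        show "integrable lborel (\<lambda>x. \<bar>(\<phi> x - \<phi> y) * diff_kernel v t x y\<bar>)"
          using i1 ki(1)[of y] by (auto simp: left_diff_distrib)
        show "integrable lborel (\<lambda>x. 4 * t * L * \<bar>diff_kernel v t x y\<bar>)" using ki(1)[of y] by auto
        fix x
        show "\<bar>(\<phi> x - \<phi> y) * diff_kernel v t x y\<bar> \<le> 4 * t * L * \<bar>diff_kernel v t x y\<bar>"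
        proof (cases "y \<in> ball x (4 * t)")
          case True
          have "\<bar>\<phi> x - \<phi> y\<bar> \<le> L * norm (x - y)" by (rule L)
          also have "\<dots> \<le> L * (4 * t)" using True L(1) by (intro mult_left_mono) (auto simp: dist_norm)
          finally have "\<bar>\<phi> x - \<phi> y\<bar> \<le> 4 * t * L" by (simp add: mult.commute mult.left_commute)
          from mult_right_mono[OF this, of "\<bar>diff_kernel v t x y\<bar>"] show ?thesis by (simp add: abs_mult)
        qed (simp add: diff_kernel_def)
      qed
      also have "\<dots> \<le> 4 * t * L * kernel_bound"
        using ki(2)[of y] t L(1) by (simp add: mult_left_mono)
      finally show ?thesis using True by simp
    next
      case False
      then have "(\<lambda>x. \<phi> x * diff_kernel v t x y) = (\<lambda>x. 0)" using zero by blast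
      then have "(LINT x|lborel. \<phi> x * diff_kernel v t x y) = 0" by simp
      moreover have "\<phi> y = 0" using False t by (intro R) auto
      ultimately show ?thesis using False by simp
    qed
  qed
  also have "\<dots> = 4 * t * L * kernel_bound * measure M (ball 0 (R + 4 * t))" by simp
  finally show ?thesis .
qed

text \<open>For \<open>t\<close> tending to 0 the bounded functions \<open>kernel_weight v t\<close>
  act on test functions as the difference quotients do, up to an error of order \<open>t\<close>.
  Hence they converge weakly to \<open>flux\<close>, and the weak limit is the density.\<close>

lemma flux_density_unit:
  assumes v: "norm v = 1"
  obtains g where "g \<in> borel_measurable borel" "\<And>x. \<bar>g x\<bar> \<le> kernel_bound"
    "\<And>\<phi>. C1c \<phi> \<Longrightarrow> flux \<phi> v = (LINT x|M. \<phi> x * g x)"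
proof -
  \<comment> \<open>From \<open>t k \<le> c\<close> follow both \<open>4 * t k < R0\<close>,
    required by the kernel bounds, and \<open>t k \<le> 1\<close>, which confines all balls of
    radius \<open>R + 4 * t k\<close> to a single one.\<close>
  obtain c where c: "0 < c" "c \<le> 1" "8 * c \<le> R0"
  proof
    show "0 < min 1 (R0 / 8)" "min 1 (R0 / 8) \<le> 1" "8 * min 1 (R0 / 8) \<le> R0" using R0 by auto
  qed
  define t where "t k = c * inverse (Suc k)" for k
  have tp: "t k > 0" for k using c by (simp add: t_def)
  have tc: "t k \<le> c" for k
    using c mult_left_le[of "inverse (Suc k)" c] by (simp add: t_def inverse_le_1_iff)
  then have t1: "t k \<le> 1" for k using c(2) order_trans by blast
  have t4: "4 * t k < R0" for k using R0 tc[of k] c by linarith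
  have t0: "t \<longlonglongrightarrow> 0"
    using tendsto_mult[OF tendsto_const[of c] LIMSEQ_inverse_real_of_nat] by (simp add: t_def[abs_def])
  have conv: "(\<lambda>k. LINT y|M. \<phi> y * kernel_weight v (t k) y) \<longlonglongrightarrow> flux \<phi> v" if \<phi>: "C1c \<phi>" for \<phi>
  proof -
    obtain L where L: "L \<ge> 0" "\<And>x y. \<bar>\<phi> x - \<phi> y\<bar> \<le> L * norm (x - y)"
      using C1c_lipschitz[OF \<phi>] by metis
    obtain R where R: "R > 0" "\<And>x. R \<le> norm x \<Longrightarrow> \<phi> x = 0"
      using C1c_frechet_zero[OF \<phi>] by metis
    have "(\<lambda>k. (LINT x|lborel. \<phi> x * dquot v (t k) x)) \<longlonglongrightarrow> flux \<phi> v"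
    proof -
      have "((\<lambda>h. ((LINT x|lborel. indicator \<Omega> x * \<phi> (x + (0 + h) *\<^sub>R v))
        - (LINT x|lborel. indicator \<Omega> x * \<phi> (x + 0 *\<^sub>R v))) / h) \<circ> t) \<longlonglongrightarrow> flux \<phi> v"
        by (rule DERIV_flux[OF \<phi>, of v, unfolded DERIV_def tendsto_at_iff_sequentially, rule_format, OF _ t0])
          (use less_imp_neq[OF tp, symmetric] in simp)
      moreover have "((LINT x|lborel. indicator \<Omega> x * \<phi> (x + (0 + t k) *\<^sub>R v))
        - (LINT x|lborel. indicator \<Omega> x * \<phi> (x + 0 *\<^sub>R v))) / t k
          = (LINT x|lborel. \<phi> x * dquot v (t k) x)" for k
        using dquot_integral[OF \<phi>, of "t k" v] tp[of k] by simp
      ultimately show ?thesis by (simp add: o_def)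
    qed
    moreover have "(\<lambda>k. (LINT x|lborel. \<phi> x * dquot v (t k) x) - (LINT y|M. \<phi> y * kernel_weight v (t k) y)) \<longlonglongrightarrow> 0"
    proof (rule Lim_null_comparison)
      have "norm ((LINT x|lborel. \<phi> x * dquot v (t k) x) - (LINT y|M. \<phi> y * kernel_weight v (t k) y))
          \<le> t k * (4 * L * kernel_bound * measure M (ball 0 (R + 4)))" for k
      proof -
        have "\<bar>(LINT x|lborel. \<phi> x * dquot v (t k) x) - (LINT y|M. \<phi> y * kernel_weight v (t k) y)\<bar>
          \<le> 4 * t k * L * kernel_bound * measure M (ball 0 (R + 4 * t k))"
          by (rule kernel_weight_approx[OF v tp t4 \<phi> L R(2)])
        also have "\<dots> \<le> 4 * t k * L * kernel_bound * measure M (ball 0 (R + 4))"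
          using tp[of k] t1[of k] L(1) kernel_bound_nonneg
          by (intro mult_left_mono measure_mono_bounded) auto
        finally show ?thesis by (simp add: mult_ac)
      qed
      then show "\<forall>\<^sub>F k in sequentially. norm ((LINT x|lborel. \<phi> x * dquot v (t k) x) - (LINT y|M. \<phi> y * kernel_weight v (t k) y))
          \<le> t k * (4 * L * kernel_bound * measure M (ball 0 (R + 4)))" by simp
      show "(\<lambda>k. t k * (4 * L * kernel_bound * measure M (ball 0 (R + 4)))) \<longlonglongrightarrow> 0"
        using tendsto_mult[OF t0 tendsto_const] by simp
    qed
    ultimately show ?thesis using tendsto_diff by fastforce
  qed
  obtain g where g: "g \<in> borel_measurable borel" "\<And>x. \<bar>g x\<bar> \<le> kernel_bound"
    "\<And>f. integrable M f \<Longrightarrow> (\<lambda>k. LINT x|M. f x * kernel_weight v (t k) x) \<longlonglongrightarrow> (LINT x|M. f x * g x)"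
    using weak_star_limit[of "\<lambda>k. kernel_weight v (t k)" kernel_bound, OF kernel_weight_measurable kernel_weight_bound[OF v tp t4]]
      convergentI[OF conv] by blast
  have "flux \<phi> v = (LINT x|M. \<phi> x * g x)" if "C1c \<phi>" for \<phi>
    using LIMSEQ_unique[OF conv[OF that] g(3)[OF C1c_integrable[OF that]]] .
  then show thesis using that g by blast
qed

lemma flux_density:
  obtains g where "g \<in> borel_measurable borel" "\<And>x. norm (g x) \<le> DIM('a) * kernel_bound"
    "\<And>\<phi> v. C1c \<phi> \<Longrightarrow> flux \<phi> v = (LINT x|M. \<phi> x * (g x \<bullet> v))"
proof -
  have "\<exists>g. g \<in> borel_measurable borel \<and> (\<forall>x. \<bar>g x\<bar> \<le> kernel_bound) \<and>
    (\<forall>\<phi>. C1c \<phi> \<longrightarrow> flux \<phi> b = (LINT x|M. \<phi> x * g x))" if "b \<in> Basis" for b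
    using flux_density_unit[of b] that by (metis norm_Basis)
  then obtain h where h: "\<And>b. b \<in> Basis \<Longrightarrow> h b \<in> borel_measurable borel"
    "\<And>b x. b \<in> Basis \<Longrightarrow> \<bar>h b x\<bar> \<le> kernel_bound"
    "\<And>b \<phi>. b \<in> Basis \<Longrightarrow> C1c \<phi> \<Longrightarrow> flux \<phi> b = (LINT x|M. \<phi> x * h b x)"
    by metis
  define g where "g x = (\<Sum>b\<in>Basis. h b x *\<^sub>R b)" for x
  have m: "g \<in> borel_measurable borel" unfolding g_def using h(1) by measurable
  have "norm (g x) \<le> DIM('a) * kernel_bound" for x
  proof -
    have "norm (g x) \<le> (\<Sum>b\<in>(Basis::'a set). kernel_bound)"
      unfolding g_def by (intro sum_norm_le) (use h(2) in auto)
    then show ?thesis by simp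
  qed
  moreover have "flux \<phi> v = (LINT x|M. \<phi> x * (g x \<bullet> v))" if \<phi>: "C1c \<phi>" for \<phi> v
  proof -
    have "flux \<phi> v = (\<Sum>b\<in>Basis. (v \<bullet> b) * (LINT x|M. \<phi> x * h b x))"
      using flux_linear[OF \<phi>] h(3)[OF _ \<phi>] by simp
    also have "\<dots> = (LINT x|M. (\<Sum>b\<in>Basis. (v \<bullet> b) * (\<phi> x * h b x)))"
      using integrable_mult_bounded(1)[OF C1c_integrable[OF \<phi>] h(1,2)]
      by (subst Bochner_Integration.integral_sum) auto
    also have "\<dots> = (LINT x|M. \<phi> x * (g x \<bullet> v))"
      by (intro Bochner_Integration.integral_cong)
        (auto simp: g_def inner_sum_left inner_sum_right sum_distrib_left inner_commute mult_ac)
    finally show ?thesis .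
  qed
  ultimately show thesis using that m by blast
qed

end

section \<open>Uniqueness of the Gauss-Green representation\<close>

text \<open>Test functions determine the signed measures \<open>f \<mu>\<close> and
  \<open>f' \<mu>'\<close>: on bounded open sets through \<open>open_indicator_approx\<close>, on
  Borel sets inside a ball because open sets form an intersection-stable generator, and then for
  bounded \<open>h\<close> by monotone approximation of its positive and negative parts.\<close>

lemma radon_integral_eq:
  fixes f f' :: "'a::euclidean_space \<Rightarrow> real"
  assumes "radon \<mu>" "radon \<mu>'"
    and f [measurable]: "f \<in> borel_measurable borel" "\<And>x. \<bar>f x\<bar> \<le> 1"
    and f' [measurable]: "f' \<in> borel_measurable borel" "\<And>x. \<bar>f' x\<bar> \<le> 1"
    and eq: "\<And>\<psi>. C1c \<psi> \<Longrightarrow> (LINT x|\<mu>. \<psi> x * f x) = (LINT x|\<mu>'. \<psi> x * f' x)"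
    and h [measurable]: "h \<in> borel_measurable borel" and hK: "\<And>x. \<bar>h x\<bar> \<le> K"
  shows "(LINT x:ball 0 R|\<mu>. h x * f x) = (LINT x:ball 0 R|\<mu>'. h x * f' x)"
proof -
  interpret m: radon \<mu> by fact
  interpret m': radon \<mu>' by fact
  have si: "set_integrable \<mu> D (\<lambda>x. h x * f x)" "set_integrable \<mu>' D (\<lambda>x. h x * f' x)"
    if "bounded D" "D \<in> sets borel" "h \<in> borel_measurable borel" "\<And>x. \<bar>h x\<bar> \<le> K" for h D and K :: real
  proof -
    have "norm (h x * f x) \<le> K" "norm (h x * f' x) \<le> K" for x
      using mult_mono[OF that(4)[of x] f(2)[of x]] mult_mono[OF that(4)[of x] f'(2)[of x]]
        order_trans[OF abs_ge_zero that(4)[of x]] by (auto simp: abs_mult)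
    then show "set_integrable \<mu> D (\<lambda>x. h x * f x)" "set_integrable \<mu>' D (\<lambda>x. h x * f' x)"
      using that by (auto intro!: m.set_integrable_bounded[of _ K] m'.set_integrable_bounded[of _ K])
  qed
  have si1: "set_integrable \<mu> D f" "set_integrable \<mu>' D f'" if "bounded D" "D \<in> sets borel" for D
    using si[OF that, of "\<lambda>x. 1" 1] by simp_all
  have opn: "(LINT x:U|\<mu>. f x) = (LINT x:U|\<mu>'. f' x)" if U: "open U" "bounded U" for U
  proof -
    have [measurable, simp]: "U \<in> sets borel" using U by simp
    obtain \<phi> :: "nat \<Rightarrow> 'a \<Rightarrow> real" where \<phi>: "\<And>k. C1c (\<phi> k)" "\<And>k x. 0 \<le> \<phi> k x" "\<And>k x. \<phi> k x \<le> 1"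
      "\<And>k x. x \<notin> U \<Longrightarrow> \<phi> k x = 0" "\<And>x. (\<lambda>k. \<phi> k x) \<longlonglongrightarrow> indicator U x"
      using open_indicator_approx[OF U(1)] by metis
    have lim: "(\<lambda>k. LINT x|N. \<phi> k x * u x) \<longlonglongrightarrow> (LINT x:U|N. u x)"
      if "radon N" "u \<in> borel_measurable borel" "\<And>x. \<bar>u x\<bar> \<le> 1" for N and u :: "'a \<Rightarrow> real"
    proof -
      interpret N: radon N by fact
      show ?thesis unfolding set_lebesgue_integral_def
      proof (rule integral_dominated_convergence[where w="indicator U"])
        show "(\<lambda>x. indicat_real U x *\<^sub>R u x) \<in> borel_measurable N" 
          using that(2) by measurable
        show "(\<lambda>x. \<phi> k x * u x) \<in> borel_measurable N" for k
          using that(2) C1c_measurable[OF \<phi>(1)[of k]] by measurable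
        show "integrable N (indicat_real U)"
          using N.finite_bounded[OF U(2)] by (intro integrable_real_indicator) auto
        show "AE x in N. (\<lambda>k. \<phi> k x * u x) \<longlonglongrightarrow> indicat_real U x *\<^sub>R u x"
          by (auto intro!: tendsto_intros \<phi>)
        have "norm (\<phi> k x * u x) \<le> indicat_real U x" for k x
          using mult_mono[OF \<phi>(3)[of k x] that(3)[of x]] \<phi>(2)[of k x] \<phi>(4)[of x k]
          by (cases "x \<in> U") (auto simp: abs_mult)
        then show "AE x in N. norm (\<phi> k x * u x) \<le> indicat_real U x" for k by simp
      qed
    qed
    show ?thesis
      using LIMSEQ_unique[OF lim[OF assms(1) f] ] lim[OF assms(2) f'] eq[OF \<phi>(1)] by simp
  qed
  define B where "B = ball (0::'a) R"
  have B [measurable, simp]: "B \<in> sets borel" "bounded B" "open B" by (auto simp: B_def)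
  have set_eq: "(LINT x:D \<inter> B|\<mu>. f x) = (LINT x:D \<inter> B|\<mu>'. f' x)" if "D \<in> sets borel" for D
  proof -
    have "Int_stable {S::'a set. open S}" by (auto simp: Int_stable_def)
    moreover have "{S::'a set. open S} \<subseteq> Pow UNIV" by simp
    moreover have "D \<in> sigma_sets UNIV {S. open S}" using that by (simp add: borel_def)
    ultimately show ?thesis
    proof (induction rule: sigma_sets_induct_disjoint)
      case (basic D)
      then show ?case by (intro opn) auto
    next
      case (compl D)
      then have D: "D \<in> sets borel" by (simp add: borel_def)
      have s: "(LINT x:(UNIV - D) \<inter> B|N. u x) = (LINT x:B|N. u x) - (LINT x:D \<inter> B|N. u x)"
        if "radon N" "set_integrable N B u" for N and u :: "'a \<Rightarrow> real"
      proof -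
        interpret N: radon N by fact
        have "(LINT x:(D \<inter> B) \<union> ((UNIV - D) \<inter> B)|N. u x) = (LINT x:D \<inter> B|N. u x) + (LINT x:(UNIV - D) \<inter> B|N. u x)"
          using D by (intro set_integral_Un) (auto intro: set_integrable_subset[OF that(2)])
        moreover have "(D \<inter> B) \<union> ((UNIV - D) \<inter> B) = B" by auto
        ultimately show ?thesis by simp
      qed
      show ?case
        using s[OF assms(1) si1(1)[of B]] s[OF assms(2) si1(2)[of B]] compl.IH opn[of B] by simp
    next
      case (union D)
      then have D: "D i \<in> sets borel" for i by (auto simp: borel_def)
      have dis: "D i \<inter> B \<inter> (D j \<inter> B) = {}" if "i \<noteq> j" for i j
        using union(1) that by (auto simp: disjoint_family_on_def)
      have UN: "\<Union>(range D) \<inter> B = (\<Union>i. D i \<inter> B)" by auto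
      have "bounded (\<Union>i. D i \<inter> B)" "(\<Union>i. D i \<inter> B) \<in> sets borel"
        using D by (auto intro: bounded_subset[OF B(2)])
      note * = si1[OF this]
      show ?case unfolding UN
        using lebesgue_integral_countable_add[OF _ dis *(1)] lebesgue_integral_countable_add[OF _ dis *(2)] D union.IH
        by simp
    qed (simp add: set_lebesgue_integral_def)
  qed
  have pos: "(LINT x:B|\<mu>. h x * f x) = (LINT x:B|\<mu>'. h x * f' x)"
    if "h \<in> borel_measurable borel" "\<And>x. 0 \<le> h x" "\<And>x. h x \<le> K" for h :: "'a \<Rightarrow> real" and K
    using that
  proof (induction h arbitrary: K rule: borel_measurable_induct_real)
    case (set D)
    have "(LINT x:B|N. indicator D x * u x) = (LINT x:D \<inter> B|N. u x)" for N and u :: "'a \<Rightarrow> real"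
      unfolding set_lebesgue_integral_def by (intro Bochner_Integration.integral_cong) (auto simp: indicator_def)
    then show ?case using set_eq[of D] set(1) by simp
  next
    case (mult u c)
    show ?case
    proof (cases "c = 0")
      case False
      then have "u x \<le> K / c" for x using mult.prems[of x] mult.hyps(1) by (simp add: field_simps)
      from mult.IH[OF this] show ?thesis by (simp add: mult.assoc)
    qed simp
  next
    case (add u v)
    have "u x \<le> K" "v x \<le> K" for x
      using add.prems[of x] add.hyps(2)[of x] add.hyps(4)[of x] by linarith+
    note le = this
    have ab: "\<bar>u x\<bar> \<le> K" "\<bar>v x\<bar> \<le> K" for x
      using le[of x] add.hyps(2)[of x] add.hyps(4)[of x] by auto
    have "set_integrable \<mu> B (\<lambda>x. u x * f x)" "set_integrable \<mu>' B (\<lambda>x. u x * f' x)"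
      "set_integrable \<mu> B (\<lambda>x. v x * f x)" "set_integrable \<mu>' B (\<lambda>x. v x * f' x)"
      by (intro si[OF B(2,1) _ ab(1)] si[OF B(2,1) _ ab(2)] add.hyps)+
    then show ?case using add.IH(1)[OF le(1)] add.IH(2)[OF le(2)] by (simp add: distrib_right)
  next
    case (seq U)
    have U_le: "U i x \<le> h x" for i x
      using seq.hyps by (intro incseq_le) (auto simp: incseq_def le_fun_def)
    then have UK: "U i x \<le> K" for i x using seq.prems[of x] order_trans by blast
    have hm: "h \<in> borel_measurable borel"
      by (rule borel_measurable_LIMSEQ_real[OF seq.hyps(4,1)])
    have lim: "(\<lambda>i. LINT x:B|N. U i x * u x) \<longlonglongrightarrow> (LINT x:B|N. h x * u x)"
      if "radon N" "u \<in> borel_measurable borel" "\<And>x. \<bar>u x\<bar> \<le> 1" for N and u :: "'a \<Rightarrow> real"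
    proof -
      interpret N: radon N by fact
      note [measurable] = that(2) hm seq.hyps(1)
      show ?thesis unfolding set_lebesgue_integral_def
      proof (rule integral_dominated_convergence[where w="\<lambda>x. K * indicator B x"])
        show "integrable N (\<lambda>x. K * indicat_real B x)"
          using N.finite_bounded[OF B(2,1)] by (intro integrable_mult_right integrable_real_indicator) auto
        show "AE x in N. (\<lambda>i. indicat_real B x *\<^sub>R (U i x * u x)) \<longlonglongrightarrow> indicat_real B x *\<^sub>R (h x * u x)"
          using seq.hyps by (auto intro!: tendsto_intros)
        have "norm (indicat_real B x *\<^sub>R (U i x * u x)) \<le> K * indicat_real B x" for i x
          using mult_mono[OF UK[of i x] that(3)[of x]] seq.hyps(2)[of i x] order_trans[OF seq.hyps(2)[of i x] UK]
          by (auto simp: indicator_def abs_mult)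
        then show "AE x in N. norm (indicat_real B x *\<^sub>R (U i x * u x)) \<le> K * indicat_real B x" for i by simp
      qed auto
    qed
    show ?case
      using LIMSEQ_unique[OF lim[OF assms(1) f]] lim[OF assms(2) f'] seq.IH[OF UK] by simp
  qed
  have "0 \<le> K" using order_trans[OF abs_ge_zero hK] .
  define hp hn where "hp x = max 0 (h x)" and "hn x = max 0 (- h x)" for x
  have [measurable]: "hp \<in> borel_measurable borel" "hn \<in> borel_measurable borel"
    unfolding hp_def hn_def by measurable
  have b: "0 \<le> hp x" "hp x \<le> K" "0 \<le> hn x" "hn x \<le> K" for x
    using hK[of x] \<open>0 \<le> K\<close> by (auto simp: hp_def hn_def)
  have h_eq: "h x = hp x - hn x" for x by (auto simp: hp_def hn_def)
  have i: "set_integrable \<mu> B (\<lambda>x. hp x * f x)" "set_integrable \<mu>' B (\<lambda>x. hp x * f' x)"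
    "set_integrable \<mu> B (\<lambda>x. hn x * f x)" "set_integrable \<mu>' B (\<lambda>x. hn x * f' x)"
    using b by (auto intro!: si[where K=K])
  show ?thesis
    unfolding h_eq left_diff_distrib B_def[symmetric]
    using i pos[of hp K] pos[of hn K] b by simp
qed

lemma gauss_green_radon: "gauss_green E \<mu> \<sigma> \<Longrightarrow> radon \<mu>"
  unfolding gauss_green_def by unfold_locales auto

text \<open>A null set modification of a polar density that is bounded by \<open>1\<close> everywhere, and therefore also
  almost everywhere for another measure.\<close>

definition unit_part :: "('a::euclidean_space \<Rightarrow> 'a) \<Rightarrow> 'a \<Rightarrow> 'a" where
  "unit_part \<sigma> x = (if norm (\<sigma> x) = 1 then \<sigma> x else 0)"

lemma unit_part_norm_le: "norm (unit_part \<sigma> x) \<le> 1"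
  by (simp add: unit_part_def)

lemma unit_part_inner_le: "b \<in> Basis \<Longrightarrow> \<bar>unit_part \<sigma> x \<bullet> b\<bar> \<le> 1"
  using Basis_le_norm[of b "unit_part \<sigma> x"] unit_part_norm_le[of \<sigma> x] by linarith

lemma unit_part_measurable [measurable]:
  assumes [measurable]: "\<sigma> \<in> borel_measurable borel"
  shows "unit_part \<sigma> \<in> borel_measurable borel"
  unfolding unit_part_def by measurable

lemma C1c_vector:
  fixes \<psi> :: "'a::euclidean_space \<Rightarrow> real"
  assumes \<psi>: "C1c \<psi>"
  shows "C1_compact_support (\<lambda>x. \<psi> x *\<^sub>R b)" "b \<in> Basis \<Longrightarrow> divergence (\<lambda>x. \<psi> x *\<^sub>R b) x = frechet_derivative \<psi> (at x) b"
proof -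
  have d: "((\<lambda>x. \<psi> x *\<^sub>R b) has_derivative (\<lambda>v. frechet_derivative \<psi> (at x) v *\<^sub>R b)) (at x)" for x
    by (intro has_derivative_scaleR_left C1_frechet C1cD \<psi>)
  have fd: "frechet_derivative (\<lambda>x. \<psi> x *\<^sub>R b) (at x) = (\<lambda>v. frechet_derivative \<psi> (at x) v *\<^sub>R b)" for x
    using frechet_derivative_at[OF d] by simp
  obtain R where R: "\<And>x. R \<le> norm x \<Longrightarrow> \<psi> x = 0" using C1c_frechet_zero[OF \<psi>] by metis
  have "{x. \<psi> x *\<^sub>R b \<noteq> 0} \<subseteq> cball 0 R" using R by auto (meson linear)
  then have "compact (closure {x. \<psi> x *\<^sub>R b \<noteq> 0})"
    using bounded_closure bounded_subset bounded_cball compact_eq_bounded_closed closed_closure by metis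
  then show "C1_compact_support (\<lambda>x. \<psi> x *\<^sub>R b)"
    unfolding C1_compact_support_def fd using d
    by (auto simp: differentiable_def intro!: continuous_intros C1_frechet C1cD \<psi>)
  assume b: "b \<in> Basis"
  show "divergence (\<lambda>x. \<psi> x *\<^sub>R b) x = frechet_derivative \<psi> (at x) b"
  proof -
    have "divergence (\<lambda>x. \<psi> x *\<^sub>R b) x = (\<Sum>c\<in>Basis. if b = c then frechet_derivative \<psi> (at x) b else 0)"
      unfolding divergence_def fd by (intro sum.cong) (use b in \<open>auto simp: inner_Basis\<close>)
    then show ?thesis using b by simp
  qed
qed

text \<open>Both representations define the same vector measure, tested component by component. Its
  polar factor of unit length recovers the mass of a ball: \<open>\<mu>\<close> of it is the
  integral of \<open>s \<bullet> s\<close> against \<open>\<mu>\<close>, which equals that of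
  \<open>s \<bullet> s'\<close> against \<open>\<mu>'\<close> and is therefore at most
  \<open>\<mu>'\<close> of it; equality follows by symmetry. Balls suffice, since
  \<open>has_outer_normal\<close> tests a representation on nothing else.\<close>

lemma gauss_green_unique:
  assumes g: "gauss_green E \<mu> \<sigma>" and g': "gauss_green E \<mu>' \<sigma>'"
  shows "measure \<mu> (ball x r) = measure \<mu>' (ball x r)"
    and "(LINT y:ball x r|\<mu>. \<sigma> y) = (LINT y:ball x r|\<mu>'. \<sigma>' y)"
proof -
  interpret m: radon \<mu> by (rule gauss_green_radon[OF g])
  interpret m': radon \<mu>' by (rule gauss_green_radon[OF g'])
  have [measurable]: "ball x r \<in> sets borel" by simp
  define s s' where "s = unit_part \<sigma>" and "s' = unit_part \<sigma>'"
  have [measurable]: "\<sigma> \<in> borel_measurable borel" "\<sigma>' \<in> borel_measurable borel"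
    using g g' by (auto simp: gauss_green_def)
  then have sm [measurable]: "s \<in> borel_measurable borel" "s' \<in> borel_measurable borel" by (auto simp: s_def s'_def)
  have ae: "AE y in \<mu>. s y = \<sigma> y \<and> norm (s y) = 1" "AE y in \<mu>'. s' y = \<sigma>' y \<and> norm (s' y) = 1"
    using g g' by (auto simp: gauss_green_def s_def s'_def unit_part_def)
  have sb: "\<bar>s y \<bullet> b\<bar> \<le> 1" "\<bar>s' y \<bullet> b\<bar> \<le> 1" if "b \<in> Basis" for y b
    using unit_part_inner_le that by (auto simp: s_def s'_def)
  have eq: "(LINT y|\<mu>. \<psi> y * (s y \<bullet> b)) = (LINT y|\<mu>'. \<psi> y * (s' y \<bullet> b))" if "C1c \<psi>" "b \<in> Basis" for \<psi> b
  proof -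
    note [measurable] = C1c_measurable[OF that(1)]
    have "(LINT y|\<mu>. \<psi> y * (s y \<bullet> b)) = (LINT y|\<mu>. (\<psi> y *\<^sub>R b) \<bullet> \<sigma> y)"
      by (rule integral_cong_AE) (use ae(1) in \<open>auto simp: inner_commute\<close>)
    also have "\<dots> = (LINT y|\<mu>'. (\<psi> y *\<^sub>R b) \<bullet> \<sigma>' y)"
      using g g' C1c_vector(1)[OF that(1), of b] unfolding gauss_green_def by metis
    also have "\<dots> = (LINT y|\<mu>'. \<psi> y * (s' y \<bullet> b))"
      by (rule integral_cong_AE) (use ae(2) in \<open>auto simp: inner_commute\<close>)
    finally show ?thesis .
  qed
  obtain R where R: "ball x r \<subseteq> ball 0 R" using bounded_subset_ballD[OF bounded_ball] by blast
  have key: "(LINT y:ball x r|\<mu>. h y * (s y \<bullet> b)) = (LINT y:ball x r|\<mu>'. h y * (s' y \<bullet> b))"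
    if "h \<in> borel_measurable borel" "\<And>y. \<bar>h y\<bar> \<le> 1" "b \<in> Basis" for h :: "'a \<Rightarrow> real" and b
  proof -
    note [measurable] = that(1)
    have "(LINT y:ball 0 R|\<mu>. (indicator (ball x r) y * h y) * (s y \<bullet> b))
      = (LINT y:ball 0 R|\<mu>'. (indicator (ball x r) y * h y) * (s' y \<bullet> b))"
    proof (rule radon_integral_eq)
      show "\<bar>indicator (ball x r) y * h y\<bar> \<le> 1" for y using that(2)[of y] by (auto simp: indicator_def)
      show "(\<lambda>y. indicator (ball x r) y * h y) \<in> borel_measurable borel"
        by measurable
    qed (use sb that eq m.radon_axioms m'.radon_axioms in auto)
    moreover have "(LINT y:ball 0 R|N. (indicator (ball x r) y * h y) * u y) = (LINT y:ball x r|N. h y * u y)"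
      for N and u :: "'a \<Rightarrow> real"
      unfolding set_lebesgue_integral_def using R
      by (intro Bochner_Integration.integral_cong) (auto simp: indicator_def)
    ultimately show ?thesis by simp
  qed
  have comp: "(LINT y:ball x r|\<mu>. \<sigma> y) \<bullet> b = (LINT y:ball x r|\<mu>. s y \<bullet> b)"
    if "radon \<mu>" "\<sigma> \<in> borel_measurable borel" "s = unit_part \<sigma>" "AE y in \<mu>. s y = \<sigma> y" 
    for \<mu> :: "'a measure" and \<sigma> s b
  proof -
    interpret r: radon \<mu> by fact
    have [measurable]: "\<sigma> \<in> borel_measurable borel" "s \<in> borel_measurable borel" using that by auto
    have "(LINT y:ball x r|\<mu>. \<sigma> y) = (LINT y:ball x r|\<mu>. s y)"
      unfolding set_lebesgue_integral_def by (rule integral_cong_AE) (use that(4) in auto)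
    moreover have "set_integrable \<mu> (ball x r) s"
      using unit_part_norm_le that(3) by (intro r.set_integrable_bounded[of _ 1]) auto
    then have "(LINT y:ball x r|\<mu>. s y) \<bullet> b = (LINT y:ball x r|\<mu>. s y \<bullet> b)"
      unfolding set_lebesgue_integral_def set_integrable_def by (subst integral_inner_left[symmetric]) auto
    ultimately show ?thesis by simp
  qed
  show "(LINT y:ball x r|\<mu>. \<sigma> y) = (LINT y:ball x r|\<mu>'. \<sigma>' y)"
  proof (rule euclidean_eqI)
    fix b :: 'a assume b: "b \<in> Basis"
    have "(LINT y:ball x r|\<mu>. \<sigma> y) \<bullet> b = (LINT y:ball x r|\<mu>. s y \<bullet> b)"
      by (rule comp[OF m.radon_axioms _ s_def]) (use ae(1) in auto)
    moreover have "(LINT y:ball x r|\<mu>'. \<sigma>' y) \<bullet> b = (LINT y:ball x r|\<mu>'. s' y \<bullet> b)"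
      by (rule comp[OF m'.radon_axioms _ s'_def]) (use ae(2) in auto)
    ultimately show "(LINT y:ball x r|\<mu>. \<sigma> y) \<bullet> b = (LINT y:ball x r|\<mu>'. \<sigma>' y) \<bullet> b"
      using key[of "\<lambda>_. 1" b] b by simp
  qed
  have split: "(LINT y:ball x r|N. u y \<bullet> w y) = (\<Sum>b\<in>Basis. LINT y:ball x r|N. (u y \<bullet> b) * (w y \<bullet> b))"
    if "radon N" and m [measurable]: "u \<in> borel_measurable borel" "w \<in> borel_measurable borel"
      and n: "\<And>y. norm (u y) \<le> 1" "\<And>y. norm (w y) \<le> 1" for N :: "'a measure" and u w
  proof -
    interpret N: radon N by fact
    have le: "norm ((u y \<bullet> b) * (w y \<bullet> b)) \<le> 1 * 1" if "b \<in> Basis" for y b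
      unfolding norm_mult using Basis_le_norm[OF that, of "u y"] Basis_le_norm[OF that, of "w y"] n[of y]
      by (intro mult_mono) auto
    have "set_integrable N (ball x r) (\<lambda>y. (u y \<bullet> b) * (w y \<bullet> b))" if "b \<in> Basis" for b
      using le[OF that] by (intro N.set_integrable_bounded[of _ 1]) auto
    note si = this
    have "(LINT y:ball x r|N. u y \<bullet> w y)
      = (LINT y|N. (\<Sum>b\<in>Basis. indicator (ball x r) y *\<^sub>R ((u y \<bullet> b) * (w y \<bullet> b))))"
      unfolding set_lebesgue_integral_def
    proof (rule Bochner_Integration.integral_cong[OF refl])
      fix y
      show "indicator (ball x r) y *\<^sub>R (u y \<bullet> w y)
        = (\<Sum>b\<in>Basis. indicator (ball x r) y *\<^sub>R ((u y \<bullet> b) * (w y \<bullet> b)))"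
        by (subst euclidean_inner) (simp add: sum_distrib_left)
    qed
    also have "\<dots> = (\<Sum>b\<in>Basis. LINT y:ball x r|N. (u y \<bullet> b) * (w y \<bullet> b))"
      unfolding set_lebesgue_integral_def using si unfolding set_integrable_def
      by (intro Bochner_Integration.integral_sum)
    finally show ?thesis .
  qed
  have le1: "measure \<mu> (ball x r) \<le> measure \<mu>' (ball x r)"
    if m: "radon \<mu>" "radon \<mu>'" and sm [measurable]: "s \<in> borel_measurable borel" "s' \<in> borel_measurable borel"
    and n: "\<And>y. norm (s y) \<le> 1" "\<And>y. norm (s' y) \<le> 1" and ae: "AE y in \<mu>. norm (s y) = 1"
    and key: "\<And>h b. h \<in> borel_measurable borel \<Longrightarrow> (\<And>y. \<bar>h y\<bar> \<le> 1) \<Longrightarrow> b \<in> Basis \<Longrightarrow>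
      (LINT y:ball x r|\<mu>. h y * (s y \<bullet> b)) = (LINT y:ball x r|\<mu>'. h y * (s' y \<bullet> b))"
    for \<mu> \<mu>' :: "'a measure" and s s'
  proof -
    interpret m: radon \<mu> by fact
    interpret m': radon \<mu>' by fact
    have "measure \<mu> (ball x r) = (LINT y:ball x r|\<mu>. s y \<bullet> s y)"
    proof -
      have "(LINT y:ball x r|\<mu>. s y \<bullet> s y) = (LINT y|\<mu>. indicator (ball x r) y)"
        unfolding set_lebesgue_integral_def
        by (rule integral_cong_AE) (use ae in \<open>auto simp: dot_square_norm\<close>)
      then show ?thesis by simp
    qed
    also have "\<dots> = (\<Sum>b\<in>Basis. LINT y:ball x r|\<mu>. (s y \<bullet> b) * (s y \<bullet> b))"
      by (intro split m sm n)
    also have "\<dots> = (\<Sum>b\<in>Basis. LINT y:ball x r|\<mu>'. (s y \<bullet> b) * (s' y \<bullet> b))"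
      using n(1) by (intro sum.cong refl key) (auto intro: order_trans[OF Basis_le_norm])
    also have "\<dots> = (LINT y:ball x r|\<mu>'. s y \<bullet> s' y)"
      by (intro split[symmetric] m sm n)
    also have "\<dots> \<le> (LINT y:ball x r|\<mu>'. 1)"
    proof (rule set_integral_mono)
      have le: "\<bar>s y \<bullet> s' y\<bar> \<le> 1" for y
        using Cauchy_Schwarz_ineq2[of "s y" "s' y"] mult_mono[OF n(1)[of y] n(2)[of y]] by auto
      then show "set_integrable \<mu>' (ball x r) (\<lambda>y. s y \<bullet> s' y)" "s y \<bullet> s' y \<le> 1" for y
        by (auto intro!: m'.set_integrable_bounded[of _ 1] simp: abs_le_iff)
      show "set_integrable \<mu>' (ball x r) (\<lambda>y. 1::real)" by (intro m'.set_integrable_bounded[of _ 1]) auto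
    qed
    also have "\<dots> = measure \<mu>' (ball x r)" by (simp add: set_lebesgue_integral_def)
    finally show ?thesis .
  qed
  have n: "norm (s y) \<le> 1" "norm (s' y) \<le> 1" for y using unit_part_norm_le by (auto simp: s_def s'_def)
  have ae': "AE y in \<mu>. norm (s y) = 1" "AE y in \<mu>'. norm (s' y) = 1" using ae by auto
  show "measure \<mu> (ball x r) = measure \<mu>' (ball x r)"
  proof (rule antisym)
    show "measure \<mu> (ball x r) \<le> measure \<mu>' (ball x r)"
      by (rule le1[OF m.radon_axioms m'.radon_axioms sm n ae'(1) key])
    show "measure \<mu>' (ball x r) \<le> measure \<mu> (ball x r)"
      by (rule le1[OF m'.radon_axioms m.radon_axioms sm(2,1) n(2,1) ae'(2) key[symmetric]])
  qed
qed

section \<open>The measure-theoretic normal and the smoothed indicator\<close>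

lemma C1_compact_support_component:
  fixes \<phi> :: "'a::euclidean_space \<Rightarrow> 'a"
  assumes "C1_compact_support \<phi>"
  shows "C1c (\<lambda>x. \<phi> x \<bullet> b)"
    and "frechet_derivative (\<lambda>x. \<phi> x \<bullet> b) (at x) v = frechet_derivative \<phi> (at x) v \<bullet> b"
proof -
  have d: "(\<phi> has_derivative frechet_derivative \<phi> (at x)) (at x)" for x
    using assms unfolding C1_compact_support_def by (simp add: frechet_derivative_works)
  have db: "((\<lambda>x. \<phi> x \<bullet> b) has_derivative (\<lambda>v. frechet_derivative \<phi> (at x) v \<bullet> b)) (at x)" for x
    by (intro has_derivative_inner_left d)
  then show "frechet_derivative (\<lambda>x. \<phi> x \<bullet> b) (at x) v = frechet_derivative \<phi> (at x) v \<bullet> b"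
    using frechet_derivative_at[OF db] by metis
  have "continuous_on UNIV (\<lambda>x. frechet_derivative \<phi> (at x) v \<bullet> b)" for v
  proof -
    have "frechet_derivative \<phi> (at x) v = (\<Sum>c\<in>Basis. (v \<bullet> c) *\<^sub>R frechet_derivative \<phi> (at x) c)" for x
    proof -
      interpret linear "frechet_derivative \<phi> (at x)" using d has_derivative_linear by blast
      show ?thesis using sum[of "\<lambda>b. (v \<bullet> b) *\<^sub>R b" Basis] by (simp add: euclidean_representation scale)
    qed
    then show ?thesis
      using assms unfolding C1_compact_support_def by (auto intro!: continuous_intros)
  qed
  with db have "C1 (\<lambda>x. \<phi> x \<bullet> b)" by (rule C1I)
  moreover have "bounded {x. \<phi> x \<noteq> 0}"
    using assms bounded_subset[OF compact_imp_bounded closure_subset] unfolding C1_compact_support_def by blast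
  then obtain R where R: "\<And>x. \<phi> x \<noteq> 0 \<Longrightarrow> norm x \<le> R" unfolding bounded_iff by blast
  have "\<phi> x \<bullet> b = 0" if "R + 1 \<le> norm x" for x using R[of x] that by force
  ultimately show "C1c (\<lambda>x. \<phi> x \<bullet> b)" unfolding C1c_def by blast
qed

locale flux_domain = ahlfors_domain M F A R0 \<Omega>
  for M :: "'a::euclidean_space measure" and F and A R0 :: real and \<Omega> +
  fixes g :: "'a \<Rightarrow> 'a" and C :: real
  assumes g [measurable]: "g \<in> borel_measurable borel" and g_le: "\<And>x. norm (g x) \<le> C"
    and flux_eq: "\<And>\<phi> v. C1c \<phi> \<Longrightarrow> flux \<phi> v = (LINT x|M. \<phi> x * (g x \<bullet> v))"
begin

lemma C_nonneg: "0 \<le> C"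
  using order_trans[OF norm_ge_zero g_le] .

text \<open>The polar form of the vector measure \<open>g\<close> times \<open>M\<close>: its total
  variation. The direction \<open>sgn g\<close> is a unit vector almost everywhere for
  \<open>perim\<close>, because the zeros of \<open>g\<close> form a \<open>perim\<close>-null
  set.\<close>

definition perim :: "'a measure" where
  "perim = density M (\<lambda>x. ennreal (norm (g x)))"

lemma sets_perim [simp, measurable_cong]: "sets perim = sets borel"
  by (simp add: perim_def)

lemma integral_perim:
  fixes f :: "'a \<Rightarrow> 'b::{banach, second_countable_topology}"
  assumes "f \<in> borel_measurable borel"
  shows "(LINT x|perim. f x) = (LINT x|M. norm (g x) *\<^sub>R f x)"
  unfolding perim_def using assms by (intro integral_density) auto

lemma norm_scaleR_sgn: "norm y *\<^sub>R sgn y = (y::'a)"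
  by (cases "y = 0") (simp_all add: sgn_div_norm)

lemma sgn_measurable [measurable]: "(\<lambda>x. sgn (g x)) \<in> borel_measurable borel"
  unfolding sgn_div_norm by measurable

lemma g_integrable: "bounded D \<Longrightarrow> D \<in> sets borel \<Longrightarrow> set_integrable M D g"
  using g_le by (intro set_integrable_bounded[of _ C]) auto

lemma norm_g_integrable: "bounded D \<Longrightarrow> D \<in> sets borel \<Longrightarrow> set_integrable M D (\<lambda>x. norm (g x))"
  using g_le by (intro set_integrable_bounded[of _ C]) auto

lemma measure_perim:
  "bounded D \<Longrightarrow> D \<in> sets borel \<Longrightarrow> emeasure perim D = ennreal (LINT x:D|M. norm (g x))"
proof -
  assume D: "bounded D" "D \<in> sets borel"
  have "emeasure perim D = (\<integral>\<^sup>+x. ennreal (norm (g x)) * indicator D x \<partial>M)"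
    unfolding perim_def using D by (intro emeasure_density) auto
  also have "\<dots> = (\<integral>\<^sup>+x. ennreal (indicator D x *\<^sub>R norm (g x)) \<partial>M)"
    by (intro nn_integral_cong) (auto simp: indicator_def)
  also have "\<dots> = ennreal (LINT x:D|M. norm (g x))"
    unfolding set_lebesgue_integral_def using norm_g_integrable[OF D] unfolding set_integrable_def
    by (intro nn_integral_eq_integral) auto
  finally show ?thesis .
qed

lemma gauss_green_perim: "gauss_green \<Omega> perim (\<lambda>x. sgn (g x))"
  unfolding gauss_green_def
proof (intro conjI allI impI)
  show "emeasure perim K < \<infinity>" if "compact K" for K
    using that by (subst measure_perim) (auto intro: compact_imp_bounded borel_compact)
  show "AE x in perim. norm (sgn (g x)) = 1"
    unfolding perim_def by (subst AE_density) (auto simp: norm_sgn)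
  fix \<phi> :: "'a \<Rightarrow> 'a" assume \<phi>: "C1_compact_support \<phi>"
  note c = C1_compact_support_component[OF \<phi>]
  have [measurable]: "\<phi> \<in> borel_measurable borel"
  proof -
    have "(\<lambda>x. \<Sum>b\<in>Basis. (\<phi> x \<bullet> b) *\<^sub>R b) \<in> borel_measurable borel"
      using C1c_measurable[OF c(1)] by measurable
    then show ?thesis by (simp add: euclidean_representation)
  qed
  have fi: "integrable lborel (\<lambda>x. indicator \<Omega> x * (frechet_derivative \<phi> (at x) b \<bullet> b))" for b
    using flux_integrable[OF c(1), of b b] by (simp add: c(2))
  have eq: "indicator \<Omega> x *\<^sub>R divergence \<phi> x
      = (\<Sum>b\<in>Basis. indicator \<Omega> x * (frechet_derivative \<phi> (at x) b \<bullet> b))" for x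
    by (simp add: divergence_def sum_distrib_left)
  have "(LINT x:\<Omega>|lebesgue. divergence \<phi> x) = (LINT x|lborel. indicator \<Omega> x *\<^sub>R divergence \<phi> x)"
    unfolding set_lebesgue_integral_def eq
    using borel_measurable_integrable[OF fi] by (intro integral_completion borel_measurable_sum) auto
  also have "\<dots> = (\<Sum>b\<in>Basis. flux (\<lambda>x. \<phi> x \<bullet> b) b)"
    unfolding eq flux_def c(2) using fi by (intro Bochner_Integration.integral_sum)
  also have "\<dots> = (\<Sum>b\<in>Basis. LINT x|M. (\<phi> x \<bullet> b) * (g x \<bullet> b))"
    by (simp add: flux_eq[OF c(1)])
  also have "\<dots> = (LINT x|M. (\<Sum>b\<in>Basis. (\<phi> x \<bullet> b) * (g x \<bullet> b)))"
  proof (rule Bochner_Integration.integral_sum[symmetric])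
    fix b :: 'a assume "b \<in> Basis"
    then have "\<bar>g x \<bullet> b\<bar> \<le> C" for x using Basis_le_norm[of b "g x"] g_le[of x] by linarith
    then show "integrable M (\<lambda>x. (\<phi> x \<bullet> b) * (g x \<bullet> b))"
      by (intro integrable_mult_bounded[OF C1c_integrable[OF c(1)]]) auto
  qed
  also have "\<dots> = (LINT x|M. norm (g x) *\<^sub>R (\<phi> x \<bullet> sgn (g x)))"
  proof (rule Bochner_Integration.integral_cong[OF refl])
    fix x
    have "(\<Sum>b\<in>Basis. (\<phi> x \<bullet> b) * (g x \<bullet> b)) = \<phi> x \<bullet> g x" by (rule euclidean_inner[symmetric])
    also have "\<dots> = \<phi> x \<bullet> (norm (g x) *\<^sub>R sgn (g x))" by (simp only: norm_scaleR_sgn)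
    finally show "(\<Sum>b\<in>Basis. (\<phi> x \<bullet> b) * (g x \<bullet> b)) = norm (g x) *\<^sub>R (\<phi> x \<bullet> sgn (g x))"
      by simp
  qed
  also have "\<dots> = (LINT x|perim. \<phi> x \<bullet> sgn (g x))"
    by (rule integral_perim[symmetric]) measurable
  finally show "(LINT x:\<Omega>|lebesgue. divergence \<phi> x) = (LINT x|perim. \<phi> x \<bullet> sgn (g x))" .
qed auto

lemma locally_finite_perimeter: "locally_finite_perimeter \<Omega>"
  unfolding locally_finite_perimeter_def using gauss_green_perim open_\<Omega> by auto

lemma perim_ball:
  "measure perim (ball x r) = (LINT y:ball x r|M. norm (g y))"
  "(LINT y:ball x r|perim. sgn (g y)) = (LINT y:ball x r|M. g y)"
proof -
  have "0 \<le> (LINT y:ball x r|M. norm (g y))" unfolding set_lebesgue_integral_def by simp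
  then show "measure perim (ball x r) = (LINT y:ball x r|M. norm (g y))"
    by (simp add: measure_def measure_perim)
  have [measurable]: "ball x r \<in> sets borel" by simp
  have "(LINT y:ball x r|perim. sgn (g y)) = (LINT y|M. norm (g y) *\<^sub>R indicator (ball x r) y *\<^sub>R sgn (g y))"
    unfolding set_lebesgue_integral_def by (rule integral_perim) measurable
  also have "\<dots> = (LINT y:ball x r|M. g y)"
    unfolding set_lebesgue_integral_def
    by (intro Bochner_Integration.integral_cong) (auto simp: indicator_def norm_scaleR_sgn)
  finally show "(LINT y:ball x r|perim. sgn (g y)) = (LINT y:ball x r|M. g y)" .
qed

lemma ball_norm_diff_integrable: "set_integrable M (ball x r) (\<lambda>y. norm (g y - a))"
proof (rule set_integrable_bounded[of _ "C + norm a"])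
  show "norm (norm (g y - a)) \<le> C + norm a" for y
    using norm_triangle_ineq4[of "g y" a] g_le[of y] by simp
qed auto

lemma set_integral_norm_le:
  fixes f :: "'a \<Rightarrow> 'b::{banach, second_countable_topology}"
  shows "norm (LINT y:D|M. f y) \<le> (LINT y:D|M. norm (f y))"
  unfolding set_lebesgue_integral_def
  using integral_norm_bound[of M "\<lambda>y. indicat_real D y *\<^sub>R f y"] by simp

lemma set_integral_ball_const: "(LINT y:ball x r|M. c) = measure M (ball x r) *\<^sub>R (c::'b::euclidean_space)"
  unfolding set_lebesgue_integral_def using finite_bounded[of "ball x r"] by simp

lemma const_integrable: "set_integrable M (ball x r) (\<lambda>_. c::'b::euclidean_space)"
  by (rule set_integrable_bounded[of _ "norm c"]) auto

lemma lebesgue_point_tendsto: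
  assumes x: "x \<in> F" and lp: "lebesgue_point g x"
  shows "((\<lambda>r. (LINT y:ball x r|M. g y) /\<^sub>R measure M (ball x r)) \<longlongrightarrow> g x) (at_right 0)"
    and "((\<lambda>r. (LINT y:ball x r|M. norm (g y)) / measure M (ball x r)) \<longlongrightarrow> norm (g x)) (at_right 0)"
proof -
  have ev: "\<forall>\<^sub>F r in at_right 0. 0 < measure M (ball x r) \<and>
      (LINT y:ball x r|M. norm (g y - g x)) \<le> \<epsilon> * measure M (ball x r)" if e: "\<epsilon> > 0" for \<epsilon>
  proof -
    obtain \<delta> where \<delta>: "\<delta> > 0" "\<And>r. 0 < r \<Longrightarrow> r < \<delta> \<Longrightarrow>
        (LINT y:ball x r|M. norm (g y - g x)) \<le> \<epsilon> * measure M (ball x r)"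
      using lp[unfolded lebesgue_point_def, rule_format, OF e] by auto
    then show ?thesis
      using R0 ball_pos[OF x] unfolding eventually_at_right_field
      by (intro exI[of _ "min \<delta> R0"]) auto
  qed
  show "((\<lambda>r. (LINT y:ball x r|M. g y) /\<^sub>R measure M (ball x r)) \<longlongrightarrow> g x) (at_right 0)"
  proof (rule tendstoI)
    fix \<epsilon> :: real assume "\<epsilon> > 0"
    then have "\<epsilon> / 2 > 0" by simp
    from ev[OF this] show "\<forall>\<^sub>F r in at_right 0. dist ((LINT y:ball x r|M. g y) /\<^sub>R measure M (ball x r)) (g x) < \<epsilon>"
    proof eventually_elim
      case (elim r)
      let ?m = "measure M (ball x r)"
      have "(LINT y:ball x r|M. g y) - ?m *\<^sub>R g x = (LINT y:ball x r|M. g y - g x)"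
        using g_integrable[of "ball x r"] const_integrable[of x r "g x"]
        by (simp add: set_integral_ball_const set_integral_diff)
      then have "norm ((LINT y:ball x r|M. g y) - ?m *\<^sub>R g x) \<le> \<epsilon> / 2 * ?m"
        using set_integral_norm_le[of "ball x r" "\<lambda>y. g y - g x"] elim by simp
      moreover have "(LINT y:ball x r|M. g y) /\<^sub>R ?m - g x = ((LINT y:ball x r|M. g y) - ?m *\<^sub>R g x) /\<^sub>R ?m"
        using elim by (simp add: algebra_simps)
      ultimately have "dist ((LINT y:ball x r|M. g y) /\<^sub>R ?m) (g x) \<le> \<epsilon> / 2"
        using elim by (simp add: dist_norm divide_simps mult.commute)
      then show ?case using \<open>\<epsilon> > 0\<close> by simp
    qed
  qed
  show "((\<lambda>r. (LINT y:ball x r|M. norm (g y)) / measure M (ball x r)) \<longlongrightarrow> norm (g x)) (at_right 0)"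
  proof (rule tendstoI)
    fix \<epsilon> :: real assume "\<epsilon> > 0"
    then have "\<epsilon> / 2 > 0" by simp
    from ev[OF this] show "\<forall>\<^sub>F r in at_right 0. dist ((LINT y:ball x r|M. norm (g y)) / measure M (ball x r)) (norm (g x)) < \<epsilon>"
    proof eventually_elim
      case (elim r)
      let ?m = "measure M (ball x r)"
      have "(LINT y:ball x r|M. norm (g y)) - ?m * norm (g x) = (LINT y:ball x r|M. norm (g y) - norm (g x))"
        using norm_g_integrable[of "ball x r"] const_integrable[of x r "norm (g x)"]
        by (simp add: set_integral_ball_const set_integral_diff)
      moreover have "(LINT y:ball x r|M. norm (norm (g y) - norm (g x))) \<le> (LINT y:ball x r|M. norm (g y - g x))"
        using norm_g_integrable[of "ball x r"] const_integrable[of x r "norm (g x)"]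
          g_integrable[of "ball x r"] const_integrable[of x r "g x"]
        by (intro set_integral_mono set_integrable_norm set_integral_diff) (auto simp: norm_triangle_ineq3)
      ultimately have "\<bar>(LINT y:ball x r|M. norm (g y)) - ?m * norm (g x)\<bar> \<le> \<epsilon> / 2 * ?m"
        using set_integral_norm_le[of "ball x r" "\<lambda>y. norm (g y) - norm (g x)"] elim by simp
      moreover have "(LINT y:ball x r|M. norm (g y)) / ?m - norm (g x)
         = ((LINT y:ball x r|M. norm (g y)) - ?m * norm (g x)) / ?m"
        using elim by (simp add: field_simps)
      ultimately have "dist ((LINT y:ball x r|M. norm (g y)) / ?m) (norm (g x)) \<le> \<epsilon> / 2"
        using elim by (simp add: dist_real_def divide_simps mult.commute)
      then show ?case using \<open>\<epsilon> > 0\<close> by simp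
    qed
  qed
qed

text \<open>The quotient in De Giorgi's definition is the average of \<open>g\<close> divided by
  that of \<open>norm g\<close>, and at a Lebesgue point it tends to \<open>g x\<close> divided by
  its norm. By \<open>gauss_green_unique\<close> any other representation has the same quotients,
  which settles the definite description.\<close>

lemma outer_normal_eq:
  assumes x: "x \<in> F" and lp: "lebesgue_point g x" and nz: "g x \<noteq> 0"
  shows "outer_normal \<Omega> x = sgn (g x)"
proof -
  let ?N = "\<lambda>r. LINT y:ball x r|M. norm (g y)"
  note lim = lebesgue_point_tendsto[OF x lp]
  have ev: "\<forall>\<^sub>F r in at_right 0. 0 < measure M (ball x r)"
    using R0 ball_pos[OF x] unfolding eventually_at_right_field by (intro exI[of _ R0]) auto
  have evN: "\<forall>\<^sub>F r in at_right 0. 0 < ?N r"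
  proof -
    have "\<forall>\<^sub>F r in at_right 0. 0 < ?N r / measure M (ball x r)"
      using order_tendstoD(1)[OF lim(2), of 0] nz by simp
    with ev show ?thesis by eventually_elim (simp add: zero_less_divide_iff)
  qed
  have pos: "measure perim (ball x r) > 0" if "r > 0" for r
  proof -
    have "\<forall>\<^sub>F r' in at_right 0. r' < r" using that by (auto simp: eventually_at_right_field)
    from eventually_happens'[OF _ eventually_conj[OF this evN]]
    obtain r' where "r' < r" "0 < ?N r'" by auto
    moreover have "measure perim (ball x r') \<le> measure perim (ball x r)"
      using \<open>r' < r\<close> by (intro measure_mono_fmeasurable) (auto simp: fmeasurable_def measure_perim)
    ultimately show ?thesis by (simp add: perim_ball)
  qed
  have "((\<lambda>r. ((LINT y:ball x r|M. g y) /\<^sub>R measure M (ball x r)) /\<^sub>R (?N r / measure M (ball x r))) \<longlongrightarrow> g x /\<^sub>R norm (g x)) (at_right 0)"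
    using nz by (intro tendsto_intros lim) auto
  then have lim_perim: "((\<lambda>r. (LINT y:ball x r|perim. sgn (g y)) /\<^sub>R measure perim (ball x r)) \<longlongrightarrow> sgn (g x)) (at_right 0)"
    unfolding sgn_div_norm[of "g x", symmetric]
    by (rule Lim_transform_eventually) (use ev in \<open>auto elim!: eventually_mono simp: perim_ball inverse_eq_divide\<close>)
  have "has_outer_normal \<Omega> x (sgn (g x))"
    unfolding has_outer_normal_def
    using locally_finite_perimeter gauss_green_perim pos lim_perim nz
    by (auto simp: norm_sgn intro!: exI[of _ perim] exI[of _ "\<lambda>x. sgn (g x)"])
  moreover have "v = sgn (g x)" if v: "has_outer_normal \<Omega> x v" for v
  proof -
    obtain \<mu> \<sigma> where gg: "gauss_green \<Omega> \<mu> \<sigma>"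
      and l: "((\<lambda>r. (LINT y:ball x r|\<mu>. \<sigma> y) /\<^sub>R measure \<mu> (ball x r)) \<longlongrightarrow> v) (at_right 0)"
      using v unfolding has_outer_normal_def by blast
    show ?thesis
      using tendsto_unique[OF _ l[unfolded gauss_green_unique[OF gg gauss_green_perim]] lim_perim] by simp
  qed
  ultimately have "(THE v. has_outer_normal \<Omega> x v) = sgn (g x)" and "x \<in> reduced_boundary \<Omega>"
    unfolding reduced_boundary_def by (blast intro: the_equality)+
  then show ?thesis unfolding outer_normal_def by simp
qed

section \<open>The smoothed indicator and its gradient\<close>

definition bump_mass :: "real \<Rightarrow> real" where
  "bump_mass s = (LINT x|lborel. bump s (x::'a))"

text \<open>The convolution of \<open>indicator \<Omega>\<close> with the bump of radius
  \<open>s\<close> normalised to total mass 1.\<close>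

definition smooth_ind :: "real \<Rightarrow> 'a \<Rightarrow> real" where
  "smooth_ind s z = (LINT x|lborel. indicator \<Omega> x * bump s (x - z)) / bump_mass s"

lemma bump_measurable [measurable]: "(bump s :: 'a \<Rightarrow> real) \<in> borel_measurable borel"
  by (intro borel_measurable_continuous_onI C1_continuous C1_bump)

lemma bump_integrable: "s > 0 \<Longrightarrow> integrable lborel (\<lambda>x. bump s (x - z::'a))"
  by (intro lb.C1c_integrable C1c_bump_shift)

lemma bump_mass_shift: "(LINT x|lborel. bump s (x - z::'a)) = bump_mass s"
  using integral_shift[of "bump s" "- z"] by (simp add: bump_mass_def)

lemma bump_mass_lower:
  assumes "s > 0"
  shows "measure lborel (ball (0::'a) 1) * (s / 2) ^ DIM('a) / 2 \<le> bump_mass s"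
proof -
  have "(LINT x|lborel. 1 / 2 * indicat_real (ball (0::'a) (s / 2)) x) \<le> bump_mass s"
    unfolding bump_mass_def
  proof (rule integral_mono)
    show "integrable lborel (\<lambda>x. 1 / 2 * indicat_real (ball (0::'a) (s / 2)) x)"
      using emeasure_bounded_finite[of "ball (0::'a) (s / 2)"]
      by (intro integrable_mult_right integrable_real_indicator) auto
    show "integrable lborel (bump s :: 'a \<Rightarrow> real)" using bump_integrable[OF assms, of 0] by simp
    show "1 / 2 * indicator (ball 0 (s / 2)) x \<le> bump s x" for x :: 'a
      using bump_ge_half[of x s] assms by (auto simp: indicator_def)
  qed
  then show ?thesis using assms lborel_ball[of "s / 2" 0] by (simp add: mult.commute)
qed

lemma bump_mass_pos: "s > 0 \<Longrightarrow> 0 < bump_mass s"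
  using bump_mass_lower[of s] content_ball_pos[of 1 "0::'a"]
  by (metis half_gt_zero less_le_trans mult_pos_pos zero_less_power zero_less_one)

lemma smooth_ind_range:
  assumes "s > 0"
  shows "0 \<le> smooth_ind s z" "smooth_ind s z \<le> 1"
proof -
  have i: "integrable lborel (\<lambda>x. indicator \<Omega> x * bump s (x - z))"
    by (rule \<Omega>_integrable[OF C1c_bump_shift[OF assms]])
  have "(LINT x|lborel. indicator \<Omega> x * bump s (x - z)) \<le> (LINT x|lborel. bump s (x - z))"
    by (rule integral_mono[OF i bump_integrable[OF assms]]) (auto simp: indicator_def)
  then show "smooth_ind s z \<le> 1"
    using bump_mass_pos[OF assms] by (simp add: smooth_ind_def bump_mass_shift)
  show "0 \<le> smooth_ind s z"
    using bump_mass_pos[OF assms] by (simp add: smooth_ind_def)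
qed

lemma far_ball:
  assumes "z \<notin> nbhd s"
  shows "z \<in> \<Omega> \<Longrightarrow> ball z s \<subseteq> \<Omega>" and "z \<notin> \<Omega> \<Longrightarrow> ball z s \<inter> \<Omega> = {}"
proof -
  have F0: "ball z s \<inter> F = {}" using assms by (auto simp: nbhd_def)
  have "ball z s \<inter> \<Omega> = {} \<or> ball z s - \<Omega> = {}"
    using connected_Int_frontier[OF connected_ball, of z s \<Omega>] F0 F_eq by blast
  moreover have "z \<in> ball z s \<or> ball z s = {}" using ball_empty[of s z] by force
  ultimately show "z \<in> \<Omega> \<Longrightarrow> ball z s \<subseteq> \<Omega>" "z \<notin> \<Omega> \<Longrightarrow> ball z s \<inter> \<Omega> = {}"
    by blast+
qed

lemma smooth_ind_far:
  assumes "s > 0" "z \<notin> nbhd s"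
  shows "smooth_ind s z = (if z \<in> \<Omega> then 1 else 0)"
proof -
  have zero: "bump s (x - z) = 0" if "x \<notin> ball z s" for x
    using that assms by (intro bump_eq_0) (auto simp: dist_norm norm_minus_commute)
  show ?thesis
  proof (cases "z \<in> \<Omega>")
    case True
    have "indicator \<Omega> x * bump s (x - z) = bump s (x - z)" for x
      using far_ball(1)[OF assms(2) True] zero[of x] by (cases "x \<in> ball z s") auto
    then have "(LINT x|lborel. indicator \<Omega> x * bump s (x - z)) = (LINT x|lborel. bump s (x - z))"
      by (rule Bochner_Integration.integral_cong[OF refl])
    then show ?thesis using True bump_mass_pos[OF assms(1)] by (simp add: smooth_ind_def bump_mass_shift)
  next
    case False
    have "indicator \<Omega> x * bump s (x - z) = 0" for x
      using far_ball(2)[OF assms(2) False] zero[of x] by (cases "x \<in> ball z s") (auto simp: indicator_def)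
    then have "(\<lambda>x. indicator \<Omega> x * bump s (x - z)) = (\<lambda>x. 0)" by blast
    then show ?thesis using False by (simp add: smooth_ind_def)
  qed
qed

text \<open>Moving the centre of the bump along \<open>h\<close> shifts the test function along
  \<open>- h\<close>, so \<open>DERIV_flux\<close> applies and \<open>flux_eq\<close> turns the
  result into an integral of \<open>g\<close>. Thus the gradient of \<open>smooth_ind\<close> is
  minus the mollified vector measure \<open>g\<close> times \<open>M\<close>.\<close>

lemma DERIV_smooth_ind:
  assumes "s > 0"
  shows "((\<lambda>t. smooth_ind s (z + t *\<^sub>R h)) has_real_derivative
    - (LINT y|M. bump s (y - (z + t *\<^sub>R h)) * (g y \<bullet> h)) / bump_mass s) (at t)"
proof -
  let ?w = "z + t *\<^sub>R h"
  have "((\<lambda>\<tau>. LINT x|lborel. indicator \<Omega> x * bump s (x + \<tau> *\<^sub>R (- h) - ?w)) has_real_derivative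
    flux (\<lambda>x. bump s (x - ?w)) (- h)) (at 0)"
    by (rule DERIV_flux[OF C1c_bump_shift[OF assms]])
  moreover have "flux (\<lambda>x. bump s (x - ?w)) (- h) = - (LINT y|M. bump s (y - ?w) * (g y \<bullet> h))"
    using flux_eq[OF C1c_bump_shift[OF assms, of ?w], of "- h"] by simp
  ultimately have "((\<lambda>\<tau>. (LINT x|lborel. indicator \<Omega> x * bump s (x + \<tau> *\<^sub>R (- h) - ?w)) / bump_mass s) has_real_derivative
    - (LINT y|M. bump s (y - ?w) * (g y \<bullet> h)) / bump_mass s) (at 0)"
    by (intro DERIV_cdivide) simp
  moreover have "x + \<tau> *\<^sub>R (- h) - ?w = x - (z + (\<tau> + t) *\<^sub>R h)" for x \<tau>
    by (simp add: algebra_simps)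
  ultimately have "((\<lambda>\<tau>. smooth_ind s (z + (\<tau> + t) *\<^sub>R h)) has_real_derivative
    - (LINT y|M. bump s (y - ?w) * (g y \<bullet> h)) / bump_mass s) (at 0)"
    by (simp only: smooth_ind_def)
  then show ?thesis
    using DERIV_shift[of "\<lambda>t. smooth_ind s (z + t *\<^sub>R h)" _ 0 t] by simp
qed

text \<open>By the mean value theorem one bump centre \<open>w\<close> on the segment represents the
  whole difference; all comparisons below become estimates of a single integral against a single
  bump.\<close>

lemma smooth_ind_diff:
  assumes "s > 0"
  obtains w where "w \<in> closed_segment z z'"
    "smooth_ind s z' - smooth_ind s z = - (LINT y|M. bump s (y - w) * (g y \<bullet> (z' - z))) / bump_mass s"
proof -
  define u where "u t = smooth_ind s (z + t *\<^sub>R (z' - z))" for t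
  obtain t where t: "0 < t" "t < 1"
    "u 1 - u 0 = (1 - 0) * (- (LINT y|M. bump s (y - (z + t *\<^sub>R (z' - z))) * (g y \<bullet> (z' - z))) / bump_mass s)"
    using MVT2[of 0 1 u "\<lambda>t. - (LINT y|M. bump s (y - (z + t *\<^sub>R (z' - z))) * (g y \<bullet> (z' - z))) / bump_mass s"]
      DERIV_smooth_ind[OF assms] unfolding u_def by auto
  have "z + t *\<^sub>R (z' - z) \<in> closed_segment z z'"
    using t unfolding closed_segment_def by (auto simp: algebra_simps intro!: exI[of _ t])
  then show thesis using t(3) by (intro that) (auto simp: u_def)
qed

lemma bump_integrable_M:
  fixes f :: "'a \<Rightarrow> real"
  assumes "s > 0" "f \<in> borel_measurable borel" "\<And>y. \<bar>f y\<bar> \<le> B"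
  shows "integrable M (\<lambda>y. bump s (y - w) * f y)"
  by (rule integrable_mult_bounded(1)[OF C1c_integrable[OF C1c_bump_shift] assms(2,3)]) fact

lemma bump_integral_upper:
  assumes "s > 0" "ball w s \<subseteq> D" "bounded D" "D \<in> sets borel"
    and f: "f \<in> borel_measurable borel" "\<And>y. 0 \<le> f y" "\<And>y. f y \<le> B"
  shows "(LINT y|M. bump s (y - w) * f y) \<le> (LINT y:D|M. f y)"
  unfolding set_lebesgue_integral_def
proof (rule integral_mono)
  have B: "\<bar>f y\<bar> \<le> B" for y using f(2,3)[of y] by simp
  show "integrable M (\<lambda>y. bump s (y - w) * f y)" by (rule bump_integrable_M[OF assms(1) f(1) B])
  show "integrable M (\<lambda>y. indicat_real D y *\<^sub>R f y)"
    using set_integrable_bounded[of f B D] B assms unfolding set_integrable_def by simp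
  show "bump s (y - w) * f y \<le> indicat_real D y *\<^sub>R f y" for y
  proof (cases "y \<in> ball w s")
    case True
    then show ?thesis using assms(2) mult_right_mono[OF bump_le_1 f(2), of s "y - w" y] by auto
  next
    case False
    then have "bump s (y - w) = 0" using assms(1) by (intro bump_eq_0) (auto simp: dist_norm norm_minus_commute)
    then show ?thesis using f(2)[of y] by (simp add: indicator_def)
  qed
qed

lemma bump_integral_lower:
  assumes "s > 0" "D \<subseteq> ball w (s / 2)" "D \<in> sets borel"
    and f: "f \<in> borel_measurable borel" "\<And>y. 0 \<le> f y" "\<And>y. f y \<le> B"
  shows "(LINT y:D|M. f y) / 2 \<le> (LINT y|M. bump s (y - w) * f y)"
proof -
  have D: "bounded D" using assms(2) bounded_subset bounded_ball by blast
  have B: "\<bar>f y\<bar> \<le> B" for y using f(2,3)[of y] by simp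
  have "(LINT y|M. indicat_real D y *\<^sub>R f y / 2) \<le> (LINT y|M. bump s (y - w) * f y)"
  proof (rule integral_mono)
    show "integrable M (\<lambda>y. bump s (y - w) * f y)" by (rule bump_integrable_M[OF assms(1) f(1) B])
    show "integrable M (\<lambda>y. indicat_real D y *\<^sub>R f y / 2)"
      using set_integrable_bounded[of f B D] B assms D unfolding set_integrable_def by simp
    show "indicat_real D y *\<^sub>R f y / 2 \<le> bump s (y - w) * f y" for y
    proof (cases "y \<in> D")
      case True
      then have "norm (y - w) \<le> s / 2" using assms(2) by (auto simp: dist_norm norm_minus_commute)
      then have "1 / 2 \<le> bump s (y - w)" using assms(1) by (intro bump_ge_half)
      from mult_right_mono[OF this f(2)[of y]] show ?thesis using True by simp
    qed (use f(2)[of y] in simp)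
  qed
  then show ?thesis by (simp add: set_lebesgue_integral_def)
qed

text \<open>\<open>2 * r\<close> bounds the distance of the two points, and
  \<open>ball x (2 * r)\<close> contains every bump of radius \<open>s \<le> r\<close> centred on
  the segment between them.\<close>

lemma smooth_ind_lipschitz:
  assumes "s > 0" "s \<le> r" "z \<in> ball x r" "z' \<in> ball x r"
  shows "\<bar>smooth_ind s z' - smooth_ind s z\<bar> \<le> 2 * r / bump_mass s * (LINT y:ball x (2 * r)|M. norm (g y))"
proof -
  obtain w where w: "w \<in> closed_segment z z'"
    "smooth_ind s z' - smooth_ind s z = - (LINT y|M. bump s (y - w) * (g y \<bullet> (z' - z))) / bump_mass s"
    using smooth_ind_diff[OF assms(1)] by blast
  have "w \<in> ball x r" using w(1) assms closed_segment_subset[OF _ _ convex_ball] by blast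
  then have sub: "ball w s \<subseteq> ball x (2 * r)"
    using assms(2) dist_triangle[of x _ w] by (auto simp: subset_iff) (smt (verit) dist_triangle)
  have zz: "norm (z' - z) \<le> 2 * r"
    using dist_triangle[of z' z x] assms(3,4) by (simp add: dist_norm norm_minus_commute)
  have r0: "0 < r" using assms by linarith
  have gm: "(\<lambda>y. norm (g y)) \<in> borel_measurable borel" by measurable
  have "norm (LINT y|M. bump s (y - w) * (g y \<bullet> (z' - z))) \<le> (LINT y|M. norm (bump s (y - w) * (g y \<bullet> (z' - z))))"
    by (rule integral_norm_bound)
  also have "\<dots> \<le> (LINT y|M. 2 * r * (bump s (y - w) * norm (g y)))"
  proof (rule integral_mono)
    have "\<bar>g y \<bullet> (z' - z)\<bar> \<le> C * norm (z' - z)" for y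
      by (rule order_trans[OF Cauchy_Schwarz_ineq2]) (intro mult_right_mono g_le norm_ge_zero)
    then show "integrable M (\<lambda>y. norm (bump s (y - w) * (g y \<bullet> (z' - z))))"
      using assms by (intro integrable_norm bump_integrable_M) auto
    show "integrable M (\<lambda>y. 2 * r * (bump s (y - w) * norm (g y)))"
      using g_le assms by (intro integrable_mult_right bump_integrable_M) auto
    fix y
    have "\<bar>g y \<bullet> (z' - z)\<bar> \<le> norm (g y) * (2 * r)"
      by (rule order_trans[OF Cauchy_Schwarz_ineq2]) (intro mult_left_mono zz norm_ge_zero)
    from mult_left_mono[OF this bump_nonneg[of s "y - w"]]
    show "norm (bump s (y - w) * (g y \<bullet> (z' - z))) \<le> 2 * r * (bump s (y - w) * norm (g y))"
      by (simp add: abs_mult mult_ac)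
  qed
  also have "\<dots> = 2 * r * (LINT y|M. bump s (y - w) * norm (g y))" by simp
  also have "\<dots> \<le> 2 * r * (LINT y:ball x (2 * r)|M. norm (g y))"
    using r0 bump_integral_upper[OF assms(1) sub _ _ gm norm_ge_zero g_le] by (intro mult_left_mono) auto
  finally have "\<bar>LINT y|M. bump s (y - w) * (g y \<bullet> (z' - z))\<bar> \<le> 2 * r * (LINT y:ball x (2 * r)|M. norm (g y))"
    by simp
  then show ?thesis
    unfolding w(2) using bump_mass_pos[OF assms(1)] by (simp add: divide_right_mono)
qed

definition tilt :: "'a \<Rightarrow> 'a \<Rightarrow> real" where
  "tilt e y = norm (g y - norm (g y) *\<^sub>R e)"

lemma tilt_measurable [measurable]: "tilt e \<in> borel_measurable borel"
  unfolding tilt_def by measurable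

lemma tilt_le: "norm e = 1 \<Longrightarrow> tilt e y \<le> 2 * C"
  unfolding tilt_def using norm_triangle_ineq4[of "g y" "norm (g y) *\<^sub>R e"] g_le[of y] by simp

lemma tilt_nonneg: "0 \<le> tilt e y"
  by (simp add: tilt_def)

text \<open>Comparing \<open>g y\<close> with its own length times \<open>e\<close> splits every
  component into a part of known sign and an error, without dividing by a possibly vanishing
  \<open>norm (g y)\<close>.\<close>

lemma inner_tilt: "\<bar>g y \<bullet> h - norm (g y) * (e \<bullet> h)\<bar> \<le> tilt e y * norm h"
  using Cauchy_Schwarz_ineq2[of "g y - norm (g y) *\<^sub>R e" h]
  by (simp add: tilt_def inner_diff_left)

text \<open>The main term \<open>norm (g y) * (e \<bullet> h)\<close> has a favourable sign, so only
  the tilt contributes to an increase. Displacements orthogonal to \<open>e\<close> qualify in both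
  directions, which is the near constancy in those directions.\<close>

lemma smooth_ind_almost_mono:
  assumes e: "norm e = 1" and s: "s > 0" "s \<le> r" and z: "z \<in> ball x r" "z' \<in> ball x r"
    and up: "0 \<le> (z' - z) \<bullet> e"
  shows "smooth_ind s z' \<le> smooth_ind s z + 2 * r / bump_mass s * (LINT y:ball x (2 * r)|M. tilt e y)"
proof -
  obtain w where w: "w \<in> closed_segment z z'"
    "smooth_ind s z' - smooth_ind s z = - (LINT y|M. bump s (y - w) * (g y \<bullet> (z' - z))) / bump_mass s"
    using smooth_ind_diff[OF s(1)] by blast
  have "w \<in> ball x r" using w(1) z closed_segment_subset[OF _ _ convex_ball] by blast
  then have sub: "ball w s \<subseteq> ball x (2 * r)"
    using s(2) by (auto simp: subset_iff) (smt (verit) dist_triangle)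
  have zz: "norm (z' - z) \<le> 2 * r"
    using dist_triangle[of z' z x] z by (simp add: dist_norm norm_minus_commute)
  have r0: "0 < r" using s by linarith
  have "(LINT y|M. - (bump s (y - w) * (g y \<bullet> (z' - z)))) \<le> (LINT y|M. 2 * r * (bump s (y - w) * tilt e y))"
  proof (rule integral_mono)
    have "\<bar>g y \<bullet> (z' - z)\<bar> \<le> C * norm (z' - z)" for y
      by (rule order_trans[OF Cauchy_Schwarz_ineq2]) (intro mult_right_mono g_le norm_ge_zero)
    then show "integrable M (\<lambda>y. - (bump s (y - w) * (g y \<bullet> (z' - z))))"
      using s by (intro Bochner_Integration.integrable_minus bump_integrable_M) auto
    show "integrable M (\<lambda>y. 2 * r * (bump s (y - w) * tilt e y))"
      using tilt_le[OF e] tilt_nonneg[of e] s by (intro integrable_mult_right bump_integrable_M) auto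
    fix y
    have "- (g y \<bullet> (z' - z)) \<le> tilt e y * norm (z' - z)"
      using inner_tilt[of y "z' - z" e] mult_nonneg_nonneg[OF norm_ge_zero up, of "g y"]
      by (simp add: inner_commute abs_le_iff)
    also have "\<dots> \<le> tilt e y * (2 * r)" by (intro mult_left_mono zz tilt_nonneg)
    finally have "- (g y \<bullet> (z' - z)) \<le> tilt e y * (2 * r)" .
    from mult_left_mono[OF this bump_nonneg[of s "y - w"]]
    show "- (bump s (y - w) * (g y \<bullet> (z' - z))) \<le> 2 * r * (bump s (y - w) * tilt e y)"
      by (simp add: mult_ac)
  qed
  also have "\<dots> = 2 * r * (LINT y|M. bump s (y - w) * tilt e y)" by simp
  also have "\<dots> \<le> 2 * r * (LINT y:ball x (2 * r)|M. tilt e y)"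
    using r0 bump_integral_upper[OF s(1) sub _ _ tilt_measurable tilt_nonneg tilt_le[OF e]]
    by (intro mult_left_mono) auto
  finally have "- (LINT y|M. bump s (y - w) * (g y \<bullet> (z' - z))) \<le> 2 * r * (LINT y:ball x (2 * r)|M. tilt e y)"
    by simp
  from divide_right_mono[OF this, of "bump_mass s"] show ?thesis
    using w(2) bump_mass_pos[OF s(1)] by simp
qed

text \<open>The segment has length \<open>s / 2\<close>, whence the factor in front. Its points are
  within \<open>s / 4\<close> of \<open>x\<close>, so \<open>ball x (s / 4)\<close> lies in the
  half-radius ball of the bump, where the bump is at least \<open>1 / 2\<close>.\<close>

lemma smooth_ind_drop:
  assumes e: "norm e = 1" and s: "s > 0" "s \<le> r"
  shows "s / (2 * bump_mass s) * ((LINT y:ball x (s / 4)|M. norm (g y)) / 2 - (LINT y:ball x (2 * r)|M. tilt e y))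
    \<le> smooth_ind s (x - (s / 4) *\<^sub>R e) - smooth_ind s (x + (s / 4) *\<^sub>R e)"
proof -
  let ?z = "x - (s / 4) *\<^sub>R e" and ?z' = "x + (s / 4) *\<^sub>R e"
  have zz: "?z' - ?z = (s / 2) *\<^sub>R e" by (simp flip: scaleR_add_left)
  obtain w where w: "w \<in> closed_segment ?z ?z'"
    "smooth_ind s ?z' - smooth_ind s ?z = - (LINT y|M. bump s (y - w) * (g y \<bullet> (?z' - ?z))) / bump_mass s"
    using smooth_ind_diff[OF s(1)] by blast
  have "?z \<in> cball x (s / 4)" "?z' \<in> cball x (s / 4)" using e s by (auto simp: dist_norm)
  then have wx: "w \<in> cball x (s / 4)" using w(1) closed_segment_subset[OF _ _ convex_cball] by blast
  then have sub: "ball w s \<subseteq> ball x (2 * r)" "ball x (s / 4) \<subseteq> ball w (s / 2)"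
    using s by (auto simp: subset_iff) (smt (verit) dist_triangle dist_commute)+
  have gm: "(\<lambda>y. norm (g y)) \<in> borel_measurable borel" by measurable
  have "(LINT y:ball x (s / 4)|M. norm (g y)) / 2 - (LINT y:ball x (2 * r)|M. tilt e y)
     \<le> (LINT y|M. bump s (y - w) * norm (g y)) - (LINT y|M. bump s (y - w) * tilt e y)"
    using bump_integral_lower[OF s(1) sub(2) _ gm norm_ge_zero g_le]
      bump_integral_upper[OF s(1) sub(1) _ _ tilt_measurable tilt_nonneg tilt_le[OF e]] by fastforce
  also have "\<dots> = (LINT y|M. bump s (y - w) * norm (g y) - bump s (y - w) * tilt e y)"
    using g_le tilt_le[OF e] tilt_nonneg[of e] s
    by (intro Bochner_Integration.integral_diff[symmetric] bump_integrable_M) auto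
  also have "\<dots> \<le> (LINT y|M. bump s (y - w) * (g y \<bullet> e))"
  proof (rule integral_mono)
    show "integrable M (\<lambda>y. bump s (y - w) * norm (g y) - bump s (y - w) * tilt e y)"
      using g_le tilt_le[OF e] tilt_nonneg[of e] s
      by (intro Bochner_Integration.integrable_diff bump_integrable_M) auto
    have "\<bar>g y \<bullet> e\<bar> \<le> C" for y
      using order_trans[OF Cauchy_Schwarz_ineq2[of "g y" e]] g_le[of y] e by simp
    then show "integrable M (\<lambda>y. bump s (y - w) * (g y \<bullet> e))"
      using s by (intro bump_integrable_M) auto
    fix y
    have "norm (g y) - tilt e y \<le> g y \<bullet> e"
      using inner_tilt[of y e e] e by (simp add: dot_square_norm abs_le_iff)
    from mult_left_mono[OF this bump_nonneg[of s "y - w"]]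
    show "bump s (y - w) * norm (g y) - bump s (y - w) * tilt e y \<le> bump s (y - w) * (g y \<bullet> e)"
      by (simp add: algebra_simps)
  qed
  finally have "s / (2 * bump_mass s) * ((LINT y:ball x (s / 4)|M. norm (g y)) / 2 - (LINT y:ball x (2 * r)|M. tilt e y))
    \<le> s / (2 * bump_mass s) * (LINT y|M. bump s (y - w) * (g y \<bullet> e))"
    using s bump_mass_pos[OF s(1)] by (intro mult_left_mono) auto
  also have "\<dots> = smooth_ind s ?z - smooth_ind s ?z'"
  proof -
    have "(LINT y|M. bump s (y - w) * (g y \<bullet> (?z' - ?z))) = s / 2 * (LINT y|M. bump s (y - w) * (g y \<bullet> e))"
      unfolding zz by (simp add: mult.left_commute flip: integral_mult_right_zero)
    then show ?thesis using w(2) bump_mass_pos[OF s(1)] by (simp add: field_simps)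
  qed
  finally show ?thesis .
qed

text \<open>By \<open>small\<close>, the drop across \<open>x\<close> exceeds the possible increase
  caused by the tilt. A point outside \<Omega> below \<open>x\<close> and off \<open>nbhd s\<close>
  has smoothed value 0, so the value at \<open>?m\<close> is at most that increase, which leaves no
  room for the drop down to \<open>?p\<close>. For a point of \<Omega> above \<open>x\<close> the
  value 1 gives the same contradiction.\<close>

lemma separation:
  assumes e: "norm e = 1" and s: "s > 0" "s \<le> r"
    and beta: "(LINT y:ball x (2 * r)|M. tilt e y) \<le> \<beta>"
    and gamma: "\<gamma> \<le> (LINT y:ball x (s / 4)|M. norm (g y))"
    and small: "12 * r * \<beta> < s * \<gamma>"
    and z: "z \<in> ball x r" "z \<notin> nbhd s"
  shows "(z - x) \<bullet> e \<le> - (s / 4) \<Longrightarrow> z \<in> \<Omega>" and "s / 4 \<le> (z - x) \<bullet> e \<Longrightarrow> z \<notin> \<Omega>"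
proof -
  let ?m = "x - (s / 4) *\<^sub>R e" and ?p = "x + (s / 4) *\<^sub>R e"
  let ?b = "LINT y:ball x (2 * r)|M. tilt e y" and ?c = "LINT y:ball x (s / 4)|M. norm (g y)"
  have I: "bump_mass s > 0" by (rule bump_mass_pos[OF s(1)])
  have r0: "0 < r" using s by linarith
  have b0: "0 \<le> ?b" unfolding set_lebesgue_integral_def by (intro integral_nonneg_AE) (auto simp: tilt_nonneg)
  have "12 * r * ?b \<le> 12 * r * \<beta>" using beta r0 by (intro mult_left_mono) auto
  also have "\<dots> < s * \<gamma>" by (rule small)
  also have "\<dots> \<le> s * ?c" using gamma s by (intro mult_left_mono) auto
  finally have "12 * r * ?b < s * ?c" .
  moreover have "s * ?b \<le> r * ?b" using b0 s(2) by (intro mult_right_mono) auto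
  moreover have "0 \<le> r * ?b" using r0 b0 by simp
  moreover have "12 * r * ?b = 12 * (r * ?b)" "2 * r * ?b = 2 * (r * ?b)" by simp_all
  moreover have "s / 2 * (?c / 2 - ?b) = s * ?c / 4 - s * ?b / 2" by (simp add: field_simps)
  \<comment> \<open>As \<open>s * ?b \<le> r * ?b\<close>, this holds once
    \<open>10 * r * ?b < s * ?c\<close>; the constant 12 leaves a margin.\<close>
  ultimately have "2 * r * ?b < s / 2 * (?c / 2 - ?b)" by linarith
  then have "2 * r / bump_mass s * ?b < s / (2 * bump_mass s) * (?c / 2 - ?b)"
    using I by (simp add: divide_simps mult.commute)
  also have "\<dots> \<le> smooth_ind s ?m - smooth_ind s ?p" by (rule smooth_ind_drop[OF e s])
  finally have drop: "2 * r / bump_mass s * ?b < smooth_ind s ?m - smooth_ind s ?p" .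
  have mp: "?m \<in> ball x r" "?p \<in> ball x r" using e s by (auto simp: dist_norm)
  have ee: "e \<bullet> e = 1" using e by (simp add: dot_square_norm)
  show "z \<in> \<Omega>" if "(z - x) \<bullet> e \<le> - (s / 4)"
  proof (rule ccontr)
    assume "z \<notin> \<Omega>"
    then have "smooth_ind s z = 0" using smooth_ind_far[OF s(1) z(2)] by simp
    moreover have "smooth_ind s ?m \<le> smooth_ind s z + 2 * r / bump_mass s * ?b"
      by (rule smooth_ind_almost_mono[OF e s z(1) mp(1)]) (use that ee in \<open>simp add: inner_diff_left\<close>)
    ultimately show False using drop smooth_ind_range(1)[OF s(1), of ?p] by linarith
  qed
  show "z \<notin> \<Omega>" if "s / 4 \<le> (z - x) \<bullet> e"
  proof
    assume "z \<in> \<Omega>"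
    then have "smooth_ind s z = 1" using smooth_ind_far[OF s(1) z(2)] by simp
    moreover have "smooth_ind s z \<le> smooth_ind s ?p + 2 * r / bump_mass s * ?b"
      by (rule smooth_ind_almost_mono[OF e s mp(2) z(1)]) (use that ee in \<open>simp add: inner_diff_left inner_add_left\<close>)
    ultimately show False using drop smooth_ind_range(2)[OF s(1), of ?m] by linarith
  qed
qed

end

section \<open>Lower bound for the perimeter density\<close>

text \<open>Finitely many halvings lead from \<open>r0\<close> to any smaller radius. Needed because
  volume fractions can be compared only between radii whose ratio is bounded.\<close>

lemma dyadic_descent:
  fixes P :: "real \<Rightarrow> bool"
  assumes P: "P r0" "r0 > 0"
    and step: "\<And>r r'. P r \<Longrightarrow> 0 < r' \<Longrightarrow> r' \<le> r \<Longrightarrow> r \<le> 2 * r' \<Longrightarrow> r \<le> r0 \<Longrightarrow> P r'"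
    and r: "0 < r" "r \<le> r0"
  shows "P r"
proof -
  have "P r" if "r0 / 2 ^ k \<le> r" "r \<le> r0" for k r
    using that
  proof (induction k arbitrary: r)
    case 0
    then show ?case using P by simp
  next
    case (Suc k)
    have r0: "0 < r" using Suc.prems(1) P(2) by (metis divide_pos_pos less_le_trans zero_less_numeral zero_less_power)
    show ?case
    proof (cases "r0 / 2 ^ k \<le> r")
      case False
      define r'' where "r'' = min (2 * r) r0"
      have "r0 / 2 ^ k \<le> 2 * r" using Suc.prems(1) by (simp add: field_simps)
      moreover have "r0 / 2 ^ k \<le> r0" using P(2) by (simp add: divide_le_eq_1 field_simps)
      ultimately have "P r''" by (intro Suc.IH) (auto simp: r''_def)
      then show ?thesis by (rule step) (use r0 Suc.prems in \<open>auto simp: r''_def\<close>)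
    qed (use Suc in auto)
  qed
  moreover obtain k where "r0 / 2 ^ k \<le> r"
  proof -
    obtain k where "r0 / r < 2 ^ k" using real_arch_pow[of 2 "r0 / r"] by auto
    then show thesis using r that[of k] by (simp add: field_simps)
  qed
  ultimately show ?thesis using r by blast
qed

context flux_domain begin

text \<open>At distance \<open>s \<le> porosity * r\<close> the neighbourhood of \<open>F\<close> fills at most half of a ball of radius
  \<open>r\<close>.\<close>

definition porosity :: real where
  "porosity = 1 / (2 * A\<^sup>2 * 2 ^ DIM('a) * 6 ^ (DIM('a) - 1))"

lemma porosity: "0 < porosity" "porosity \<le> 1"
proof -
  have "1 \<le> A\<^sup>2" using A by (simp add: one_le_power)
  moreover have "(1::real) \<le> 2 ^ DIM('a)" "(1::real) \<le> 6 ^ (DIM('a) - 1)" by simp_all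
  ultimately have "1 * 1 * 1 \<le> A\<^sup>2 * 2 ^ DIM('a) * 6 ^ (DIM('a) - 1)"
    by (intro mult_mono) auto
  then show "0 < porosity" "porosity \<le> 1" unfolding porosity_def by (auto simp: divide_le_eq_1 intro!: divide_pos_pos)
qed

definition vol1 :: real where
  "vol1 = measure lborel (ball (0::'a) 1)"

lemma vol1_pos: "0 < vol1"
  unfolding vol1_def by (rule content_ball_pos) simp

text \<open>\<open>nbhd_volume\<close> relative to the volume of the ball: the value of
  \<open>porosity\<close> is read off from the constants there, with the factor 2 arranged so that
  \<open>s \<le> porosity * r\<close> means at most one half.\<close>

lemma nbhd_volume_fraction:
  assumes "0 < s" "s \<le> r" "6 * r < R0"
  shows "measure lborel (nbhd s \<inter> ball x r) \<le> s / (2 * porosity * r) * measure lborel (ball x r)"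
proof -
  obtain d where d: "DIM('a) = Suc d" using DIM_positive[where 'a='a] gr0_implies_Suc by blast
  have "measure lborel (ball x r) = r ^ Suc d * vol1"
    using lborel_ball[of r x] assms by (simp add: vol1_def d)
  moreover have "1 / (2 * porosity) = A\<^sup>2 * 2 ^ DIM('a) * 6 ^ (DIM('a) - 1)" by (simp add: porosity_def)
  moreover have "s / (2 * porosity * r) = 1 / (2 * porosity) * (s / r)" by simp
  ultimately have "s / (2 * porosity * r) * measure lborel (ball x r)
      = A\<^sup>2 * 2 ^ DIM('a) * 6 ^ (DIM('a) - 1) * s * (r ^ d * vol1)"
    using assms by simp
  then show ?thesis using nbhd_volume[OF assms, of x] by (simp add: vol1_def d mult_ac)
qed

lemma far_point:
  assumes "0 < \<rho>" "6 * \<rho> < R0" "0 < s" "s \<le> porosity * \<rho>"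
  obtains w where "w \<in> ball p \<rho>" "w \<notin> nbhd s"
proof (rule ccontr)
  assume "\<not> thesis"
  then have "nbhd s \<inter> ball p \<rho> = ball p \<rho>" using that by blast
  moreover have "s \<le> \<rho>" using assms porosity mult_right_mono[of porosity 1 \<rho>] by linarith
  ultimately have "measure lborel (ball p \<rho>) \<le> s / (2 * porosity * \<rho>) * measure lborel (ball p \<rho>)"
    using nbhd_volume_fraction[of s \<rho> p] assms by simp
  also have "s / (2 * porosity * \<rho>) \<le> 1 / 2" using assms porosity by (simp add: field_simps)
  then have "s / (2 * porosity * \<rho>) * measure lborel (ball p \<rho>) \<le> 1 / 2 * measure lborel (ball p \<rho>)"
    by (intro mult_right_mono) auto
  finally show False using content_ball_pos[of \<rho> p] assms by simp
qed

lemma int_norm_g_lower: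
  assumes "0 \<le> c" and AE: "AE y in M. c \<le> norm (g y)"
  shows "c * measure M (ball x r) \<le> (LINT y:ball x r|M. norm (g y))"
proof -
  have "c * measure M (ball x r) = (LINT y:ball x r|M. c)"
    using set_integral_ball_const[of x r c] by simp
  also have "\<dots> \<le> (LINT y:ball x r|M. norm (g y))"
    unfolding set_lebesgue_integral_def
    using AE const_integrable[of x r c] norm_g_integrable[of "ball x r"] unfolding set_integrable_def
    by (intro integral_mono_AE) (auto elim!: eventually_mono simp: indicator_def)
  finally show ?thesis .
qed

text \<open>What remains of
  \<open>bump_mass s \<le> 2 * r * (2 * a * (A * (2 * r) ^ (n - 1)))\<close>, solved for
  \<open>a\<close>, when \<open>n = DIM('a)\<close>, \<open>s = porosity * (r / 4)\<close> and
  \<open>bump_mass_lower\<close> is inserted; the powers of \<open>r\<close> cancel.\<close>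

definition perim_lower :: real where
  "perim_lower = vol1 * (porosity / 8) ^ DIM('a) / (8 * A * 2 ^ (DIM('a) - 1))"

lemma perim_lower_pos: "0 < perim_lower"
  using A porosity vol1_pos by (simp add: perim_lower_def)

lemma lebesgue_pointD:
  assumes "lebesgue_point g x" "\<epsilon> > 0"
  obtains \<delta> where "\<delta> > 0" "\<And>r. 0 < r \<Longrightarrow> r < \<delta> \<Longrightarrow>
     (LINT y:ball x r|M. norm (g y - g x)) \<le> \<epsilon> * measure M (ball x r)"
  using assms(1)[unfolded lebesgue_point_def, rule_format, OF assms(2)] that by auto

text \<open>Near \<open>x\<close> the density is almost \<open>a *\<^sub>R e\<close>, so at a small
  enough scale \<open>separation\<close> puts a point below \<open>x\<close> into \<Omega> and one
  above \<open>x\<close> outside. The smoothed indicator falls from 1 to 0 between them, which by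
  \<open>smooth_ind_lipschitz\<close> requires a definite multiple of \<open>r ^ (n - 1)\<close> of
  perimeter, with \<open>n = DIM('a)\<close>; but only about \<open>a\<close> times the mass of the
  ball is available.\<close>

lemma lower_density:
  assumes x: "x \<in> F" and lp: "lebesgue_point g x" and nz: "g x \<noteq> 0"
  shows "perim_lower \<le> norm (g x)"
proof -
  obtain d where d: "DIM('a) = Suc d" using DIM_positive[where 'a='a] gr0_implies_Suc by blast
  define a where "a = norm (g x)"
  define e where "e = sgn (g x)"
  have a: "a > 0" and e: "norm e = 1" using nz by (auto simp: a_def e_def norm_sgn)
  have gx: "g x = a *\<^sub>R e" by (simp add: a_def e_def norm_scaleR_sgn)
  \<comment> \<open>\<open>q\<close> is the right-hand side of the condition \<open>small\<close>
    below divided by \<open>r ^ Suc d\<close>; the bound on \<epsilon> makes the left-hand side at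
    most half of it. Here \<epsilon> may depend on \<open>a\<close>, as only the radius is
    affected.\<close>
  define q where "q = porosity / 4 * (a / 2) * (porosity / 16) ^ d / A"
  have q: "q > 0" using a porosity A by (simp add: q_def)
  define \<epsilon> where "\<epsilon> = min (a / 2) (q / (48 * A * 2 ^ d))"
  have \<epsilon>: "\<epsilon> > 0" "\<epsilon> \<le> a / 2" "\<epsilon> \<le> q / (48 * A * 2 ^ d)" using a q A by (auto simp: \<epsilon>_def)
  obtain \<delta> where \<delta>: "\<delta> > 0" "\<And>r. 0 < r \<Longrightarrow> r < \<delta> \<Longrightarrow>
     (LINT y:ball x r|M. norm (g y - g x)) \<le> \<epsilon> * measure M (ball x r)"
    using lebesgue_pointD[OF lp \<epsilon>(1)] by metis
  define r where "r = min \<delta> R0 / 8"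
  have r: "0 < r" "2 * r < \<delta>" "6 * r < R0" using \<delta>(1) R0 by (auto simp: r_def)
  define s where "s = porosity * (r / 4)"
  have s: "0 < s" "s \<le> r / 4" using porosity r mult_right_mono[of porosity 1 "r / 4"] by (auto simp: s_def)
  have sr: "s \<le> r" "s / 4 < \<delta>" "s / 4 < R0" using s r R0 by auto
  have m2: "measure M (ball x (2 * r)) \<le> A * (2 * r) ^ d"
    using upper[OF x, of "2 * r"] r by (simp add: d)
  have ms: "(s / 4) ^ d / A \<le> measure M (ball x (s / 4))"
    using lower[OF x, of "s / 4"] s sr A by (simp add: d field_simps)
  have nd: "norm (g y) \<le> norm (g y - g x) + a" "a - norm (g y - g x) \<le> norm (g y)" for y
    using norm_triangle_ineq2[of "g y" "g x"] norm_triangle_ineq3[of "g y" "g x"] by (auto simp: a_def)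
  have I2: "(LINT y:ball x (2 * r)|M. norm (g y)) \<le> 2 * a * (A * (2 * r) ^ d)"
  proof -
    have "(LINT y:ball x (2 * r)|M. norm (g y)) \<le> (LINT y:ball x (2 * r)|M. norm (g y - g x) + a)"
      using nd(1) by (intro set_integral_mono set_integral_add ball_norm_diff_integrable const_integrable norm_g_integrable) auto
    also have "\<dots> = (LINT y:ball x (2 * r)|M. norm (g y - g x)) + measure M (ball x (2 * r)) * a"
      using ball_norm_diff_integrable const_integrable[of x "2 * r" a]
      by (subst set_integral_add) (auto simp: set_integral_ball_const[of _ _ a, simplified])
    also have "\<dots> \<le> \<epsilon> * measure M (ball x (2 * r)) + measure M (ball x (2 * r)) * a"
      using \<delta>(2)[of "2 * r"] r by simp
    also have "\<dots> = (\<epsilon> + a) * measure M (ball x (2 * r))" by (simp add: algebra_simps)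
    also have "\<dots> \<le> 2 * a * (A * (2 * r) ^ d)" using m2 \<epsilon> a by (intro mult_mono) auto
    finally show ?thesis .
  qed
  have beta: "(LINT y:ball x (2 * r)|M. tilt e y) \<le> 2 * \<epsilon> * (A * (2 * r) ^ d)"
  proof -
    \<comment> \<open>Two deviations add up: that of the vector \<open>g y\<close> from
      \<open>g x\<close> and that of its length from \<open>a\<close>.\<close>
    have "tilt e y \<le> 2 * norm (g y - g x)" for y
    proof -
      have "g y - norm (g y) *\<^sub>R e = (g y - g x) + (a - norm (g y)) *\<^sub>R e"
        unfolding gx by (simp add: algebra_simps)
      then have "tilt e y \<le> norm (g y - g x) + norm ((a - norm (g y)) *\<^sub>R e)"
        unfolding tilt_def by (metis norm_triangle_ineq)
      also have "norm ((a - norm (g y)) *\<^sub>R e) \<le> norm (g y - g x)"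
        using nd[of y] e by (simp add: abs_le_iff)
      finally show ?thesis by simp
    qed
    moreover have "set_integrable M (ball x (2 * r)) (tilt e)"
      using tilt_le[OF e] tilt_nonneg by (intro set_integrable_bounded[of _ "2 * C"]) auto
    ultimately have "(LINT y:ball x (2 * r)|M. tilt e y) \<le> (LINT y:ball x (2 * r)|M. 2 * norm (g y - g x))"
      using ball_norm_diff_integrable by (intro set_integral_mono) auto
    also have "\<dots> = 2 * (LINT y:ball x (2 * r)|M. norm (g y - g x))" by simp
    also have "\<dots> \<le> 2 * (\<epsilon> * measure M (ball x (2 * r)))"
      using \<delta>(2)[of "2 * r"] r by simp
    also have "\<dots> \<le> 2 * \<epsilon> * (A * (2 * r) ^ d)" using m2 \<epsilon> by simp
    finally show ?thesis .
  qed
  have gamma: "a / 2 * ((s / 4) ^ d / A) \<le> (LINT y:ball x (s / 4)|M. norm (g y))"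
  proof -
    have "a / 2 * ((s / 4) ^ d / A) \<le> (a - \<epsilon>) * measure M (ball x (s / 4))"
      using ms \<epsilon> a s A by (intro mult_mono) auto
    also have "\<dots> \<le> measure M (ball x (s / 4)) * a - (LINT y:ball x (s / 4)|M. norm (g y - g x))"
      using \<delta>(2)[of "s / 4"] s sr by (simp add: algebra_simps)
    also have "\<dots> = (LINT y:ball x (s / 4)|M. a - norm (g y - g x))"
      using ball_norm_diff_integrable const_integrable[of x "s / 4" a]
      by (subst set_integral_diff) (auto simp: set_integral_ball_const[of _ _ a, simplified])
    also have "\<dots> \<le> (LINT y:ball x (s / 4)|M. norm (g y))"
      using nd(2) by (intro set_integral_mono set_integral_diff ball_norm_diff_integrable const_integrable norm_g_integrable) auto
    finally show ?thesis .
  qed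
  have small: "12 * r * (2 * \<epsilon> * (A * (2 * r) ^ d)) < s * (a / 2 * ((s / 4) ^ d / A))"
  proof -
    have "12 * r * (2 * \<epsilon> * (A * (2 * r) ^ d)) = 24 * A * 2 ^ d * \<epsilon> * r ^ Suc d"
      by (simp add: power_mult_distrib mult_ac)
    also have "\<dots> \<le> 24 * A * 2 ^ d * (q / (48 * A * 2 ^ d)) * r ^ Suc d"
      using \<epsilon> A r by (intro mult_right_mono mult_left_mono) auto
    also have "\<dots> = q / 2 * r ^ Suc d" using A by simp
    also have "\<dots> < q * r ^ Suc d" using q r by simp
    also have "\<dots> = s * (a / 2 * ((s / 4) ^ d / A))"
    proof -
      have "s / 4 = porosity / 16 * r" by (simp add: s_def)
      then have "(s / 4) ^ d = (porosity / 16) ^ d * r ^ d" by (simp only: power_mult_distrib)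
      then show ?thesis by (simp add: q_def s_def mult_ac)
    qed
    finally show ?thesis .
  qed
  note sep = separation[OF e s(1) sr(1) beta gamma small]
  have ee: "e \<bullet> e = 1" using e by (simp add: dot_square_norm)
  have r4: "0 < r / 4" "6 * (r / 4) < R0" "s \<le> porosity * (r / 4)" using r R0 by (auto simp: s_def)
  have ball_height: "\<bar>(w - p) \<bullet> e\<bar> < \<rho>" if "w \<in> ball p \<rho>" for w p \<rho>
    using Cauchy_Schwarz_ineq2[of "w - p" e] that e by (simp add: dist_norm norm_minus_commute)
  \<comment> \<open>Centres at height \<open>r / 2\<close> below and above \<open>x\<close> with
    radius \<open>r / 4\<close> keep the points inside \<open>ball x r\<close> and beyond the height
    \<open>s / 4\<close> that \<open>separation\<close> asks for.\<close>
  obtain z1 where z1: "z1 \<in> ball (x - (r / 2) *\<^sub>R e) (r / 4)" "z1 \<notin> nbhd s"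
    using far_point[OF r4(1,2) s(1) r4(3)] by blast
  obtain z2 where z2: "z2 \<in> ball (x + (r / 2) *\<^sub>R e) (r / 4)" "z2 \<notin> nbhd s"
    using far_point[OF r4(1,2) s(1) r4(3)] by blast
  have z1r: "z1 \<in> ball x r" and z2r: "z2 \<in> ball x r"
    using z1(1) z2(1) r e dist_triangle[of x z1 "x - (r / 2) *\<^sub>R e"] dist_triangle[of x z2 "x + (r / 2) *\<^sub>R e"]
    by (auto simp: dist_norm)
  have "(z1 - x) \<bullet> e \<le> - (s / 4)"
    using ball_height[OF z1(1)] s r
    unfolding abs_less_iff inner_diff_left inner_scaleR_left ee mult_1_right by linarith
  then have "z1 \<in> \<Omega>" by (rule sep(1)[OF z1r z1(2)])
  moreover have "s / 4 \<le> (z2 - x) \<bullet> e"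
    using ball_height[OF z2(1)] s r
    unfolding abs_less_iff inner_diff_left inner_add_left inner_scaleR_left ee mult_1_right by linarith
  then have "z2 \<notin> \<Omega>" by (rule sep(2)[OF z2r z2(2)])
  ultimately have "1 \<le> 2 * r / bump_mass s * (LINT y:ball x (2 * r)|M. norm (g y))"
    using smooth_ind_lipschitz[OF s(1) sr(1) z1r z2r] smooth_ind_far[OF s(1)] z1(2) z2(2) by simp
  also have "\<dots> \<le> 2 * r / bump_mass s * (2 * a * (A * (2 * r) ^ d))"
    using I2 r bump_mass_pos[OF s(1)] by (intro mult_left_mono) auto
  finally have "bump_mass s \<le> 2 * r * (2 * a * (A * (2 * r) ^ d))"
    using bump_mass_pos[OF s(1)] by (simp add: field_simps)
  also have "\<dots> = 4 * a * A * 2 ^ d * r ^ Suc d" by (simp add: power_mult_distrib mult_ac)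
  finally have "vol1 * (s / 2) ^ Suc d / 2 \<le> 4 * a * A * 2 ^ d * r ^ Suc d"
    using bump_mass_lower[OF s(1)] by (simp add: vol1_def d)
  moreover have "s / 2 = porosity / 8 * r" by (simp add: s_def)
  then have "(s / 2) ^ Suc d = (porosity / 8) ^ Suc d * r ^ Suc d" by (simp only: power_mult_distrib)
  ultimately have "vol1 * (porosity / 8) ^ Suc d / 2 * r ^ Suc d \<le> 4 * a * A * 2 ^ d * r ^ Suc d"
    by (simp only: mult.assoc times_divide_eq_left times_divide_eq_right mult.commute mult.left_commute)
  then have "vol1 * (porosity / 8) ^ Suc d / 2 \<le> 4 * a * A * 2 ^ d"
    by (rule mult_right_le_imp_le) (use r in simp)
  then show ?thesis using A unfolding perim_lower_def a_def[symmetric] d by (simp add: field_simps)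
qed

text \<open>With \<open>g x = 0\<close> there is so little perimeter that the smoothed indicator
  varies by less than 1 on \<open>ball x r\<close>, and it cannot take both values 0 and 1 there.
  Off \<open>nbhd s\<close> the ball is thus entirely inside or entirely outside \<Omega>, and
  \<open>nbhd s\<close> has small volume.\<close>

lemma density_dichotomy:
  assumes x: "x \<in> F" and lp: "lebesgue_point g x" and z: "g x = 0" and "\<epsilon> > 0"
  obtains \<delta> where "\<delta> > 0" "\<And>r. 0 < r \<Longrightarrow> r < \<delta> \<Longrightarrow>
    measure lborel (\<Omega> \<inter> ball x r) \<le> \<epsilon> * measure lborel (ball x r) \<or>
    measure lborel (ball x r - \<Omega>) \<le> \<epsilon> * measure lborel (ball x r)"
proof -
  obtain d where d: "DIM('a) = Suc d" using DIM_positive[where 'a='a] gr0_implies_Suc by blast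
  \<comment> \<open>The ratio of \<open>s\<close> to \<open>r\<close>: the second entry keeps the
    volume fraction of \<open>nbhd s\<close> below \<epsilon>, the first keeps
    \<open>s \<le> r\<close>. Then \<open>\<epsilon>1\<close> is chosen so that the variation, of
    order \<open>\<epsilon>1 * r ^ Suc d / bump_mass s\<close>, stays below 1.\<close>
  define \<eta> where "\<eta> = min 1 (2 * porosity * \<epsilon>)"
  have \<eta>: "0 < \<eta>" "\<eta> \<le> 1" "\<eta> \<le> 2 * porosity * \<epsilon>" using porosity \<open>\<epsilon> > 0\<close> by (auto simp: \<eta>_def)
  define \<epsilon>1 where "\<epsilon>1 = vol1 * (\<eta> / 2) ^ Suc d / (16 * A * 2 ^ d)"
  have "\<epsilon>1 > 0" using vol1_pos \<eta> A by (simp add: \<epsilon>1_def)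
  then obtain \<delta> where \<delta>: "\<delta> > 0" "\<And>r. 0 < r \<Longrightarrow> r < \<delta> \<Longrightarrow>
     (LINT y:ball x r|M. norm (g y - g x)) \<le> \<epsilon>1 * measure M (ball x r)"
    using lebesgue_pointD[OF lp] by metis
  have "measure lborel (\<Omega> \<inter> ball x r) \<le> \<epsilon> * measure lborel (ball x r) \<or>
    measure lborel (ball x r - \<Omega>) \<le> \<epsilon> * measure lborel (ball x r)"
    if r: "0 < r" "r < min \<delta> R0 / 8" for r
  proof -
    have r': "2 * r < \<delta>" "2 * r < R0" "6 * r < R0" using r by auto
    define s where "s = \<eta> * r"
    have s: "0 < s" "s \<le> r" using \<eta> r mult_right_mono[of \<eta> 1 r] by (auto simp: s_def)
    have "(LINT y:ball x (2 * r)|M. norm (g y)) \<le> \<epsilon>1 * measure M (ball x (2 * r))"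
      using \<delta>(2)[of "2 * r"] r r' z by simp
    also have "\<dots> \<le> \<epsilon>1 * (A * (2 * r) ^ d)"
      using upper[OF x, of "2 * r"] r r' \<open>\<epsilon>1 > 0\<close> by (intro mult_left_mono) (auto simp: d)
    finally have I: "(LINT y:ball x (2 * r)|M. norm (g y)) \<le> \<epsilon>1 * (A * (2 * r) ^ d)" .
    have "4 * (r * (\<epsilon>1 * (A * (2 * r) ^ d))) = vol1 * (s / 2) ^ Suc d / 4"
    proof -
      have "s / 2 = \<eta> / 2 * r" by (simp add: s_def)
      then have "(s / 2) ^ Suc d = (\<eta> / 2) ^ Suc d * r ^ Suc d" by (simp only: power_mult_distrib)
      then show ?thesis using A by (simp add: \<epsilon>1_def power_mult_distrib field_simps)
    qed
    also have "\<dots> < bump_mass s"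
    proof -
      have "0 < vol1 * (s / 2) ^ Suc d" using vol1_pos s by simp
      then show ?thesis using bump_mass_lower[OF s(1)] by (simp add: vol1_def d)
    qed
    finally have "2 * r / bump_mass s * (\<epsilon>1 * (A * (2 * r) ^ d)) < 1"
      using bump_mass_pos[OF s(1)] mult_pos_pos[OF r(1), of "\<epsilon>1 * (A * (2 * r) ^ d)"] \<open>\<epsilon>1 > 0\<close> A r(1) by (simp add: divide_less_eq)
    moreover have "2 * r / bump_mass s * (LINT y:ball x (2 * r)|M. norm (g y)) \<le> 2 * r / bump_mass s * (\<epsilon>1 * (A * (2 * r) ^ d))"
      using I r bump_mass_pos[OF s(1)] by (intro mult_left_mono) auto
    ultimately have lt1: "2 * r / bump_mass s * (LINT y:ball x (2 * r)|M. norm (g y)) < 1" by linarith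
    have same: "z' \<in> \<Omega>" if "z \<in> ball x r" "z' \<in> ball x r" "z \<notin> nbhd s" "z' \<notin> nbhd s" "z \<in> \<Omega>" for z z'
      using smooth_ind_lipschitz[OF s that(1,2)] smooth_ind_far[OF s(1)] that lt1 by (auto split: if_splits)
    have nb: "measure lborel (nbhd s \<inter> ball x r) \<le> \<epsilon> * measure lborel (ball x r)"
    proof -
      have "s / (2 * porosity * r) \<le> \<epsilon>" using \<eta> porosity r by (simp add: s_def field_simps)
      then have "s / (2 * porosity * r) * measure lborel (ball x r) \<le> \<epsilon> * measure lborel (ball x r)"
        by (intro mult_right_mono) auto
      then show ?thesis using nbhd_volume_fraction[OF s r'(3), of x] by linarith
    qed
    have mono: "measure lborel D \<le> \<epsilon> * measure lborel (ball x r)" if "D \<subseteq> nbhd s \<inter> ball x r" "D \<in> sets borel" for D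
      using lb.measure_mono_bounded[OF that(1) _ that(2)] nb by (fastforce intro: order_trans bounded_Int)
    show ?thesis
    proof (cases "\<exists>z. z \<in> ball x r \<and> z \<notin> nbhd s \<and> z \<in> \<Omega>")
      case True
      then have "ball x r - \<Omega> \<subseteq> nbhd s \<inter> ball x r" using same by blast
      then show ?thesis using mono[of "ball x r - \<Omega>"] by auto
    next
      case False
      then have "\<Omega> \<inter> ball x r \<subseteq> nbhd s \<inter> ball x r" by blast
      then show ?thesis using mono[of "\<Omega> \<inter> ball x r"] by auto
    qed
  qed
  then show thesis using that[of "min \<delta> R0 / 8"] \<delta>(1) R0 by auto
qed

lemma density_eq:
  "measure lebesgue (\<Omega> \<inter> ball x r) / measure lebesgue (ball x r)
    = measure lborel (\<Omega> \<inter> ball x r) / measure lborel (ball x r)"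
  by simp

lemma ball_split: "measure lborel (\<Omega> \<inter> ball x r) + measure lborel (ball x r - \<Omega>) = measure lborel (ball x r)"
proof -
  have "bounded (\<Omega> \<inter> ball x r)" "bounded (ball x r - \<Omega>)"
    by (rule bounded_subset[OF bounded_ball[of x r]], blast)+
  then have "measure lborel ((\<Omega> \<inter> ball x r) \<union> (ball x r - \<Omega>)) = measure lborel (\<Omega> \<inter> ball x r) + measure lborel (ball x r - \<Omega>)"
    using lb.finite_bounded[of "\<Omega> \<inter> ball x r"] lb.finite_bounded[of "ball x r - \<Omega>"]
    by (intro measure_Union) auto
  moreover have "(\<Omega> \<inter> ball x r) \<union> (ball x r - \<Omega>) = ball x r" by blast
  ultimately show ?thesis by simp
qed

text \<open>At every small scale the density is close to \<open>0\<close> or to \<open>1\<close>; halving the radius multiplies it, and its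
  complement, by at most \<open>2 ^ n\<close>, so that it cannot pass from one alternative to the other.\<close>

lemma density_zero_or_one:
  assumes x: "x \<in> F" and lp: "lebesgue_point g x" and z: "g x = 0"
  shows "has_density_at \<Omega> x 0 \<or> has_density_at \<Omega> x 1"
proof -
  define n where "n = DIM('a)"
  define m where "m D r = measure lborel (D \<inter> ball x r)" for D r
  define b where "b r = measure lborel (ball x r)" for r
  have b: "b r > 0" if "r > 0" for r unfolding b_def by (rule content_ball_pos[OF that])
  have m0: "0 \<le> m D r" for D r by (simp add: m_def)
  have split: "m \<Omega> r + m (- \<Omega>) r = b r" for r
  proof -
    have "- \<Omega> \<inter> ball x r = ball x r - \<Omega>" by blast
    then show ?thesis using ball_split[of x r] by (simp add: m_def b_def)
  qed
  have dich: "\<exists>\<delta>>0. \<forall>r. 0 < r \<and> r < \<delta> \<longrightarrow> m \<Omega> r \<le> \<epsilon> * b r \<or> m (- \<Omega>) r \<le> \<epsilon> * b r" if "\<epsilon> > 0" for \<epsilon>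
  proof -
    have "- \<Omega> \<inter> ball x r = ball x r - \<Omega>" for r by blast
    then show ?thesis using density_dichotomy[OF x lp z that] unfolding m_def b_def by metis
  qed
  \<comment> \<open>Halving the radius turns the fraction \<open>\<epsilon>0\<close> into at most
    \<open>1 / 4\<close>; the complement then fills at least \<open>3 / 4\<close>, so the other
    alternative is impossible at the new radius.\<close>
  define \<epsilon>0 :: real where "\<epsilon>0 = 1 / (4 * 2 ^ n)"
  have \<epsilon>0: "0 < \<epsilon>0" "\<epsilon>0 \<le> 1 / 4" by (auto simp: \<epsilon>0_def field_simps)
  obtain \<delta>0 where \<delta>0: "\<delta>0 > 0" "\<And>r. 0 < r \<Longrightarrow> r < \<delta>0 \<Longrightarrow> m \<Omega> r \<le> \<epsilon>0 * b r \<or> m (- \<Omega>) r \<le> \<epsilon>0 * b r"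
    using dich[OF \<epsilon>0(1)] by blast
  have descend: "m D r \<le> \<epsilon>0 * b r"
    if D: "D \<in> sets borel" "D = \<Omega> \<or> D = - \<Omega>" and start: "m D (\<delta>0 / 2) \<le> \<epsilon>0 * b (\<delta>0 / 2)"
      and r: "0 < r" "r \<le> \<delta>0 / 2" for D r
  proof (rule dyadic_descent[where P="\<lambda>r. m D r \<le> \<epsilon>0 * b r", OF start _ _ r])
    show "0 < \<delta>0 / 2" using \<delta>0 by simp
    fix r r' assume *: "m D r \<le> \<epsilon>0 * b r" "0 < r'" "r' \<le> r" "r \<le> 2 * r'" "r \<le> \<delta>0 / 2"
    have "m D r' \<le> m D r"
      unfolding m_def using *(3) D(1)
      by (intro lb.measure_mono_bounded) (auto intro: bounded_subset[OF bounded_ball])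
    also have "\<dots> \<le> \<epsilon>0 * b (2 * r')"
    proof -
      have "b r \<le> b (2 * r')" unfolding b_def using *(4)
        by (intro lb.measure_mono_bounded) auto
      then show ?thesis using *(1) \<epsilon>0(1) mult_left_mono[of "b r" "b (2 * r')" \<epsilon>0] by linarith
    qed
    also have "\<dots> = 1 / 4 * b r'"
      using lborel_ball[of "2 * r'" x] lborel_ball[of r' x] *(2) by (simp add: b_def \<epsilon>0_def n_def power_mult_distrib)
    finally have le: "m D r' \<le> 1 / 4 * b r'" .
    have "\<not> m (- D) r' \<le> \<epsilon>0 * b r'"
    proof
      assume "m (- D) r' \<le> \<epsilon>0 * b r'"
      also have "\<dots> \<le> 1 / 4 * b r'" using \<epsilon>0 b[OF *(2)] by (intro mult_right_mono) auto
      finally have "m D r' + m (- D) r' \<le> 1 / 2 * b r'" using le by simp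
      moreover have "m D r' + m (- D) r' = b r'" using split[of r'] D(2) by (auto simp: add.commute)
      ultimately show False using b[OF *(2)] by simp
    qed
    then show "m D r' \<le> \<epsilon>0 * b r'" using \<delta>0(2)[of r'] * \<delta>0(1) D(2) by auto
  qed
  \<comment> \<open>The fixed threshold \<open>\<epsilon>0\<close> decides once and for all which of
    the two sets is the thin one; \<open>dich\<close> with smaller thresholds then makes its
    fraction arbitrarily small.\<close>
  have lim: "((\<lambda>r. m D r / b r) \<longlongrightarrow> 0) (at_right 0)"
    if D: "D \<in> sets borel" "D = \<Omega> \<or> D = - \<Omega>" and start: "m D (\<delta>0 / 2) \<le> \<epsilon>0 * b (\<delta>0 / 2)" for D
  proof (rule tendstoI)
    fix \<epsilon> :: real assume "\<epsilon> > 0"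
    define \<epsilon>' where "\<epsilon>' = min (\<epsilon> / 2) (1 / 4)"
    have \<epsilon>': "0 < \<epsilon>'" "\<epsilon>' < \<epsilon>" "\<epsilon>' \<le> 1 / 4" using \<open>\<epsilon> > 0\<close> by (auto simp: \<epsilon>'_def)
    obtain \<delta> where \<delta>: "\<delta> > 0" "\<And>r. 0 < r \<Longrightarrow> r < \<delta> \<Longrightarrow> m \<Omega> r \<le> \<epsilon>' * b r \<or> m (- \<Omega>) r \<le> \<epsilon>' * b r"
      using dich[OF \<epsilon>'(1)] by blast
    have "dist (m D r / b r) 0 < \<epsilon>" if r: "0 < r" "r < min \<delta> (\<delta>0 / 2)" for r
    proof -
      have br: "0 < b r" by (rule b[OF r(1)])
      have "m D r \<le> \<epsilon>0 * b r" using descend[OF D start] r by auto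
      also have "\<dots> \<le> 1 / 4 * b r" using \<epsilon>0 br by (intro mult_right_mono) auto
      finally have le: "m D r \<le> 1 / 4 * b r" .
      have "\<not> m (- D) r \<le> \<epsilon>' * b r"
      proof
        assume "m (- D) r \<le> \<epsilon>' * b r"
        also have "\<dots> \<le> 1 / 4 * b r" using \<epsilon>' br by (intro mult_right_mono) auto
        finally have "m D r + m (- D) r \<le> 1 / 2 * b r" using le by simp
        moreover have "m D r + m (- D) r = b r" using split[of r] D(2) by (auto simp: add.commute)
        ultimately show False using br by simp
      qed
      then have "m D r \<le> \<epsilon>' * b r" using \<delta>(2)[of r] r D(2) by auto
      also have "\<dots> < \<epsilon> * b r" using \<epsilon>' br by simp
      finally show ?thesis using br m0[of D r] by (simp add: divide_less_eq)
    qed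
    then show "\<forall>\<^sub>F r in at_right 0. dist (m D r / b r) 0 < \<epsilon>"
      unfolding eventually_at_right_field using \<delta>(1) \<delta>0(1) by (intro exI[of _ "min \<delta> (\<delta>0 / 2)"]) auto
  qed
  consider "m \<Omega> (\<delta>0 / 2) \<le> \<epsilon>0 * b (\<delta>0 / 2)" | "m (- \<Omega>) (\<delta>0 / 2) \<le> \<epsilon>0 * b (\<delta>0 / 2)"
    using \<delta>0(2)[of "\<delta>0 / 2"] \<delta>0(1) by auto
  then show ?thesis
  proof cases
    case 1
    from lim[OF _ _ this] have "has_density_at \<Omega> x 0"
      unfolding has_density_at_def density_eq m_def b_def by simp
    then show ?thesis ..
  next
    case 2
    from lim[OF _ _ this] have "((\<lambda>r. 1 - m (- \<Omega>) r / b r) \<longlongrightarrow> 1 - 0) (at_right 0)"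
      by (intro tendsto_diff tendsto_const) auto
    moreover have "\<forall>\<^sub>F r in at_right 0. 1 - m (- \<Omega>) r / b r = m \<Omega> r / b r"
      unfolding eventually_at_right_field
    proof (intro exI[of _ 1] conjI allI impI)
      fix r :: real assume "0 < r"
      from b[OF this] split[of r] show "1 - m (- \<Omega>) r / b r = m \<Omega> r / b r" by (simp add: field_simps)
    qed simp
    ultimately have "((\<lambda>r. m \<Omega> r / b r) \<longlongrightarrow> 1) (at_right 0)"
      using Lim_transform_eventually by fastforce
    then have "has_density_at \<Omega> x 1"
      unfolding has_density_at_def density_eq m_def b_def by simp
    then show ?thesis ..
  qed
qed

lemma AE_normal:
  assumes "essential_boundary \<Omega> = F"
  shows "AE x in M. perim_lower \<le> norm (g x) \<and> outer_normal \<Omega> x = sgn (g x)"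
  using AE_lebesgue_point[OF g g_le] AE_F
proof eventually_elim
  case (elim x)
  then have "g x \<noteq> 0" using density_zero_or_one[of x] assms unfolding essential_boundary_def by auto
  then show ?case using elim lower_density outer_normal_eq by blast
qed

end

section \<open>Flatness\<close>

text \<open>A supremum in \<open>real\<close> is informative only for sets bounded above; here
  \<open>r\<close> is a bound, since \<open>x\<close> belongs to \<open>B\<close>. The result makes
  the infimum in \<open>flatness\<close> one of a set bounded below.\<close>

lemma infdist_SUP_bounds:
  assumes "x \<in> A" "x \<in> B" "\<And>a. a \<in> A \<Longrightarrow> dist x a \<le> r"
  shows "0 \<le> (SUP a\<in>A. infdist a B)"
proof -
  have "bdd_above ((\<lambda>a. infdist a B) ` A)"
    using assms infdist_le[OF assms(2)] by (intro bdd_aboveI2[of _ _ r]) (metis dist_commute order_trans)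
  from cSUP_upper[OF assms(1) this] show ?thesis using infdist_nonneg[of x B] by linarith
qed

lemma flatness_le_two_sided_dist:
  fixes S :: "'a::euclidean_space set"
  assumes "x \<in> S" "0 < r" "affine L" "aff_dim L = int (DIM('a)) - 1" "x \<in> L"
  shows "flatness S x r \<le> two_sided_dist (S \<inter> cball x r) (L \<inter> cball x r) / r"
  unfolding flatness_def
proof (rule cINF_lower)
  show "bdd_below ((\<lambda>L. two_sided_dist (S \<inter> cball x r) (L \<inter> cball x r) / r) `
      {L. affine L \<and> aff_dim L = int (DIM('a)) - 1 \<and> x \<in> L})"
  proof (rule bdd_belowI2)
    fix L assume "L \<in> {L. affine L \<and> aff_dim L = int (DIM('a)) - 1 \<and> x \<in> L}"
    then have "x \<in> L" by simp
    then show "0 \<le> two_sided_dist (S \<inter> cball x r) (L \<inter> cball x r) / r"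
      unfolding two_sided_dist_def using assms(1,2)
      by (intro divide_nonneg_pos add_nonneg_nonneg infdist_SUP_bounds[of x _ _ r]) auto
  qed
qed (use assms in auto)

context flux_domain begin

lemma tilt_eq: "tilt e y = norm (g y) * norm (sgn (g y) - e)"
proof -
  have "g y - norm (g y) *\<^sub>R e = norm (g y) *\<^sub>R (sgn (g y) - e)"
    by (simp only: scaleR_diff_right norm_scaleR_sgn)
  then show ?thesis by (simp add: tilt_def)
qed

lemma sgn_diff_integrable: "set_integrable M (ball x r) (\<lambda>y. norm (sgn (g y) - a))"
proof (rule set_integrable_bounded[of _ "1 + norm a"])
  show "norm (norm (sgn (g y) - a)) \<le> 1 + norm a" for y
    using norm_triangle_ineq4[of "sgn (g y)" a] norm_sgn[of "g y"] by (auto split: if_splits)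
qed auto

text \<open>The comparison plane passes through \<open>x\<close> orthogonally to \<open>e\<close>.
  Points of \<open>F\<close> are within \<open>\<delta> * r\<close> of it and its points within
  \<open>4 * (\<delta> * r)\<close> of \<open>F\<close>, which adds up to 5. The condition
  \<open>small\<close> is that of \<open>separation\<close> at radius \<open>2 * r\<close>, divided
  by \<open>r ^ DIM('a)\<close>.\<close>

lemma flatness_le:
  assumes AE: "AE y in M. perim_lower \<le> norm (g y)" and x: "x \<in> F" and r: "0 < r" "8 * r < R0"
    and e: "norm e = 1" and \<delta>: "0 < \<delta>" "\<delta> \<le> 1 / 4" and "0 \<le> \<epsilon>"
    and osc: "(LINT y:ball x (8 * r)|M. norm (sgn (g y) - e)) \<le> \<epsilon> * measure M (ball x (8 * r))"
    and small: "24 * C * A * 8 ^ (DIM('a) - 1) * \<epsilon> < porosity * \<delta> / 4 * (perim_lower * ((porosity * \<delta> / 16) ^ (DIM('a) - 1) / A))"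
  shows "flatness F x r \<le> 5 * \<delta>"
proof -
  define d where "d = DIM('a) - 1"
  \<comment> \<open>\<open>\<rho>\<close> is the precision with which points can be moved off the
    neighbourhood; \<open>s\<close> is the width for which \<open>far_point\<close> works at that
    precision. A height difference \<open>\<delta> * r\<close> is then
    \<open>4 * \<rho>\<close>.\<close>
  define \<rho> where "\<rho> = \<delta> * r / 4"
  define s where "s = porosity * \<rho>"
  have \<delta>r: "\<delta> * r \<le> r / 4" using \<delta> r mult_right_mono[of \<delta> "1/4" r] by simp
  have \<rho>: "0 < \<rho>" "6 * \<rho> < R0" "\<rho> \<le> r / 16" 
    using mult_pos_pos[OF \<delta>(1) r(1)] \<delta>r r unfolding \<rho>_def by linarith+
  have s: "0 < s" "s \<le> \<rho>" "s \<le> porosity * \<rho>" using porosity \<rho> mult_right_mono[of porosity 1 \<rho>] by (auto simp: s_def)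
  have s2: "s \<le> 2 * r" "s / 4 < R0" "s / 4 \<le> \<rho>" using s \<rho> r by auto
  have tm: "(LINT y:ball x (8 * r)|M. tilt e y) \<le> C * (\<epsilon> * (A * (8 * r) ^ d))"
  proof -
    have "(LINT y:ball x (8 * r)|M. tilt e y) \<le> (LINT y:ball x (8 * r)|M. C * norm (sgn (g y) - e))"
    proof (rule set_integral_mono)
      show "set_integrable M (ball x (8 * r)) (tilt e)"
        using tilt_le[OF e] tilt_nonneg by (intro set_integrable_bounded[of _ "2 * C"]) auto
      show "set_integrable M (ball x (8 * r)) (\<lambda>y. C * norm (sgn (g y) - e))"
        using sgn_diff_integrable by simp
      show "tilt e y \<le> C * norm (sgn (g y) - e)" for y
        unfolding tilt_eq by (intro mult_right_mono g_le norm_ge_zero)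
    qed
    also have "\<dots> = C * (LINT y:ball x (8 * r)|M. norm (sgn (g y) - e))" by simp
    also have "\<dots> \<le> C * (\<epsilon> * measure M (ball x (8 * r)))"
      using osc C_nonneg by (intro mult_left_mono)
    also have "\<dots> \<le> C * (\<epsilon> * (A * (8 * r) ^ d))"
      using upper[OF x, of "8 * r"] r \<open>0 \<le> \<epsilon>\<close> C_nonneg unfolding d_def by (intro mult_left_mono) auto
    finally show ?thesis .
  qed
  have sm: "12 * (2 * r) * (C * (\<epsilon> * (A * (8 * r) ^ d))) < s * (perim_lower * ((s / 4) ^ d / A))"
  proof -
    have "12 * (2 * r) * (C * (\<epsilon> * (A * (8 * r) ^ d))) = 24 * C * A * 8 ^ d * \<epsilon> * r ^ Suc d"
      by (simp add: power_mult_distrib mult_ac)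
    also have "\<dots> < porosity * \<delta> / 4 * (perim_lower * ((porosity * \<delta> / 16) ^ d / A)) * r ^ Suc d"
      using small r unfolding d_def[symmetric] by (intro mult_strict_right_mono) auto
    also have "\<dots> = s * (perim_lower * ((s / 4) ^ d / A))"
    proof -
      have "s / 4 = porosity * \<delta> / 16 * r" by (simp add: s_def \<rho>_def)
      then have "(s / 4) ^ d = (porosity * \<delta> / 16) ^ d * r ^ d" by (simp only: power_mult_distrib)
      then show ?thesis by (simp add: s_def \<rho>_def mult_ac)
    qed
    finally show ?thesis .
  qed
  \<comment> \<open>The same \<open>e\<close> separates at every point \<open>y\<close> of
    \<open>F\<close> near \<open>x\<close>, because \<open>ball y (4 * r)\<close> stays inside
    \<open>ball x (8 * r)\<close>, where the tilt is controlled.\<close>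
  have sep: "(z - y) \<bullet> e \<le> - (s / 4) \<Longrightarrow> z \<in> \<Omega>" "s / 4 \<le> (z - y) \<bullet> e \<Longrightarrow> z \<notin> \<Omega>"
    if y: "y \<in> F" "y \<in> ball x (2 * r)" and z: "z \<in> ball y (2 * r)" "z \<notin> nbhd s" for y z
  proof -
    have sub: "ball y (2 * (2 * r)) \<subseteq> ball x (8 * r)"
    proof
      fix w assume "w \<in> ball y (2 * (2 * r))"
      then show "w \<in> ball x (8 * r)" using y(2) r dist_triangle[of x w y] by simp
    qed
    have "(LINT w:ball y (2 * (2 * r))|M. tilt e w) \<le> (LINT w:ball x (8 * r)|M. tilt e w)"
      unfolding set_lebesgue_integral_def
    proof (rule integral_mono)
      show "integrable M (\<lambda>w. indicat_real (ball z q) w *\<^sub>R tilt e w)" for z q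
        using tilt_le[OF e] tilt_nonneg set_integrable_bounded[of "tilt e" "2 * C" "ball z q"]
        unfolding set_integrable_def by auto
      then show "integrable M (\<lambda>w. indicat_real (ball x (8 * r)) w *\<^sub>R tilt e w)" .
      show "indicat_real (ball y (2 * (2 * r))) w *\<^sub>R tilt e w \<le> indicat_real (ball x (8 * r)) w *\<^sub>R tilt e w" for w
        using subsetD[OF sub, of w] tilt_nonneg[of e w] by (simp add: indicator_def)
    qed
    then have b: "(LINT w:ball y (2 * (2 * r))|M. tilt e w) \<le> C * (\<epsilon> * (A * (8 * r) ^ d))" using tm by linarith
    have "perim_lower * ((s / 4) ^ d / A) \<le> perim_lower * measure M (ball y (s / 4))"
    proof (rule mult_left_mono)
      show "(s / 4) ^ d / A \<le> measure M (ball y (s / 4))"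
        using lower[OF y(1), of "s / 4"] s s2 A unfolding d_def by (simp add: pos_divide_le_eq mult.commute)
    qed (use perim_lower_pos in simp)
    also have "\<dots> \<le> (LINT w:ball y (s / 4)|M. norm (g w))"
      using perim_lower_pos AE by (intro int_norm_g_lower) auto
    finally have c: "perim_lower * ((s / 4) ^ d / A) \<le> (LINT w:ball y (s / 4)|M. norm (g w))" .
    show "(z - y) \<bullet> e \<le> - (s / 4) \<Longrightarrow> z \<in> \<Omega>" "s / 4 \<le> (z - y) \<bullet> e \<Longrightarrow> z \<notin> \<Omega>"
      using separation[OF e s(1) s2(1) b c sm z] by auto
  qed
  have ee: "e \<bullet> e = 1" using e by (simp add: dot_square_norm)
  have height: "\<bar>(w - p) \<bullet> e\<bar> < \<rho>" if "w \<in> ball p \<rho>" for w p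
    using Cauchy_Schwarz_ineq2[of "w - p" e] that e by (simp add: dist_norm norm_minus_commute)
  \<comment> \<open>If two points of \<open>F\<close> differed too much in height, a point off the
    neighbourhood near their midpoint would lie above the lower one, hence outside \<Omega>, and
    below the upper one, hence inside.\<close>
  have mid: False if y: "y \<in> F" "y \<in> ball x (2 * r)" and y': "y' \<in> F" "y' \<in> ball x (2 * r)"
    and yy: "dist y y' \<le> r" and h: "\<delta> * r \<le> (y' - y) \<bullet> e" for y y'
  proof -
    define p where "p = midpoint y y'"
    obtain w where w: "w \<in> ball p \<rho>" "w \<notin> nbhd s" using far_point[OF \<rho>(1,2) s(1,3)] by blast
    have dp: "dist y p \<le> r / 2" "dist y' p \<le> r / 2" using yy by (auto simp: p_def dist_midpoint)
    have wy: "w \<in> ball y (2 * r)" "w \<in> ball y' (2 * r)"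
      using dp w(1) \<rho> r dist_triangle[of y w p] dist_triangle[of y' w p] by auto
    have hp: "2 * (p \<bullet> e) = y \<bullet> e + y' \<bullet> e" by (simp add: p_def midpoint_def inner_add_left)
    have hw: "\<bar>w \<bullet> e - p \<bullet> e\<bar> < \<rho>" using height[OF w(1)] by (simp add: inner_diff_left)
    have h': "4 * \<rho> \<le> y' \<bullet> e - y \<bullet> e" using h by (simp add: \<rho>_def inner_diff_left)
    have "s / 4 \<le> (w - y) \<bullet> e" "(w - y') \<bullet> e \<le> - (s / 4)"
      using hp hw h' s2(3) unfolding inner_diff_left abs_less_iff by linarith+
    then show False using sep(2)[OF y wy(1) w(2)] sep(1)[OF y' wy(2) w(2)] by blast
  qed
  have flat1: "\<bar>(y - x) \<bullet> e\<bar> < \<delta> * r" if "y \<in> F" "y \<in> cball x r" for y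
  proof (rule ccontr)
    assume "\<not> ?thesis"
    then have "\<delta> * r \<le> (y - x) \<bullet> e \<or> \<delta> * r \<le> (x - y) \<bullet> e"
      by (auto simp: inner_diff_left abs_less_iff)
    then show False
      using mid[of x y] mid[of y x] x that r by (auto simp: dist_commute)
  qed
  define L where "L = {p. e \<bullet> p = e \<bullet> x}"
  have L: "affine L" "aff_dim L = int (DIM('a)) - 1" "x \<in> L"
    using e aff_dim_hyperplane[of e "e \<bullet> x"] unfolding L_def by (fastforce simp: affine_hyperplane)+
  have one: "infdist y (L \<inter> cball x r) \<le> \<delta> * r" if "y \<in> F \<inter> cball x r" for y
  proof -
    define p where "p = y - ((y - x) \<bullet> e) *\<^sub>R e"
    have "p \<in> L" by (simp add: p_def L_def inner_diff_right ee inner_diff_left inner_commute)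
    moreover have "norm (p - x) \<le> norm (y - x)"
    proof -
      have "(p - x) \<bullet> (p - x) = (y - x) \<bullet> (y - x) - ((y - x) \<bullet> e)\<^sup>2"
        using ee by (simp add: p_def inner_diff_left inner_diff_right inner_commute power2_eq_square algebra_simps)
      then show ?thesis by (simp add: norm_le)
    qed
    then have "p \<in> cball x r" using that by (simp add: dist_norm norm_minus_commute)
    ultimately have "infdist y (L \<inter> cball x r) \<le> dist y p" by (intro infdist_le) auto
    also have "\<dots> = \<bar>(y - x) \<bullet> e\<bar>" using e by (simp add: p_def dist_norm)
    finally show ?thesis using flat1[of y] that by simp
  qed
  have two: "infdist q (F \<inter> cball x r) \<le> 4 * (\<delta> * r)" if q: "q \<in> L \<inter> cball x r" for q
  proof -
    \<comment> \<open>Pulling \<open>q\<close> towards \<open>x\<close> by the fraction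
      \<open>3 * \<delta>\<close> makes room: the point of \<open>F\<close> found within
      \<open>3 * \<rho>\<close> of \<open>q'\<close> still belongs to
      \<open>cball x r\<close>.\<close>
    define q' where "q' = x + (1 - 3 * \<delta>) *\<^sub>R (q - x)"
    have nq: "norm (q - x) \<le> r" using q by (simp add: dist_norm norm_minus_commute)
    have "q - q' = (3 * \<delta>) *\<^sub>R (q - x)" by (simp add: q'_def algebra_simps)
    then have qq': "dist q q' \<le> 3 * (\<delta> * r)"
      using nq \<delta> mult_left_mono[OF nq, of "3 * \<delta>"] by (simp add: dist_norm mult.assoc)
    have q'x: "dist x q' \<le> r - 3 * (\<delta> * r)"
    proof -
      have "dist x q' = (1 - 3 * \<delta>) * norm (q - x)"
        unfolding dist_commute[of x q'] using \<delta> by (simp add: q'_def dist_norm)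
      then show ?thesis using mult_left_mono[OF nq, of "1 - 3 * \<delta>"] \<delta> by (simp add: algebra_simps)
    qed
    have q'h: "q' \<bullet> e = x \<bullet> e" using q by (simp add: q'_def L_def inner_add_right inner_diff_right inner_commute[of _ e])
    \<comment> \<open>At height \<open>2 * \<rho>\<close> below and above \<open>q'\<close>, a
      displacement by less than \<open>\<rho>\<close> does not change sides; \<open>w1\<close> lies
      in \<Omega> and \<open>w2\<close> does not, so the connected ball around \<open>q'\<close>
      meets \<open>F\<close>.\<close>
    obtain w1 where w1: "w1 \<in> ball (q' - (2 * \<rho>) *\<^sub>R e) \<rho>" "w1 \<notin> nbhd s"
      using far_point[OF \<rho>(1,2) s(1,3)] by blast
    obtain w2 where w2: "w2 \<in> ball (q' + (2 * \<rho>) *\<^sub>R e) \<rho>" "w2 \<notin> nbhd s"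
      using far_point[OF \<rho>(1,2) s(1,3)] by blast
    have "dist q' (q' - (2 * \<rho>) *\<^sub>R e) = 2 * \<rho>" "dist q' (q' + (2 * \<rho>) *\<^sub>R e) = 2 * \<rho>"
      using e \<rho> by (auto simp: dist_norm)
    then have wq: "w1 \<in> ball q' (3 * \<rho>)" "w2 \<in> ball q' (3 * \<rho>)"
      using w1(1) w2(1) dist_triangle[of q' w1 "q' - (2 * \<rho>) *\<^sub>R e"] dist_triangle[of q' w2 "q' + (2 * \<rho>) *\<^sub>R e"]
      by auto
    have near: "w \<in> ball x (2 * r)" if "w \<in> ball q' (3 * \<rho>)" for w
      using that q'x \<rho> r \<delta> dist_triangle[of x w q'] mult_pos_pos[OF \<delta>(1) r(1)]
      unfolding mem_ball by linarith
    have "(w1 - x) \<bullet> e \<le> - (s / 4)"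
      using height[OF w1(1)] s2(3) \<rho>(1) q'h
      unfolding abs_less_iff inner_diff_left inner_scaleR_left ee mult_1_right by linarith
    then have "w1 \<in> \<Omega>" using x r near[OF wq(1)] w1 sep(1)[of x w1] by auto
    have "s / 4 \<le> (w2 - x) \<bullet> e"
      using height[OF w2(1)] s2(3) \<rho>(1) q'h
      unfolding abs_less_iff inner_diff_left inner_add_left inner_scaleR_left ee mult_1_right by linarith
    then have "w2 \<notin> \<Omega>" using x r near[OF wq(2)] w2 sep(2)[of x w2] by auto
    have "ball q' (3 * \<rho>) \<inter> F \<noteq> {}"
      unfolding F_eq using \<open>w1 \<in> \<Omega>\<close> \<open>w2 \<notin> \<Omega>\<close> wq by (intro connected_Int_frontier) auto
    then obtain b where b: "b \<in> F" "dist q' b < 3 * \<rho>" by auto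
    have "dist x b \<le> r"
      using dist_triangle[of x b q'] q'x b(2) mult_pos_pos[OF \<delta>(1) r(1)] by (simp add: \<rho>_def)
    then have "infdist q (F \<inter> cball x r) \<le> dist q b" using b by (intro infdist_le) auto
    also have "\<dots> \<le> 4 * (\<delta> * r)"
      using dist_triangle[of q b q'] qq' b(2) mult_pos_pos[OF \<delta>(1) r(1)] by (simp add: \<rho>_def)
    finally show ?thesis .
  qed
  have "two_sided_dist (F \<inter> cball x r) (L \<inter> cball x r) \<le> \<delta> * r + 4 * (\<delta> * r)"
    unfolding two_sided_dist_def using x L(3) r one two
    by (intro add_mono cSUP_least) auto
  then have "two_sided_dist (F \<inter> cball x r) (L \<inter> cball x r) / r \<le> 5 * \<delta>"
    using r by (simp add: divide_le_eq)
  then show ?thesis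
    using flatness_le_two_sided_dist[OF x r(1) L] by linarith
qed

text \<open>Small oscillation gives closeness to the average \<open>m\<close>, which need not have
  length 1. As \<open>sgn (g y)\<close> is almost everywhere a unit vector, \<open>norm m\<close> is
  within \<epsilon> of 1, and replacing \<open>m\<close> by \<open>sgn m\<close> costs another
  \<epsilon>; hence the factor 2.\<close>

lemma mean_direction:
  assumes AE: "AE y in M. perim_lower \<le> norm (g y)" and x: "x \<in> F" and r: "0 < r" "r < R0"
    and \<epsilon>: "0 < \<epsilon>" "\<epsilon> < 1"
    and osc: "(LINT y:ball x r|M. (norm (sgn (g y) - m))\<^sup>2) \<le> \<epsilon>\<^sup>2 * measure M (ball x r)"
  obtains e where "norm e = 1"
    "(LINT y:ball x r|M. norm (sgn (g y) - e)) \<le> 2 * \<epsilon> * measure M (ball x r)"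
proof -
  let ?\<mu> = "measure M (ball x r)"
  have \<mu>: "?\<mu> > 0" by (rule ball_pos[OF x r])
  have sq_int: "set_integrable M (ball x r) (\<lambda>y. (norm (sgn (g y) - m))\<^sup>2)"
  proof (rule set_integrable_bounded[of _ "(1 + norm m)\<^sup>2"])
    have "norm (sgn (g y) - m) \<le> 1 + norm m" for y
      using norm_triangle_ineq4[of "sgn (g y)" m] norm_sgn[of "g y"] by (auto split: if_splits)
    then show "norm ((norm (sgn (g y) - m))\<^sup>2) \<le> (1 + norm m)\<^sup>2" for y
      by (simp add: power_mono)
  qed auto
  \<comment> \<open>AM-GM: \<open>a \<le> a\<^sup>2 / (2 \<epsilon>) + \<epsilon> / 2\<close>\<close>
  have mean: "(LINT y:ball x r|M. norm (sgn (g y) - m)) \<le> \<epsilon> * ?\<mu>"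
  proof -
    have "(LINT y:ball x r|M. norm (sgn (g y) - m))
        \<le> (LINT y:ball x r|M. (norm (sgn (g y) - m))\<^sup>2 / (2 * \<epsilon>) + \<epsilon> / 2)"
    proof (rule set_integral_mono)
      show "set_integrable M (ball x r) (\<lambda>y. (norm (sgn (g y) - m))\<^sup>2 / (2 * \<epsilon>) + \<epsilon> / 2)"
        using sq_int const_integrable[of x r "\<epsilon> / 2"] by (intro set_integral_add) auto
      fix y
      have "0 \<le> (norm (sgn (g y) - m) - \<epsilon>)\<^sup>2" by simp
      then show "norm (sgn (g y) - m) \<le> (norm (sgn (g y) - m))\<^sup>2 / (2 * \<epsilon>) + \<epsilon> / 2"
        using \<epsilon> by (simp add: field_simps power2_eq_square)
    qed (rule sgn_diff_integrable)
    also have "\<dots> = (LINT y:ball x r|M. (norm (sgn (g y) - m))\<^sup>2) / (2 * \<epsilon>) + \<epsilon> / 2 * ?\<mu>"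
      using sq_int const_integrable[of x r "\<epsilon> / 2"] set_integral_ball_const[of x r "\<epsilon> / 2"]
      by (subst set_integral_add) (auto simp: mult.commute)
    also have "\<dots> \<le> \<epsilon>\<^sup>2 * ?\<mu> / (2 * \<epsilon>) + \<epsilon> / 2 * ?\<mu>"
      using osc \<epsilon> by (intro add_right_mono divide_right_mono) auto
    also have "\<dots> = \<epsilon> * ?\<mu>" using \<epsilon> by (simp add: power2_eq_square)
    finally show ?thesis .
  qed
  have unit: "\<bar>1 - norm m\<bar> \<le> \<epsilon>"
  proof -
    have "\<bar>1 - norm m\<bar> * ?\<mu> = (LINT y:ball x r|M. \<bar>1 - norm m\<bar>)"
      using set_integral_ball_const[of x r "\<bar>1 - norm m\<bar>"] by simp
    also have "\<dots> \<le> (LINT y:ball x r|M. norm (sgn (g y) - m))"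
      unfolding set_lebesgue_integral_def
    proof (rule integral_mono_AE)
      show "AE y in M. indicat_real (ball x r) y *\<^sub>R \<bar>1 - norm m\<bar> \<le> indicat_real (ball x r) y *\<^sub>R norm (sgn (g y) - m)"
        using AE
      proof eventually_elim
        case (elim y)
        then have "g y \<noteq> 0" using perim_lower_pos by auto
        then have "norm (sgn (g y)) = 1" by (simp add: norm_sgn)
        then show ?case using norm_triangle_ineq3[of "sgn (g y)" m] by (simp add: indicator_def)
      qed
    qed (use const_integrable[of x r "\<bar>1 - norm m\<bar>"] sgn_diff_integrable[of x r m] in \<open>auto simp: set_integrable_def\<close>)
    also have "\<dots> \<le> \<epsilon> * ?\<mu>" by (rule mean)
    finally show ?thesis using \<mu> by (simp add: mult_le_cancel_right)
  qed
  then have m0: "m \<noteq> 0" using \<epsilon> by auto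
  define e where "e = sgn m"
  have e: "norm e = 1" using m0 by (simp add: e_def norm_sgn)
  have "m - e = (norm m - 1) *\<^sub>R e"
    using norm_scaleR_sgn[of m] by (simp add: scaleR_diff_left e_def)
  then have me: "norm (m - e) \<le> \<epsilon>" using unit e by (simp add: abs_minus_commute)
  have "(LINT y:ball x r|M. norm (sgn (g y) - e)) \<le> (LINT y:ball x r|M. norm (sgn (g y) - m) + \<epsilon>)"
  proof (rule set_integral_mono)
    show "set_integrable M (ball x r) (\<lambda>y. norm (sgn (g y) - m) + \<epsilon>)"
      using sgn_diff_integrable const_integrable[of x r \<epsilon>] by (intro set_integral_add) auto
    show "norm (sgn (g y) - e) \<le> norm (sgn (g y) - m) + \<epsilon>" for y
      using norm_triangle_ineq[of "sgn (g y) - m" "m - e"] me by simp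
  qed (rule sgn_diff_integrable)
  also have "\<dots> = (LINT y:ball x r|M. norm (sgn (g y) - m)) + \<epsilon> * ?\<mu>"
    using sgn_diff_integrable const_integrable[of x r \<epsilon>] set_integral_ball_const[of x r \<epsilon>]
    by (subst set_integral_add) (auto simp: mult.commute)
  also have "\<dots> \<le> 2 * \<epsilon> * ?\<mu>" using mean by simp
  finally show thesis using e that by blast
qed

end

text \<open>A one-point boundary has diameter 0, so \<open>ahlfors_regular\<close> says nothing
  about it and it is excluded separately: the punctured space is connected, so \<Omega> is all of it
  and has density 1 at \<open>p\<close>, which therefore is not in the essential boundary.\<close>

lemma frontier_singleton_density:
  fixes \<Omega> :: "'a::euclidean_space set"
  assumes "2 \<le> DIM('a)" "open \<Omega>" "frontier \<Omega> = {p}"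
  shows "has_density_at \<Omega> p 1"
proof -
  have "connected (- {p})" using assms(1) by (rule connected_punctured_universe)
  then have "- {p} \<inter> \<Omega> = {} \<or> - {p} - \<Omega> = {}"
    using connected_Int_frontier[of "- {p}" \<Omega>] assms(3) by blast
  moreover have p: "p \<notin> \<Omega>" using assms(2,3) by (auto simp: frontier_def interior_open)
  moreover obtain z where "z \<in> \<Omega>" using assms(3) by fastforce
  ultimately have "- {p} \<subseteq> \<Omega>" by (metis ComplI Diff_eq_empty_iff IntI empty_iff singletonD)
  with p have \<Omega>: "\<Omega> = - {p}" by auto
  have "measure lebesgue (\<Omega> \<inter> ball p r) / measure lebesgue (ball p r) = 1" if "r > 0" for r
  proof -
    have "\<Omega> \<inter> ball p r = ball p r - {p}" using \<Omega> by blast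
    moreover have "measure lebesgue (ball p r - {p}) = measure lebesgue (ball p r)"
      by (intro measure_Diff_null_set) auto
    ultimately show ?thesis using content_ball_pos[OF that, of p] by simp
  qed
  then have "\<forall>\<^sub>F r in at_right 0. 1 = measure lebesgue (\<Omega> \<inter> ball p r) / measure lebesgue (ball p r)"
    unfolding eventually_at_right_field by (intro exI[of _ 1] conjI allI impI) (simp_all only: zero_less_one)
  then show ?thesis unfolding has_density_at_def
    by (rule Lim_transform_eventually[OF tendsto_const])
qed

section \<open>Surface measure on the boundary and assembly of the result\<close>

lemma sets_hausdorff_measure [simp, measurable_cong]: "sets (hausdorff_measure k) = sets borel"
  using sets.sigma_sets_eq[of "borel :: 'a measure"]
  by (simp add: hausdorff_measure_def sets_measure_of_conv)

context
  fixes F :: "'a::euclidean_space set"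
  assumes F: "closed F"
begin

text \<open>A density rather than \<open>restrict_space\<close>, so that the measure still lives on
  the Borel sets of the whole space, as \<open>radon\<close> requires.\<close>

definition boundary_measure :: "'a measure" where
  "boundary_measure = density surface_measure (indicator F)"

lemma emeasure_boundary_measure:
  assumes "B \<in> sets borel"
  shows "emeasure boundary_measure B = emeasure surface_measure (F \<inter> B)"
proof -
  have "emeasure boundary_measure B = (\<integral>\<^sup>+x. indicator F x * indicator B x \<partial>surface_measure)"
    unfolding boundary_measure_def using F assms
    by (intro emeasure_density borel_measurable_indicator) auto
  also have "\<dots> = (\<integral>\<^sup>+x. indicator (F \<inter> B) x \<partial>surface_measure)"
    by (intro nn_integral_cong) (auto simp: indicator_def)
  finally show ?thesis using F assms by simp
qed

text \<open>Carries the averages in \<open>VMO_loc\<close> over to the measure of the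
  \<open>ahlfors\<close> locale and replaces the normal by a Borel function equal to it almost
  everywhere. Since \<open>\<nu>\<close> is known to be measurable only on \<open>F\<close>, it is
  first cut off by the indicator.\<close>

lemma integral_boundary_measure:
  fixes \<nu> \<nu>' :: "'a \<Rightarrow> 'a" and h :: "'a \<Rightarrow> 'b::{banach, second_countable_topology}"
  assumes \<nu>: "\<nu> \<in> borel_measurable (restrict_space surface_measure F)"
    and \<nu>' [measurable]: "\<nu>' \<in> borel_measurable borel"
    and AE: "AE y in boundary_measure. \<nu> y = \<nu>' y"
    and h [measurable]: "h \<in> borel_measurable borel"
  shows "(LINT y:ball x r \<inter> F|surface_measure. h (\<nu> y)) = (LINT y:ball x r|boundary_measure. h (\<nu>' y))"
proof -
  have [measurable]: "F \<in> sets borel" "ball x r \<in> sets borel" using F by auto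
  have m: "(\<lambda>y. indicator F y *\<^sub>R \<nu> y) \<in> borel_measurable surface_measure"
    using \<nu> F by (subst (asm) borel_measurable_restrict_space_iff) auto
  note [measurable] = m
  have "(LINT y:ball x r|boundary_measure. h (\<nu>' y))
      = (LINT y|density surface_measure (\<lambda>y. ennreal (indicator F y)). indicator (ball x r) y *\<^sub>R h (\<nu>' y))"
    by (simp add: set_lebesgue_integral_def boundary_measure_def ennreal_indicator)
  also have "\<dots> = (LINT y|surface_measure. indicat_real F y *\<^sub>R (indicator (ball x r) y *\<^sub>R h (\<nu>' y)))"
  proof (rule integral_density)
    have mc: "borel_measurable surface_measure = borel_measurable (borel :: 'a measure)"
      by (rule measurable_cong_sets) simp_all
    show "(\<lambda>y. indicat_real (ball x r) y *\<^sub>R h (\<nu>' y)) \<in> borel_measurable surface_measure"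
      "indicat_real F \<in> borel_measurable surface_measure"
      unfolding mc by measurable
  qed simp
  also have "\<dots> = (LINT y|surface_measure. indicator (ball x r \<inter> F) y *\<^sub>R h (indicator F y *\<^sub>R \<nu> y))"
  proof (rule integral_cong_AE)
    have "AE y in surface_measure. y \<in> F \<longrightarrow> \<nu> y = \<nu>' y"
      using AE unfolding boundary_measure_def
      by (subst (asm) AE_density) (auto elim!: eventually_mono simp: indicator_def split: if_splits)
    then show "AE y in surface_measure. indicat_real F y *\<^sub>R (indicator (ball x r) y *\<^sub>R h (\<nu>' y))
        = indicator (ball x r \<inter> F) y *\<^sub>R h (indicator F y *\<^sub>R \<nu> y)"
      by eventually_elim (auto simp: indicator_def)
  qed measurable
  also have "\<dots> = (LINT y:ball x r \<inter> F|surface_measure. h (\<nu> y))"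
    unfolding set_lebesgue_integral_def
    by (intro Bochner_Integration.integral_cong) (auto simp: indicator_def)
  finally show ?thesis by simp
qed

text \<open>Two distinct points bound the diameter from below by \<open>dist p q\<close>, which
  serves as \<open>R0\<close>. Local finiteness follows by covering the compact part of
  \<open>F\<close> with finitely many balls of radius below it.\<close>

lemma ahlfors_boundary_measure:
  assumes reg: "ahlfors_regular F" and pq: "p \<in> F" "q \<in> F" "p \<noteq> q"
  obtains A where "ahlfors boundary_measure F A (dist p q)"
proof -
  obtain C where C: "C \<ge> 1" and bound: "\<And>x r. x \<in> F \<Longrightarrow> r > 0 \<Longrightarrow> ennreal r < ediam F \<Longrightarrow>
     ennreal (r ^ (DIM('a) - 1) / C) \<le> emeasure surface_measure (F \<inter> ball x r) \<and>
     emeasure surface_measure (F \<inter> ball x r) \<le> ennreal (C * r ^ (DIM('a) - 1))"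
    using reg unfolding ahlfors_regular_def by blast
  have diam: "ennreal r < ediam F" if "r < dist p q" for r
  proof -
    have "ennreal (dist p q) \<le> ediam F" unfolding ediam_def using pq by (meson SUP_upper2 order_refl)
    moreover have "ennreal r < ennreal (dist p q)" using that pq by (simp add: ennreal_less_iff ennreal_lessI)
    ultimately show ?thesis by (rule less_le_trans[rotated])
  qed
  have b: "ennreal (r ^ (DIM('a) - 1) / C) \<le> emeasure boundary_measure (ball x r)"
    "emeasure boundary_measure (ball x r) \<le> ennreal (C * r ^ (DIM('a) - 1))"
    if "x \<in> F" "0 < r" "r < dist p q" for x r
    using bound[OF that(1,2) diam[OF that(3)]] by (simp_all add: emeasure_boundary_measure)
  have fin: "emeasure boundary_measure (ball x r) \<noteq> \<infinity>" if "x \<in> F" "0 < r" "r < dist p q" for x r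
    using b(2)[OF that] by (auto simp: top_unique)
  have "ahlfors boundary_measure F C (dist p q)"
  proof
    show sets: "sets boundary_measure = sets borel" by (simp add: boundary_measure_def)
    show "emeasure boundary_measure K < \<infinity>" if K: "compact K" for K
    proof -
      define \<rho> where "\<rho> = dist p q / 2"
      have \<rho>: "0 < \<rho>" "\<rho> < dist p q" using pq by (auto simp: \<rho>_def)
      have cov: "K \<inter> F \<subseteq> (\<Union>x\<in>K \<inter> F. ball x \<rho>)" using \<rho> by auto
      obtain T where T: "T \<subseteq> K \<inter> F" "finite T" "K \<inter> F \<subseteq> (\<Union>x\<in>T. ball x \<rho>)"
        by (rule compactE_image[OF compact_Int_closed[OF K F] _ cov]) auto
      have "emeasure boundary_measure K = emeasure boundary_measure (K \<inter> F)"
        using emeasure_boundary_measure[of K] emeasure_boundary_measure[of "K \<inter> F"] K F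
        by (simp add: borel_compact borel_closed sets.Int Int_ac)
      also have "\<dots> \<le> emeasure boundary_measure (\<Union>x\<in>T. ball x \<rho>)"
        using T by (intro emeasure_mono) (auto simp: sets)
      also have "\<dots> \<le> (\<Sum>x\<in>T. emeasure boundary_measure (ball x \<rho>))"
        using T by (intro emeasure_subadditive_finite) (auto simp: sets)
      also have "\<dots> < \<infinity>"
        using T(1,2) fin[OF _ \<rho>] by (auto simp: less_top)
      finally show ?thesis .
    qed
    show "emeasure boundary_measure (- F) = 0"
      using F by (simp add: emeasure_boundary_measure)
    fix x r assume xr: "x \<in> F" "0 < r" "r < dist p q"
    have e: "emeasure boundary_measure (ball x r) = ennreal (measure boundary_measure (ball x r))"
      using fin[OF xr] by (intro emeasure_eq_ennreal_measure) auto
    have "r ^ (DIM('a) - 1) / C \<le> measure boundary_measure (ball x r)"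
      using b(1)[OF xr] unfolding e by (subst (asm) ennreal_le_iff) auto
    then show "r ^ (DIM('a) - 1) \<le> C * measure boundary_measure (ball x r)"
      using C by (simp add: pos_divide_le_eq mult.commute)
    show "measure boundary_measure (ball x r) \<le> C * r ^ (DIM('a) - 1)"
      using b(2)[OF xr] C xr unfolding e by (subst (asm) ennreal_le_iff) auto
  qed (use F C pq in auto)
  then show thesis by (rule that)
qed

end

lemma vmo_implies_flat:
  fixes \<Omega> :: "'a::euclidean_space set"
  assumes dim: "2 \<le> DIM('a)" and op: "open \<Omega>"
    and ess: "essential_boundary \<Omega> = frontier \<Omega>"
    and reg: "ahlfors_regular (frontier \<Omega>)"
    and vmo: "VMO_loc (frontier \<Omega>) (outer_normal \<Omega>)"
  shows "vanishing_reifenberg_flat (frontier \<Omega>)"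
proof (cases "frontier \<Omega> = {}")
  case True
  then show ?thesis by (simp add: vanishing_reifenberg_flat_def bot_ennreal)
next
  case False
  define F where "F = frontier \<Omega>"
  have cF: "closed F" by (simp add: F_def frontier_closed)
  obtain p where p: "p \<in> F" using False by (auto simp: F_def)
  \<comment> \<open>A second point of \<open>F\<close> is what makes \<open>R0\<close>
    positive.\<close>
  have "F \<noteq> {p}"
    using frontier_singleton_density[OF dim op, of p] ess p unfolding F_def essential_boundary_def by auto
  then obtain q where q: "q \<in> F" "p \<noteq> q" using p by auto
  define M where "M = boundary_measure F"
  define R0 where "R0 = dist p q"
  obtain A where "ahlfors M F A R0"
    using ahlfors_boundary_measure[OF cF reg[folded F_def] p q] unfolding M_def R0_def by blast
  then interpret ahlfors M F A R0 .
  interpret ahlfors_domain M F A R0 \<Omega>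
    by unfold_locales (simp_all add: op F_def)
  obtain g where g: "g \<in> borel_measurable borel" "\<And>x. norm (g x) \<le> DIM('a) * kernel_bound"
    "\<And>\<phi> v. C1c \<phi> \<Longrightarrow> flux \<phi> v = (LINT x|M. \<phi> x * (g x \<bullet> v))"
    using flux_density by blast
  define C where "C = DIM('a) * kernel_bound"
  interpret flux_domain M F A R0 \<Omega> g C
    by unfold_locales (use g in \<open>auto simp: C_def\<close>)
  have AE: "AE y in M. perim_lower \<le> norm (g y)" and AEn: "AE y in M. outer_normal \<Omega> y = sgn (g y)"
    using AE_normal ess unfolding F_def by auto
  have \<nu>: "outer_normal \<Omega> \<in> borel_measurable (restrict_space surface_measure F)"
    and osc: "\<And>K. compact K \<Longrightarrow> ((\<lambda>r. SUP x\<in>F \<inter> K. osc_norm F (outer_normal \<Omega>) x r) \<longlongrightarrow> 0) (at_right 0)"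
    using vmo unfolding VMO_loc_def L2_loc_def F_def by auto
  have avg: "ball_average F (\<lambda>y. h (outer_normal \<Omega> y)) x r
     = (LINT y:ball x r|M. h (sgn (g y))) /\<^sub>R measure M (ball x r)"
    if "h \<in> borel_measurable borel" for h :: "'a \<Rightarrow> real" and x r
    using integral_boundary_measure[OF cF \<nu> sgn_measurable AEn[unfolded M_def] that, of x r]
      emeasure_boundary_measure[OF cF, of "ball x r"]
    unfolding ball_average_def M_def measure_def by (simp add: Int_commute)
  have flat: "\<exists>r1>0. \<forall>x\<in>F \<inter> K. \<forall>r. 0 < r \<and> r < r1 \<longrightarrow> flatness F x r \<le> 5 * \<delta>"
    if K: "compact K" and \<delta>: "0 < \<delta>" "\<delta> \<le> 1 / 4" for K \<delta>
  proof -
    define b where "b = porosity * \<delta> / 4 * (perim_lower * ((porosity * \<delta> / 16) ^ (DIM('a) - 1) / A))"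
    define a where "a = 24 * C * A * 8 ^ (DIM('a) - 1)"
    have b: "0 < b" using porosity perim_lower_pos \<delta> A by (simp add: b_def)
    have a: "0 \<le> a" using C_nonneg A by (simp add: a_def)
    \<comment> \<open>\<open>flatness_le\<close> is applied with \<open>2 * \<epsilon>\<close>, the
      outcome of \<open>mean_direction\<close>, which itself asks for \<open>\<epsilon> < 1\<close>.
      The summand 1 guards against \<open>a = 0\<close>.\<close>
    define \<epsilon> where "\<epsilon> = min (1 / 2) (b / (4 * (a + 1)))"
    have \<epsilon>: "0 < \<epsilon>" "\<epsilon> < 1" "\<epsilon> \<le> b / (4 * (a + 1))" using a b by (auto simp: \<epsilon>_def)
    have small: "a * (2 * \<epsilon>) < b"
    proof -
      have "a * (2 * \<epsilon>) \<le> a * (2 * (b / (4 * (a + 1))))" using a \<epsilon> by (intro mult_left_mono) auto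
      also have "\<dots> = a / (a + 1) * (b / 2)" using a by (simp add: field_simps)
      also have "\<dots> \<le> 1 * (b / 2)" using a b by (intro mult_right_mono) auto
      finally show ?thesis using b by simp
    qed
    have "\<forall>\<^sub>F r in at_right 0. (SUP x\<in>F \<inter> K. osc_norm F (outer_normal \<Omega>) x r) < ennreal \<epsilon>"
      using osc[OF K] \<epsilon>(1) by (intro order_tendstoD(2)) auto
    then obtain r2 where r2: "r2 > 0" "\<And>r. 0 < r \<Longrightarrow> r < r2 \<Longrightarrow>
        (SUP x\<in>F \<inter> K. osc_norm F (outer_normal \<Omega>) x r) < ennreal \<epsilon>"
      unfolding eventually_at_right_field by auto
    \<comment> \<open>The supremum in \<open>osc_norm\<close> runs over radii strictly below its
      argument, so \<open>8 * r\<close> has to be less than the argument \<open>r2 / 2\<close>,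
      which in turn is less than \<open>r2\<close>.\<close>
    define r1 where "r1 = min (r2 / 2) R0 / 8"
    have "flatness F x r \<le> 5 * \<delta>" if x: "x \<in> F \<inter> K" and r: "0 < r" "r < r1" for x r
    proof -
      have r8: "0 < 8 * r" "8 * r < r2 / 2" "8 * r < R0" using r by (auto simp: r1_def)
      \<comment> \<open>\<open>mean_direction\<close> accepts an arbitrary vector, so this average
        is used as it stands; only the squared oscillation around it is rewritten in terms of
        \<open>g\<close>.\<close>
      define m where "m = ball_average F (outer_normal \<Omega>) x (8 * r)"
      define v where "v = ball_average F (\<lambda>y. (norm (outer_normal \<Omega> y - m))\<^sup>2) x (8 * r)"
      have "ennreal (sqrt v) \<le> osc_norm F (outer_normal \<Omega>) x (r2 / 2)"
        unfolding osc_norm_def v_def m_def using r8 by (intro SUP_upper) auto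
      also have "\<dots> \<le> (SUP x\<in>F \<inter> K. osc_norm F (outer_normal \<Omega>) x (r2 / 2))"
        by (rule SUP_upper[OF x])
      also have "\<dots> < ennreal \<epsilon>" using r2 by simp
      finally have "sqrt v < \<epsilon>" by (meson ennreal_leI leD not_le)
      then have v: "v \<le> \<epsilon>\<^sup>2" using \<epsilon>(1) by (simp add: sqrt_le_D less_imp_le)
      have "v = (LINT y:ball x (8 * r)|M. (norm (sgn (g y) - m))\<^sup>2) /\<^sub>R measure M (ball x (8 * r))"
        unfolding v_def by (rule avg) measurable
      then have "(LINT y:ball x (8 * r)|M. (norm (sgn (g y) - m))\<^sup>2) \<le> \<epsilon>\<^sup>2 * measure M (ball x (8 * r))"
        using v ball_pos[of x "8 * r"] x r8 by (simp add: field_simps)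
      then obtain e where e: "norm e = 1"
        "(LINT y:ball x (8 * r)|M. norm (sgn (g y) - e)) \<le> 2 * \<epsilon> * measure M (ball x (8 * r))"
        using mean_direction[OF AE _ r8(1,3) \<epsilon>(1,2), of x m] x by blast
      show ?thesis
        by (rule flatness_le[OF AE _ r(1) r8(3) e(1) \<delta> _ e(2)])
          (use x \<epsilon> small in \<open>auto simp: a_def b_def\<close>)
    qed
    moreover have "r1 > 0" using r2(1) R0 by (simp add: r1_def)
    ultimately show ?thesis by blast
  qed
  have "((\<lambda>r. SUP x\<in>F \<inter> K. ennreal (flatness F x r)) \<longlongrightarrow> 0) (at_right 0)" if K: "compact K" for K
  proof (rule order_tendstoI)
    fix t :: ennreal assume "0 < t"
    \<comment> \<open>A finite value below \<open>t\<close>, which may be infinite, is extracted so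
      that the flatness can be compared with a real number.\<close>
    then obtain c where c: "0 < c" "c < t" using dense by blast
    then have "c < top" using less_le_trans top_greatest by blast
    then obtain u where u: "c = ennreal u" "0 \<le> u" by (cases c) auto
    then have "0 < u" using c by simp
    define \<delta> where "\<delta> = min (u / 5) (1 / 4)"
    have \<delta>: "0 < \<delta>" "\<delta> \<le> 1 / 4" "5 * \<delta> \<le> u" using \<open>0 < u\<close> by (auto simp: \<delta>_def)
    obtain r1 where r1: "r1 > 0" "\<And>x r. x \<in> F \<inter> K \<Longrightarrow> 0 < r \<Longrightarrow> r < r1 \<Longrightarrow> flatness F x r \<le> 5 * \<delta>"
      using flat[OF K \<delta>(1,2)] by blast
    have "(SUP x\<in>F \<inter> K. ennreal (flatness F x r)) < t" if "0 < r" "r < r1" for r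
    proof -
      have "flatness F x r \<le> u" if "x \<in> F \<inter> K" for x
        using r1(2)[OF that \<open>0 < r\<close> \<open>r < r1\<close>] \<delta>(3) by linarith
      then have "(SUP x\<in>F \<inter> K. ennreal (flatness F x r)) \<le> c"
        unfolding u(1) by (intro SUP_least ennreal_leI)
      then show ?thesis using c(2) by (rule le_less_trans)
    qed
    then show "\<forall>\<^sub>F r in at_right 0. (SUP x\<in>F \<inter> K. ennreal (flatness F x r)) < t"
      unfolding eventually_at_right_field using r1(1) by blast
  qed simp
  then show ?thesis
    using cF unfolding vanishing_reifenberg_flat_def F_def by blast
qed

theorem corollary3p11:
  fixes \<Omega> :: "(real ^ 'n) set"
  assumes "CARD('n) \<ge> 3"
    and "open \<Omega>" and "connected \<Omega>"
    and "essential_boundary \<Omega> = frontier \<Omega>"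
    and "ahlfors_regular (frontier \<Omega>)"
    and "VMO_loc (frontier \<Omega>) (outer_normal \<Omega>)"
  shows "vanishing_reifenberg_flat (frontier \<Omega>)"
  by (rule vmo_implies_flat) (use assms in auto)

end
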